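(* Let $N_s\ge4$ be even, $m=N_s/2$, let $U>0$, $t>0$, and consider the ground state of the Bose-Hubbard Hamiltonian on the periodic ring of $N_s$ sites with $N=N_s$ particles. Put $\varepsilon=\sqrt2\,t/U$ and $f(x)=4\cos^2x\,\ln(4\cos^2x)$ with the convention $0\ln0=0$. Let $S_{\mathrm{half}}$, $S_{\mathrm{even/odd}}$ and $S_{\mathrm{site}}$ be the entanglement entropies of $A=\{1,\dots,N_s/2\}$, of $A=\{1,3,\dots,N_s-1\}$ (equivalently, of its complement $\{2,4,\dots,N_s\}$), and of $A=\{1\}$, respectively. Then, for fixed $N_s$, as $\varepsilon\to0$, $$S_{\mathrm{half}}=4\varepsilon^2\Big(1+\ln\tfrac1{\varepsilon^2}\Big)+O(\varepsilon^3),$$ $$S_{\mathrm{even/odd}}=\varepsilon^2\Big[2N_s\Big(1+\ln\tfrac1{\varepsilon^2}\Big)-2\sum_{k=0}^{m-1}f\Big(\tfrac{\pi k}{m}\Big)\Big]+O(\varepsilon^3),$$ $$S_{\mathrm{site}}=4\varepsilon^2\Big(1+\ln\tfrac1{\varepsilon^2}\Big)-4\ln2\;\varepsilon^2+O(\varepsilon^3).$$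
   Context: The sites are $\Lambda=\{1,\dots,N_s\}$, with indices modulo $N_s$. With bosonic operators $\hat b_i,\hat b_i^\dagger$ and $\hat n_i=\hat b_i^\dagger\hat b_i$, the Hamiltonian is $$\mathcal{H}=-t\sum_{i=1}^{N_s}\left(\hat b_i^\dagger\hat b_{i+1}+\mathrm{H.c.}\right)+\frac U2\sum_{i=1}^{N_s}\hat n_i(\hat n_i-1),$$ restricted to the subspace of total particle number $N$. For $A\subset\Lambda$ and $B=\Lambda\setminus A$ the Fock space factorizes as $\mathcal{F}=\mathcal{F}_A\otimes\mathcal{F}_B$. The entanglement entropy is $S_A=-\mathrm{Tr}[\rho^A\ln\rho^A]$ with $\rho^A=\mathrm{Tr}_B|\psi_0\rangle\langle\psi_0|$, where $|\psi_0\rangle$ is the normalized ground state. *)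

theory Defs
  imports Complex_Main
begin

text \<open>
  A Fock basis vector is an occupation function \<open>n\<close>, vanishing off the sites under
  consideration; a state is its family of amplitudes \<open>\<psi> n = \<langle>n|\<psi>\<rangle>\<close>.
\<close>

type_synonym occ = "nat \<Rightarrow> nat"
type_synonym state = "occ \<Rightarrow> complex"

definition occs :: "nat set \<Rightarrow> occ set" where
  "occs A = {n. \<forall>i. i \<notin> A \<longrightarrow> n i = 0}"

definition occs_eq :: "nat set \<Rightarrow> nat \<Rightarrow> occ set" where
  "occs_eq A N = {n \<in> occs A. (\<Sum>i\<in>A. n i) = N}"

definition occs_le :: "nat set \<Rightarrow> nat \<Rightarrow> occ set" where
  "occs_le A N = {n \<in> occs A. (\<Sum>i\<in>A. n i) \<le> N}"

lemma finite_occs_le: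
  assumes "finite A"
  shows "finite (occs_le A N)"
proof -
  have "occs_le A N \<subseteq> {n. \<forall>i. (i \<in> A \<longrightarrow> n i \<in> {..N}) \<and> (i \<notin> A \<longrightarrow> n i = 0)}"
  proof (intro subsetI CollectI allI conjI impI)
    fix n i assume n: "n \<in> occs_le A N"
    show "n i \<in> {..N}" if "i \<in> A"
    proof -
      have "n i \<le> (\<Sum>j\<in>A. n j)"
        using assms that by (intro member_le_sum) auto
      then show ?thesis using n by (simp add: occs_le_def)
    qed
    show "n i = 0" if "i \<notin> A"
      using n that by (simp add: occs_le_def occs_def)
  qed
  then show ?thesis
    using finite_set_of_finite_funs[OF assms, of "{..N}" 0] finite_subset by blast
qed

lemma finite_occs_eq:
  assumes "finite A"
  shows "finite (occs_eq A N)"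
  by (rule finite_subset[OF _ finite_occs_le[OF assms, of N]])
    (auto simp: occs_eq_def occs_le_def)

text \<open>
  Amplitudes of \<open>b\<^sub>i \<psi>\<close> and \<open>b\<^sub>i\<^sup>\<dagger> \<psi>\<close>, obtained by pairing
  \<open>b\<^sub>i |n\<rangle> = \<surd>n\<^sub>i |n - e\<^sub>i\<rangle>\<close> and
  \<open>b\<^sub>i\<^sup>\<dagger> |n\<rangle> = \<surd>(n\<^sub>i + 1) |n + e\<^sub>i\<rangle>\<close> with a basis vector. In
  \<open>create\<close> the truncated subtraction at \<open>n i = 0\<close> is multiplied by \<open>sqrt 0 = 0\<close>.
\<close>

definition annihilate :: "nat \<Rightarrow> state \<Rightarrow> state" where
  "annihilate i \<psi> = (\<lambda>n. of_real (sqrt (real (n i + 1))) * \<psi> (n(i := n i + 1)))"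

definition create :: "nat \<Rightarrow> state \<Rightarrow> state" where
  "create i \<psi> = (\<lambda>n. of_real (sqrt (real (n i))) * \<psi> (n(i := n i - 1)))"

definition number :: "nat \<Rightarrow> state \<Rightarrow> state" where
  "number i \<psi> = create i (annihilate i \<psi>)"

definition next_site :: "nat \<Rightarrow> nat \<Rightarrow> nat" where
  "next_site Ns i = i mod Ns + 1"

definition bose_hubbard :: "nat \<Rightarrow> real \<Rightarrow> real \<Rightarrow> state \<Rightarrow> state" where
  "bose_hubbard Ns t U \<psi> = (\<lambda>n.
     - of_real t * (\<Sum>i = 1..Ns. create i (annihilate (next_site Ns i) \<psi>) n
                               + create (next_site Ns i) (annihilate i \<psi>) n)
     + of_real (U / 2) * (\<Sum>i = 1..Ns. number i (\<lambda>k. number i \<psi> k - \<psi> k) n))"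

definition sector :: "nat \<Rightarrow> nat \<Rightarrow> state set" where
  "sector Ns N = {\<psi>. \<forall>n. n \<notin> occs_eq {1..Ns} N \<longrightarrow> \<psi> n = 0}"

definition is_energy :: "nat \<Rightarrow> nat \<Rightarrow> real \<Rightarrow> real \<Rightarrow> real \<Rightarrow> bool" where
  "is_energy Ns N t U E \<longleftrightarrow>
     (\<exists>\<phi> \<in> sector Ns N. \<phi> \<noteq> (\<lambda>_. 0) \<and>
        bose_hubbard Ns t U \<phi> = (\<lambda>n. of_real E * \<phi> n))"

definition ground_state :: "nat \<Rightarrow> nat \<Rightarrow> real \<Rightarrow> real \<Rightarrow> state \<Rightarrow> bool" where
  "ground_state Ns N t U \<psi> \<longleftrightarrow>
     \<psi> \<in> sector Ns N \<and> (\<Sum>n \<in> occs_eq {1..Ns} N. (cmod (\<psi> n))\<^sup>2) = 1 \<and>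
     (\<exists>E. bose_hubbard Ns t U \<psi> = (\<lambda>n. of_real E * \<psi> n) \<and>
          (\<forall>E'. is_energy Ns N t U E' \<longrightarrow> E \<le> E'))"

text \<open>
  Operators on a space with finite orthonormal basis \<open>X\<close> are given by their matrix elements
  \<open>R a b = \<langle>a|R|b\<rangle>\<close>, relevant only for \<open>a, b \<in> X\<close>. The vectors of a
  diagonalizing orthonormal basis are indexed by \<open>X\<close> as well.
\<close>

definition spectral_decomposition ::
  "'a set \<Rightarrow> ('a \<Rightarrow> 'a \<Rightarrow> complex) \<Rightarrow> ('a \<Rightarrow> real) \<Rightarrow> ('a \<Rightarrow> 'a \<Rightarrow> complex) \<Rightarrow> bool" where
  "spectral_decomposition X R p v \<longleftrightarrow>
     (\<forall>j\<in>X. \<forall>k\<in>X. (\<Sum>a\<in>X. cnj (v j a) * v k a) = (if j = k then 1 else 0)) \<and>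
     (\<forall>a\<in>X. \<forall>b\<in>X. R a b = (\<Sum>k\<in>X. of_real (p k) * v k a * cnj (v k b)))"

text \<open>
  Functional calculus of a Hermitian operator. On \<open>X\<close> the result does not depend on the
  diagonalization that is chosen.
\<close>

definition op_fun ::
  "'a set \<Rightarrow> (real \<Rightarrow> real) \<Rightarrow> ('a \<Rightarrow> 'a \<Rightarrow> complex) \<Rightarrow> 'a \<Rightarrow> 'a \<Rightarrow> complex" where
  "op_fun X f R = (SOME F. \<exists>p v. spectral_decomposition X R p v \<and>
     F = (\<lambda>a b. \<Sum>k\<in>X. of_real (f (p k)) * v k a * cnj (v k b)))"

text \<open>
  Since \<open>ln 0 = 0\<close> in the library, a zero eigenvalue contributes \<open>0\<close> to
  \<open>R ln R\<close>, as it should.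
\<close>

definition von_neumann_entropy :: "'a set \<Rightarrow> ('a \<Rightarrow> 'a \<Rightarrow> complex) \<Rightarrow> real" where
  "von_neumann_entropy X R = - Re (\<Sum>a\<in>X. \<Sum>b\<in>X. R a b * op_fun X ln R b a)"

text \<open>
  \<open>Tr\<^sub>B |\<psi>\<rangle>\<langle>\<psi>|\<close> with \<open>B = {1..Ns} - A\<close>; for \<open>a\<close> supported on
  \<open>A\<close> and \<open>b\<close> on \<open>B\<close>, the basis vector \<open>a \<otimes> b\<close> has occupation
  \<open>\<lambda>i. a i + b i\<close>. In an \<open>N\<close>-particle state neither part holds more than \<open>N\<close>
  particles, so the local Fock spaces may be cut off there, which makes them finite-dimensional.
\<close>

definition reduced_density :: "nat \<Rightarrow> nat \<Rightarrow> nat set \<Rightarrow> state \<Rightarrow> occ \<Rightarrow> occ \<Rightarrow> complex" where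
  "reduced_density Ns N A \<psi> = (\<lambda>a a'.
     \<Sum>b \<in> occs_le ({1..Ns} - A) N. \<psi> (\<lambda>i. a i + b i) * cnj (\<psi> (\<lambda>i. a' i + b i)))"

definition entanglement_entropy :: "nat \<Rightarrow> nat \<Rightarrow> nat set \<Rightarrow> state \<Rightarrow> real" where
  "entanglement_entropy Ns N A \<psi> =
     von_neumann_entropy (occs_le A N) (reduced_density Ns N A \<psi>)"

text \<open>The convention \<open>0 ln 0 = 0\<close> holds automatically.\<close>

definition f_cos :: "real \<Rightarrow> real" where
  "f_cos x = 4 * (cos x)\<^sup>2 * ln (4 * (cos x)\<^sup>2)"

end

(*
  Let eps = sqrt 2 t / U.  The trial Mott state shows that the ground energy is nonpositive, so
  every other occupation is gapped by U, and the eigenvalue equation can be iterated directly: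
  up to a phase, the amplitude of a dipole (one particle hopped from a site to a neighbour) is
  eps + O(eps^3), the Mott amplitude is 1 + O(eps^2), and everything else is O(eps^2), even
  O(eps^3) when the number of particles on the odd sublattice has changed parity.

  Write psi as a matrix M from B to A, so that the reduced density matrix is R = M M*.  No
  eigenvalue perturbation theory is used.  If p are the eigenvalues of R and u_j are orthonormal
  trial vectors with guessed eigenvalues y_j, then weighting the scalar bounds
    p ln y + p - y <= p ln p <= p ln y + p - y + (p - y)^2 / y
  by |<v_k, u_j>|^2 bounds the entropy by Rayleigh quotients, defects and the purity alone.
  The trial vectors are the dipoles cut by the boundary of A, with y_j = eps^2 mu_j where mu_j
  are the positive eigenvalues of the matrix counting common neighbours in B (each occurs twice:
  surplus or hole in A), and the normalized column of M at the Mott state of B.  An O(eps^3)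
  error in the trace of the small eigenvalues would spoil the remainder by a factor ln eps; it
  is absent because terms of odd relative order change the sublattice parity.
*)

theory Submission
  imports Defs "HOL-Analysis.Analysis"
begin

section \<open>Inner products and the spectral theorem on a finite basis\<close>

text \<open>The target spectrum can be degenerate and close to eigenvalues of higher order, so
  following single eigenvalues would require gaps. Averages under |<v_k, u_j>|^2 require none, and
  they fix how accurate each quantity must be. An error in a Rayleigh quotient is multiplied by ln
  y, hence has to be O(eps^4); a defect enters squared and divided by y of order eps^2, so a
  residual vector of norm O(eps^3) is enough. The eigenvalue near 1 is treated differently in the
  two directions. For the upper bound on the sum of p ln p it gets no trial vector: p ln p <= p^2 -
  p agrees to first order at p = 1, and particle conservation splits the purity into two blocks
  whose traces are known. For the lower bound the Mott column gets level 1, and the trace that no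
  trial vector captures, O(eps^4), is compared with the level eps^3; this costs a multiple of eps^3
  for the level and eps^4 |ln eps| for the trace, both within the remainder.\<close>

definition ip :: "'a set \<Rightarrow> ('a \<Rightarrow> complex) \<Rightarrow> ('a \<Rightarrow> complex) \<Rightarrow> complex" where
  "ip X x y = (\<Sum>a\<in>X. cnj (x a) * y a)"

definition norm_sq :: "'a set \<Rightarrow> ('a \<Rightarrow> complex) \<Rightarrow> real" where
  "norm_sq X x = (\<Sum>a\<in>X. (cmod (x a))\<^sup>2)"

definition mat_vec :: "'a set \<Rightarrow> ('a \<Rightarrow> 'a \<Rightarrow> complex) \<Rightarrow> ('a \<Rightarrow> complex) \<Rightarrow> 'a \<Rightarrow> complex" where
  "mat_vec X R x = (\<lambda>a. \<Sum>b\<in>X. R a b * x b)"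

definition orthonormal :: "'a set \<Rightarrow> 'j set \<Rightarrow> ('j \<Rightarrow> 'a \<Rightarrow> complex) \<Rightarrow> bool" where
  "orthonormal X J u \<longleftrightarrow> (\<forall>j\<in>J. \<forall>k\<in>J. ip X (u j) (u k) = (if j = k then 1 else 0))"

lemma ip_self: "ip X x x = of_real (norm_sq X x)"
  by (simp add: ip_def norm_sq_def mult.commute complex_norm_square del: of_real_power)

lemma norm_sq_nonneg: "norm_sq X x \<ge> 0"
  by (simp add: norm_sq_def sum_nonneg)

lemma norm_sq_eq_0: "finite X \<Longrightarrow> norm_sq X x = 0 \<longleftrightarrow> (\<forall>a\<in>X. x a = 0)"
  by (simp add: norm_sq_def sum_nonneg_eq_0_iff)

lemma cnj_ip: "cnj (ip X x y) = ip X y x"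
  by (simp add: ip_def mult.commute)

lemma norm_sq_scale: "norm_sq X (\<lambda>a. c * x a) = (cmod c)\<^sup>2 * norm_sq X x"
  by (simp add: norm_sq_def norm_mult power_mult_distrib sum_distrib_left)

lemma ip_add_right: "ip X x (\<lambda>a. y a + z a) = ip X x y + ip X x z"
  by (simp add: ip_def algebra_simps sum.distrib)

lemma ip_add_left: "ip X (\<lambda>a. y a + z a) x = ip X y x + ip X z x"
  by (simp add: ip_def algebra_simps sum.distrib)

lemma ip_diff_right: "ip X x (\<lambda>a. y a - z a) = ip X x y - ip X x z"
  by (simp add: ip_def algebra_simps sum_subtractf)

lemma ip_diff_left: "ip X (\<lambda>a. y a - z a) x = ip X y x - ip X z x"
  by (simp add: ip_def algebra_simps sum_subtractf)

lemma ip_scale_right: "ip X x (\<lambda>a. c * y a) = c * ip X x y"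
  by (simp add: ip_def sum_distrib_left mult_ac)

lemma ip_scale_left: "ip X (\<lambda>a. c * y a) x = cnj c * ip X y x"
  by (simp add: ip_def sum_distrib_left mult_ac)

lemma ip_sum_right: "ip X x (\<lambda>a. \<Sum>j\<in>J. f j a) = (\<Sum>j\<in>J. ip X x (f j))"
  by (simp add: ip_def sum_distrib_left sum.swap[of _ J])

lemma ip_sum_left: "ip X (\<lambda>a. \<Sum>j\<in>J. f j a) x = (\<Sum>j\<in>J. ip X (f j) x)"
  by (simp add: ip_def sum_distrib_right sum.swap[of _ J])

lemmas ip_lin = ip_add_right ip_add_left ip_diff_right ip_diff_left ip_scale_right ip_scale_left
  ip_sum_right ip_sum_left

lemma ip_cong: "(\<And>a. a \<in> X \<Longrightarrow> x a = x' a) \<Longrightarrow> (\<And>a. a \<in> X \<Longrightarrow> y a = y' a) \<Longrightarrow> ip X x y = ip X x' y'"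
  by (simp add: ip_def)

lemma orthonormalD: "orthonormal X J u \<Longrightarrow> j \<in> J \<Longrightarrow> k \<in> J \<Longrightarrow> ip X (u j) (u k) = (if j = k then 1 else 0)"
  by (simp add: orthonormal_def)

text \<open>Pythagoras for the projection onto the span of the u_j. Bessel, Parseval and the
  counting arguments for completeness are all read off from this identity.\<close>

lemma residual_norm:
  assumes "finite J" "orthonormal X J u"
  shows "norm_sq X (\<lambda>a. x a - (\<Sum>j\<in>J. ip X (u j) x * u j a))
    = norm_sq X x - (\<Sum>j\<in>J. (cmod (ip X (u j) x))\<^sup>2)"
proof -
  let ?c = "\<lambda>j. ip X (u j) x"
  have sq: "cnj (?c j) * ?c j = of_real ((cmod (?c j))\<^sup>2)" for j
    by (metis complex_norm_square mult.commute)
  have "ip X (\<lambda>a. \<Sum>j\<in>J. ?c j * u j a) (\<lambda>a. \<Sum>j\<in>J. ?c j * u j a)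
      = (\<Sum>j\<in>J. \<Sum>k\<in>J. cnj (?c j) * (?c k * ip X (u j) (u k)))"
    unfolding ip_lin by (subst sum.swap) (simp add: sum_distrib_left mult_ac)
  also have "\<dots> = (\<Sum>j\<in>J. \<Sum>k\<in>J. if k = j then cnj (?c j) * ?c j else 0)"
    by (intro sum.cong) (auto simp: orthonormalD[OF assms(2)])
  finally have ww: "ip X (\<lambda>a. \<Sum>j\<in>J. ?c j * u j a) (\<lambda>a. \<Sum>j\<in>J. ?c j * u j a)
      = (\<Sum>j\<in>J. cnj (?c j) * ?c j)"
    using assms(1) by simp
  have "of_real (norm_sq X (\<lambda>a. x a - (\<Sum>j\<in>J. ?c j * u j a)))
      = (of_real (norm_sq X x - (\<Sum>j\<in>J. (cmod (?c j))\<^sup>2)) :: complex)"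
    unfolding ip_self[symmetric] ip_diff_left ip_diff_right ww
    by (simp add: ip_lin ip_self sq cnj_ip[of X _ x, symmetric] mult.commute[of _ "cnj _"] del: of_real_power)
  then show ?thesis
    by (simp only: of_real_eq_iff)
qed

lemma bessel:
  assumes "finite J" "orthonormal X J u"
  shows "(\<Sum>j\<in>J. (cmod (ip X (u j) x))\<^sup>2) \<le> norm_sq X x"
  using residual_norm[OF assms, of x]
    norm_sq_nonneg[of X "\<lambda>a. x a - (\<Sum>j\<in>J. ip X (u j) x * u j a)"] by linarith

lemma ip_indicator: "finite X \<Longrightarrow> a \<in> X \<Longrightarrow> ip X u (\<lambda>b. if b = a then 1 else 0) = cnj (u a)"
  by (simp add: ip_def if_distrib cong: if_cong)

lemma norm_sq_indicator: "finite X \<Longrightarrow> a \<in> X \<Longrightarrow> norm_sq X (\<lambda>b. if b = a then 1 else 0) = 1"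
  by (simp add: norm_sq_def if_distrib[of cmod] if_distrib[of "\<lambda>x. x\<^sup>2"] cong: if_cong)

lemma orthonormal_norm_sq: "orthonormal X J u \<Longrightarrow> j \<in> J \<Longrightarrow> norm_sq X (u j) = 1"
  using orthonormalD[of X J u j j] by (simp add: ip_self)

text \<open>Trace count: the squared residuals of the coordinate vectors add up to
  \<open>card X - card X = 0\<close>.\<close>

lemma orthonormal_complete:
  assumes X: "finite X" and v: "orthonormal X X v" and a: "a \<in> X" and b: "b \<in> X"
  shows "(\<Sum>k\<in>X. v k a * cnj (v k b)) = (if a = b then 1 else 0)"
proof -
  let ?e = "\<lambda>c b. if b = c then 1 else (0::complex)"
  define r where "r c = norm_sq X (\<lambda>b. ?e c b - (\<Sum>k\<in>X. ip X (v k) (?e c) * v k b))" for c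
  have r: "r c = 1 - (\<Sum>k\<in>X. (cmod (v k c))\<^sup>2)" if "c \<in> X" for c
  proof -
    show ?thesis
      unfolding r_def residual_norm[OF X v] using that X by (simp add: ip_indicator norm_sq_indicator)
  qed
  have "(\<Sum>c\<in>X. r c) = card X - (\<Sum>c\<in>X. \<Sum>k\<in>X. (cmod (v k c))\<^sup>2)"
    by (simp add: r sum_subtractf)
  also have "(\<Sum>c\<in>X. \<Sum>k\<in>X. (cmod (v k c))\<^sup>2) = (\<Sum>k\<in>X. norm_sq X (v k))"
    unfolding norm_sq_def by (rule sum.swap)
  also have "\<dots> = card X"
    by (simp add: orthonormal_norm_sq[OF v])
  finally have "(\<Sum>c\<in>X. r c) = 0"
    by simp
  then have "r b = 0"
    using X b by (subst (asm) sum_nonneg_eq_0_iff) (auto simp: r_def norm_sq_nonneg)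
  then have "?e b a = (\<Sum>k\<in>X. ip X (v k) (?e b) * v k a)"
    using X a unfolding r_def by (subst (asm) norm_sq_eq_0) auto
  then show ?thesis
    using X b by (simp add: ip_indicator mult.commute)
qed

lemma parseval:
  assumes X: "finite X" and v: "orthonormal X X v"
  shows "(\<Sum>k\<in>X. (cmod (ip X (v k) x))\<^sup>2) = norm_sq X x"
proof -
  have "(\<Sum>k\<in>X. ip X (v k) x * v k a) = x a" if a: "a \<in> X" for a
  proof -
    have "(\<Sum>k\<in>X. ip X (v k) x * v k a) = (\<Sum>b\<in>X. (\<Sum>k\<in>X. v k a * cnj (v k b)) * x b)"
      unfolding ip_def by (simp add: sum_distrib_right sum_distrib_left mult_ac) (rule sum.swap)
    also have "\<dots> = (\<Sum>b\<in>X. if b = a then x b else 0)"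
      by (intro sum.cong) (auto simp: orthonormal_complete[OF X v a])
    finally show ?thesis using X a by simp
  qed
  then have "norm_sq X (\<lambda>a. x a - (\<Sum>k\<in>X. ip X (v k) x * v k a)) = 0"
    using X by (simp add: norm_sq_eq_0)
  then show ?thesis
    using residual_norm[OF X v, of x] by simp
qed

section \<open>Spectral theorem by maximizing the quadratic form\<close>

definition hermitian :: "'a set \<Rightarrow> ('a \<Rightarrow> 'a \<Rightarrow> complex) \<Rightarrow> bool" where
  "hermitian X R \<longleftrightarrow> (\<forall>a\<in>X. \<forall>b\<in>X. R a b = cnj (R b a))"

lemma hermitian_ip:
  assumes "hermitian X R"
  shows "ip X x (mat_vec X R y) = ip X (mat_vec X R x) y"
proof -
  have "ip X x (mat_vec X R y) = (\<Sum>a\<in>X. \<Sum>b\<in>X. cnj (x a) * (R a b * y b))"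
    by (simp add: ip_def mat_vec_def sum_distrib_left)
  also have "\<dots> = (\<Sum>a\<in>X. \<Sum>b\<in>X. cnj (R b a * x a) * y b)"
  proof (intro sum.cong refl)
    fix a b assume "a \<in> X" "b \<in> X"
    then have "R a b = cnj (R b a)" using assms unfolding hermitian_def by blast
    then show "cnj (x a) * (R a b * y b) = cnj (R b a * x a) * y b" by simp
  qed
  also have "\<dots> = ip X (mat_vec X R x) y"
    unfolding ip_def mat_vec_def by (simp add: sum_distrib_right) (rule sum.swap)
  finally show ?thesis .
qed

lemma mat_vec_lin:
  "mat_vec X R (\<lambda>a. x a + y a) = (\<lambda>a. mat_vec X R x a + mat_vec X R y a)"
  "mat_vec X R (\<lambda>a. c * x a) = (\<lambda>a. c * mat_vec X R x a)"
  by (auto simp: mat_vec_def algebra_simps sum.distrib sum_distrib_left)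

text \<open>First variation. The residual g = (R - l) x is orthogonal to x and to every u_j, so x +
  s g is admissible for each s > 0. Maximality at x then gives 2 |g|^2 <= s k with k independent of
  s, and a small s forces g = 0.\<close>

lemma hermitian_rayleigh_maximizer:
  assumes R: "hermitian X R" and x: "norm_sq X x = 1" and xu: "\<forall>j\<in>J. ip X (u j) x = 0"
    and u: "\<forall>j\<in>J. \<forall>a\<in>X. mat_vec X R (u j) a = of_real (p j) * u j a" and X: "finite X"
    and mx: "\<And>y. (\<forall>a. a \<notin> X \<longrightarrow> y a = 0) \<Longrightarrow> (\<forall>j\<in>J. ip X (u j) y = 0)
      \<Longrightarrow> Re (ip X y (mat_vec X R y)) \<le> l * norm_sq X y"
    and xs: "\<forall>a. a \<notin> X \<longrightarrow> x a = 0"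
    and l: "l = Re (ip X x (mat_vec X R x))"
  shows "\<forall>a\<in>X. mat_vec X R x a = of_real l * x a"
proof -
  define g where "g a = (if a \<in> X then mat_vec X R x a - of_real l * x a else 0)" for a
  have real: "ip X y (mat_vec X R y) = of_real (Re (ip X y (mat_vec X R y)))" for y
  proof -
    have "cnj (ip X y (mat_vec X R y)) = ip X y (mat_vec X R y)"
      by (subst cnj_ip) (rule hermitian_ip[OF R, symmetric])
    then show ?thesis by (metis Reals_cnj_iff of_real_Re)
  qed
  have gx: "ip X z g = ip X z (mat_vec X R x) - of_real l * ip X z x" for z
    unfolding ip_scale_right[symmetric] ip_diff_right[symmetric]
    by (rule ip_cong) (auto simp: g_def)
  have xg: "ip X x g = 0"
    unfolding gx l by (subst real) (simp add: ip_self x)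
  have gx0: "ip X g x = 0"
    using xg by (metis cnj_ip complex_cnj_zero)
  have gu: "ip X (u j) g = 0" if "j \<in> J" for j
  proof -
    have "ip X (u j) (mat_vec X R x) = ip X (\<lambda>a. of_real (p j) * u j a) x"
      unfolding hermitian_ip[OF R] using u that by (intro ip_cong) auto
    then show ?thesis
      unfolding gx using xu that by (simp add: ip_scale_left)
  qed
  define k where "k = l * norm_sq X g - Re (ip X g (mat_vec X R g))"
  have gR: "ip X g (mat_vec X R x) = of_real (norm_sq X g)"
    using gx[of g] gx0 by (simp add: ip_self)
  have Rg: "ip X x (mat_vec X R g) = of_real (norm_sq X g)"
  proof -
    have "ip X x (mat_vec X R g) = cnj (ip X g (mat_vec X R x))"
      by (subst cnj_ip) (rule hermitian_ip[OF R])
    then show ?thesis by (simp add: gR)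
  qed
  have ineq: "2 * norm_sq X g \<le> s * k" if s: "s > 0" for s :: real
  proof -
    let ?y = "\<lambda>a. x a + of_real s * g a"
    have "Re (ip X ?y (mat_vec X R ?y)) \<le> l * norm_sq X ?y"
    proof (rule mx)
      show "\<forall>a. a \<notin> X \<longrightarrow> ?y a = 0" using xs by (simp add: g_def)
      show "\<forall>j\<in>J. ip X (u j) ?y = 0" using xu gu by (simp add: ip_add_right ip_scale_right)
    qed
    moreover have "Re (ip X ?y (mat_vec X R ?y)) = l + 2 * s * norm_sq X g + s\<^sup>2 * Re (ip X g (mat_vec X R g))"
      unfolding mat_vec_lin ip_add_left ip_add_right ip_scale_left ip_scale_right gR Rg
      by (simp add: l power2_eq_square algebra_simps)
    moreover have "(of_real (norm_sq X ?y) :: complex) = of_real (1 + s\<^sup>2 * norm_sq X g)"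
      unfolding ip_self[symmetric]
      unfolding ip_add_left ip_add_right ip_scale_left ip_scale_right xg gx0
      by (simp add: ip_self x power2_eq_square)
    then have "norm_sq X ?y = 1 + s\<^sup>2 * norm_sq X g"
      by (simp only: of_real_eq_iff)
    ultimately have "s * (2 * norm_sq X g) \<le> s * (s * k)"
      by (simp add: k_def algebra_simps power2_eq_square)
    then show ?thesis using s by (simp only: mult_le_cancel_left_pos)
  qed
  have "norm_sq X g \<le> 0"
  proof (rule ccontr)
    assume "\<not> norm_sq X g \<le> 0"
    then have n: "norm_sq X g > 0" by simp
    have kpos: "k > 0" using ineq[of 1] n by simp
    have "2 * norm_sq X g \<le> norm_sq X g"
      using ineq[of "norm_sq X g / k"] n kpos by simp
    then show False using n by simp
  qed
  then have "norm_sq X g = 0" using norm_sq_nonneg[of X g] by simp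
  then show ?thesis
    using X by (auto simp: norm_sq_eq_0 g_def)
qed

text \<open>Tychonoff for the product topology on functions. Vectors are functions on the whole
  type, so the coordinates outside X are pinned to 0; left free, they would destroy
  compactness.\<close>

lemma compact_unit_box: "compact {x :: 'a \<Rightarrow> complex. \<forall>a. x a \<in> (if a \<in> X then cball 0 1 else {0})}"
proof -
  have "compactin (product_topology (\<lambda>_. euclidean) UNIV)
    (PiE (UNIV :: 'a set) (\<lambda>a. if a \<in> X then cball (0::complex) 1 else {0}))"
    by (subst compactin_PiE) auto
  then show ?thesis
    by (simp add: euclidean_product_topology PiE_UNIV_domain Pi_def)
qed

text \<open>The projections of the coordinate vectors onto the span of the u_j have total squared
  norm card J < card X, so one of them has squared norm below 1; the residual of that coordinate
  vector is nonzero and is normalized.\<close>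

lemma orthogonal_unit_vector:
  assumes X: "finite X" and J: "finite J" and u: "orthonormal X J u" and c: "card J < card X"
  obtains x where "norm_sq X x = 1" "\<forall>j\<in>J. ip X (u j) x = 0" "\<forall>a. a \<notin> X \<longrightarrow> x a = 0"
proof -
  let ?e = "\<lambda>c b. if b = c then 1 else (0::complex)"
  have "(\<Sum>a\<in>X. \<Sum>j\<in>J. (cmod (u j a))\<^sup>2) = (\<Sum>j\<in>J. norm_sq X (u j))"
    unfolding norm_sq_def by (rule sum.swap)
  also have "\<dots> = card J" by (simp add: orthonormal_norm_sq[OF u])
  also have "\<dots> < (\<Sum>a\<in>X. 1)" using c by simp
  finally obtain a where a: "a \<in> X" "(\<Sum>j\<in>J. (cmod (u j a))\<^sup>2) < 1"
    by (meson not_le sum_mono)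
  define r where "r b = (if b \<in> X then ?e a b - (\<Sum>j\<in>J. ip X (u j) (?e a) * u j b) else 0)" for b
  have "norm_sq X r = norm_sq X (\<lambda>b. ?e a b - (\<Sum>j\<in>J. ip X (u j) (?e a) * u j b))"
    by (simp add: norm_sq_def r_def)
  also have "\<dots> = 1 - (\<Sum>j\<in>J. (cmod (u j a))\<^sup>2)"
    unfolding residual_norm[OF J u] using X a(1)
    by (simp add: ip_indicator norm_sq_indicator)
  finally have r: "norm_sq X r > 0" using a(2) by simp
  have ru: "ip X (u j) r = 0" if "j \<in> J" for j
  proof -
    have "ip X (u j) r = ip X (u j) (\<lambda>b. ?e a b - (\<Sum>k\<in>J. ip X (u k) (?e a) * u k b))"
      by (rule ip_cong) (auto simp: r_def)
    also have "\<dots> = ip X (u j) (?e a) - (\<Sum>k\<in>J. if k = j then ip X (u j) (?e a) else 0)"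
      unfolding ip_lin using that by (intro arg_cong2[of _ _ _ _ "(-)"] sum.cong refl)
        (auto simp: orthonormalD[OF u])
    finally show ?thesis using J that by simp
  qed
  let ?x = "\<lambda>b. of_real (1 / sqrt (norm_sq X r)) * r b"
  have "norm_sq X ?x = (1 / sqrt (norm_sq X r))\<^sup>2 * norm_sq X r"
    unfolding norm_sq_scale using r by (simp add: norm_divide)
  then have "norm_sq X ?x = 1" using r by (simp add: power_divide)
  moreover have "\<forall>j\<in>J. ip X (u j) ?x = 0"
    unfolding ip_scale_right using ru by simp
  moreover have "\<forall>a. a \<notin> X \<longrightarrow> ?x a = 0" by (simp add: r_def)
  ultimately show ?thesis by (rule that)
qed

text \<open>Maximizes the quadratic form over the compact set of unit vectors orthogonal to the
  eigenvectors already found; homogeneity carries the maximum property from unit vectors to all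
  admissible vectors.\<close>

lemma hermitian_next_eigenvector:
  assumes X: "finite X" and R: "hermitian X R" and J: "finite J" and c: "card J < card X"
    and u: "orthonormal X J u" and pu: "\<forall>j\<in>J. \<forall>a\<in>X. mat_vec X R (u j) a = of_real (p j) * u j a"
  obtains x l where "norm_sq X x = 1" "\<forall>j\<in>J. ip X (u j) x = 0"
    "\<forall>a\<in>X. mat_vec X R x a = of_real (l::real) * x a"
proof -
  define K where "K = {x. \<forall>a. x a \<in> (if a \<in> X then cball (0::complex) 1 else {0})} \<inter>
     {x. ip X x x = 1} \<inter> (\<Inter>j\<in>J. {x. ip X (u j) x = 0})"
  define q where "q x = Re (ip X x (mat_vec X R x))" for x
  have "compact K"
    unfolding K_def
    by (intro compact_Int_closed compact_unit_box closed_INT ballI closed_Collect_eq)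
       (auto simp: ip_def intro!: continuous_intros)
  moreover have "continuous_on K q"
    unfolding q_def ip_def mat_vec_def
    by (intro continuous_intros continuous_on_subset[OF continuous_on_product_coordinates subset_UNIV])
  moreover have unitK: "x \<in> K" if "norm_sq X x = 1" "\<forall>j\<in>J. ip X (u j) x = 0" "\<forall>a. a \<notin> X \<longrightarrow> x a = 0" for x
  proof -
    have "cmod (x a) \<le> 1" if a: "a \<in> X" for a
    proof -
      have "(cmod (x a))\<^sup>2 \<le> norm_sq X x"
        unfolding norm_sq_def by (rule member_le_sum) (use a X in auto)
      then show ?thesis using \<open>norm_sq X x = 1\<close> by (simp add: abs_square_le_1)
    qed
    then show ?thesis using that by (auto simp: K_def ip_self dist_norm)
  qed
  moreover obtain x0 where "norm_sq X x0 = 1" "\<forall>j\<in>J. ip X (u j) x0 = 0" "\<forall>a. a \<notin> X \<longrightarrow> x0 a = 0"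
    using orthogonal_unit_vector[OF X J u c] by blast
  ultimately obtain x where x: "x \<in> K" and mx: "\<And>y. y \<in> K \<Longrightarrow> q y \<le> q x"
    using continuous_attains_sup[of K q] by blast
  have "x a = 0" if "a \<notin> X" for a
  proof -
    have "x a \<in> (if a \<in> X then cball 0 1 else {0})" using x by (simp add: K_def)
    then show ?thesis using that by simp
  qed
  then have n: "norm_sq X x = 1" and o: "\<forall>j\<in>J. ip X (u j) x = 0" and s: "\<forall>a. a \<notin> X \<longrightarrow> x a = 0"
    using x by (auto simp: K_def ip_self)
  have "\<forall>a\<in>X. mat_vec X R x a = of_real (q x) * x a"
  proof (rule hermitian_rayleigh_maximizer[OF R n o pu X _ s])
    show "q x = Re (ip X x (mat_vec X R x))" by (simp add: q_def)
    fix y assume y: "\<forall>a. a \<notin> X \<longrightarrow> y a = 0" "\<forall>j\<in>J. ip X (u j) y = 0"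
    show "Re (ip X y (mat_vec X R y)) \<le> q x * norm_sq X y"
    proof (cases "norm_sq X y = 0")
      case True
      then have "ip X y (mat_vec X R y) = 0"
        using X by (simp add: norm_sq_eq_0 ip_def)
      then show ?thesis using True by simp
    next
      case False
      then have ny: "norm_sq X y > 0" using norm_sq_nonneg[of X y] by simp
      let ?t = "1 / sqrt (norm_sq X y)"
      let ?z = "\<lambda>a. of_real ?t * y a"
      have t2: "?t\<^sup>2 * norm_sq X y = 1" using ny by (simp add: power_divide)
      have "norm_sq X ?z = ?t\<^sup>2 * norm_sq X y"
        unfolding norm_sq_scale using ny by (simp add: norm_divide)
      then have "norm_sq X ?z = 1" using t2 by simp
      then have "?z \<in> K"
        using y by (intro unitK) (auto simp only: ip_scale_right mult_zero_right simp_thms)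
      from mx[OF this] have "q ?z \<le> q x" .
      also have "q ?z = ?t\<^sup>2 * Re (ip X y (mat_vec X R y))"
        by (simp add: q_def mat_vec_lin ip_lin power2_eq_square del: of_real_divide)
      finally have "?t\<^sup>2 * Re (ip X y (mat_vec X R y)) * norm_sq X y \<le> q x * norm_sq X y"
        using ny by simp
      also have "?t\<^sup>2 * Re (ip X y (mat_vec X R y)) * norm_sq X y = Re (ip X y (mat_vec X R y)) * (?t\<^sup>2 * norm_sq X y)"
        by (simp only: mult_ac)
      finally show ?thesis unfolding t2 by simp
    qed
  qed
  then show ?thesis using that n o by blast
qed

theorem hermitian_spectral_decomposition:
  assumes X: "finite X" and R: "hermitian X R"
  obtains p v where "spectral_decomposition X R p v"
proof -
  have "\<exists>u p. orthonormal X {..<n} u \<and> (\<forall>j<n. \<forall>a\<in>X. mat_vec X R (u j) a = of_real (p j :: real) * u j a)"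
    if "n \<le> card X" for n :: nat
    using that
  proof (induction n)
    case 0
    show ?case by (simp add: orthonormal_def)
  next
    case (Suc n)
    then obtain u and p :: "nat \<Rightarrow> real" where u: "orthonormal X {..<n} u"
      and p: "\<forall>j\<in>{..<n}. \<forall>a\<in>X. mat_vec X R (u j) a = of_real (p j) * u j a"
      by auto
    have c: "card {..<n} < card X" using Suc.prems by simp
    obtain x and l :: real
      where x: "norm_sq X x = 1" "\<forall>j\<in>{..<n}. ip X (u j) x = 0"
        "\<forall>a\<in>X. mat_vec X R x a = of_real l * x a"
      using hermitian_next_eigenvector[OF X R finite_lessThan c u p] by blast
    have x': "\<forall>j\<in>{..<n}. ip X x (u j) = 0" using x(2) by (metis cnj_ip complex_cnj_zero)
    have "orthonormal X {..<Suc n} (u(n := x))"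
      using u x(2) x' ip_self[of X x, unfolded x(1)] by (auto simp: orthonormal_def less_Suc_eq)
    moreover have "\<forall>j<Suc n. \<forall>a\<in>X. mat_vec X R ((u(n := x)) j) a = of_real ((p(n := l)) j) * (u(n := x)) j a"
      using p x(3) by (auto simp: less_Suc_eq)
    ultimately show ?case by blast
  qed
  then obtain u and p :: "nat \<Rightarrow> real" where u: "orthonormal X {..<card X} u"
    and p: "\<forall>j<card X. \<forall>a\<in>X. mat_vec X R (u j) a = of_real (p j) * u j a"
    by blast
  \<comment> \<open>The eigenvectors were found in sequence, whereas
    \<open>spectral_decomposition\<close> indexes them by X itself; any bijection relabels
    them.\<close>
  obtain h where h: "bij_betw h X {..<card X}"
    using ex_bij_betw_finite_nat[OF X] by (metis atLeast0LessThan)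
  define v where "v k = u (h k)" for k
  have v: "orthonormal X X v"
    unfolding orthonormal_def v_def
  proof (intro ballI)
    fix j k assume "j \<in> X" "k \<in> X"
    then have "h j \<in> {..<card X}" "h k \<in> {..<card X}" "h j = h k \<longleftrightarrow> j = k"
      using h by (auto simp: bij_betw_def inj_on_def)
    then show "ip X (u (h j)) (u (h k)) = (if j = k then 1 else 0)"
      using orthonormalD[OF u] by simp
  qed
  have pv: "mat_vec X R (v k) a = of_real (p (h k)) * v k a" if "k \<in> X" "a \<in> X" for k a
    using p h that by (auto simp: v_def bij_betw_def)
  have "R a b = (\<Sum>k\<in>X. of_real (p (h k)) * v k a * cnj (v k b))" if ab: "a \<in> X" "b \<in> X" for a b
  proof -
    have "R a b = (\<Sum>c\<in>X. if c = b then R a c else 0)"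
      using X ab by simp
    also have "\<dots> = (\<Sum>c\<in>X. R a c * (\<Sum>k\<in>X. v k c * cnj (v k b)))"
      by (intro sum.cong) (auto simp: orthonormal_complete[OF X v _ ab(2)])
    also have "\<dots> = (\<Sum>k\<in>X. mat_vec X R (v k) a * cnj (v k b))"
      by (simp add: mat_vec_def sum_distrib_left sum_distrib_right mult.assoc) (rule sum.swap)
    also have "\<dots> = (\<Sum>k\<in>X. of_real (p (h k)) * v k a * cnj (v k b))"
      using ab by (simp add: pv)
    finally show ?thesis .
  qed
  then have "spectral_decomposition X R (\<lambda>k. p (h k)) v"
    using v by (simp add: spectral_decomposition_def orthonormal_def ip_def)
  then show ?thesis by (rule that)
qed

section \<open>Entropy bounds from approximate eigenvectors\<close>

lemma spectral_orthonormal: "spectral_decomposition X R p v \<Longrightarrow> orthonormal X X v"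
  by (simp add: spectral_decomposition_def orthonormal_def ip_def)

text \<open>Trace of the product of two functions of one operator. With g = p it yields the trace of
  R ln R for h = ln p, and the purity for h = p.\<close>

lemma spectral_trace:
  assumes X: "finite X" and v: "orthonormal X X v"
  shows "(\<Sum>a\<in>X. \<Sum>b\<in>X. (\<Sum>k\<in>X. g k * v k a * cnj (v k b)) * (\<Sum>l\<in>X. h l * v l b * cnj (v l a)))
    = (\<Sum>k\<in>X. g k * h k)"
proof -
  have "(\<Sum>b\<in>X. (\<Sum>k\<in>X. g k * v k a * cnj (v k b)) * (\<Sum>l\<in>X. h l * v l b * cnj (v l a)))
      = (\<Sum>k\<in>X. g k * h k * (cnj (v k a) * v k a))" for a
  proof -
    have "(\<Sum>b\<in>X. (\<Sum>k\<in>X. g k * v k a * cnj (v k b)) * (\<Sum>l\<in>X. h l * v l b * cnj (v l a)))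
        = (\<Sum>b\<in>X. \<Sum>k\<in>X. \<Sum>l\<in>X. g k * h l * v k a * cnj (v l a) * (cnj (v k b) * v l b))"
      by (simp add: sum_product mult_ac)
    also have "\<dots> = (\<Sum>k\<in>X. \<Sum>l\<in>X. g k * h l * v k a * cnj (v l a) * ip X (v k) (v l))"
      unfolding ip_def sum_distrib_left
      by (rule trans[OF sum.swap]) (rule sum.cong[OF refl], rule sum.swap)
    also have "\<dots> = (\<Sum>k\<in>X. \<Sum>l\<in>X. if l = k then g k * h k * (cnj (v k a) * v k a) else 0)"
      by (intro sum.cong refl) (auto simp: orthonormalD[OF v])
    finally show ?thesis using X by simp
  qed
  then have "(\<Sum>a\<in>X. \<Sum>b\<in>X. (\<Sum>k\<in>X. g k * v k a * cnj (v k b)) * (\<Sum>l\<in>X. h l * v l b * cnj (v l a)))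
      = (\<Sum>a\<in>X. \<Sum>k\<in>X. g k * h k * (cnj (v k a) * v k a))"
    by simp
  also have "\<dots> = (\<Sum>k\<in>X. g k * h k * ip X (v k) (v k))"
    unfolding ip_def sum_distrib_left by (rule sum.swap)
  also have "\<dots> = (\<Sum>k\<in>X. g k * h k)"
    by (simp add: orthonormalD[OF v])
  finally show ?thesis .
qed

text \<open>The spectral theorem makes the choice in \<open>op_fun\<close> range over a nonempty
  set, so ln R comes with some decomposition of R, and this decomposition enters all later
  bounds.\<close>

lemma entropy_eq_eigenvalue_sum:
  assumes X: "finite X" and R: "hermitian X R"
  obtains p v where "spectral_decomposition X R p v"
    "von_neumann_entropy X R = - (\<Sum>k\<in>X. p k * ln (p k))"
proof -
  have "\<exists>F p v. spectral_decomposition X R p v \<and>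
     F = (\<lambda>a b. \<Sum>k\<in>X. of_real (ln (p k)) * v k a * cnj (v k b))"
    using hermitian_spectral_decomposition[OF assms] by metis
  then have "\<exists>p v. spectral_decomposition X R p v \<and>
     op_fun X ln R = (\<lambda>a b. \<Sum>k\<in>X. of_real (ln (p k)) * v k a * cnj (v k b))"
    unfolding op_fun_def by (rule someI_ex)
  then obtain p v where pv: "spectral_decomposition X R p v"
    and F: "op_fun X ln R = (\<lambda>a b. \<Sum>k\<in>X. of_real (ln (p k)) * v k a * cnj (v k b))"
    by blast
  have "(\<Sum>a\<in>X. \<Sum>b\<in>X. R a b * op_fun X ln R b a)
     = (\<Sum>a\<in>X. \<Sum>b\<in>X. (\<Sum>k\<in>X. of_real (p k) * v k a * cnj (v k b))
          * (\<Sum>l\<in>X. of_real (ln (p l)) * v l b * cnj (v l a)))"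
    using pv by (intro sum.cong refl) (simp add: F spectral_decomposition_def)
  also have "\<dots> = of_real (\<Sum>k\<in>X. p k * ln (p k))"
    by (simp add: spectral_trace[OF X spectral_orthonormal[OF pv]])
  finally have "von_neumann_entropy X R = - (\<Sum>k\<in>X. p k * ln (p k))"
    by (simp add: von_neumann_entropy_def)
  then show ?thesis using that pv by blast
qed

section \<open>Moments of the spectrum and two-sided bounds on the entropy\<close>

definition rayleigh :: "'a set \<Rightarrow> ('a \<Rightarrow> 'a \<Rightarrow> complex) \<Rightarrow> ('a \<Rightarrow> complex) \<Rightarrow> real" where
  "rayleigh X R x = Re (ip X x (mat_vec X R x))"

lemma spectral_mat_vec:
  assumes pv: "spectral_decomposition X R p v" and a: "a \<in> X"
  shows "mat_vec X R x a = (\<Sum>k\<in>X. of_real (p k) * ip X (v k) x * v k a)"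
proof -
  have "mat_vec X R x a = (\<Sum>b\<in>X. (\<Sum>k\<in>X. of_real (p k) * v k a * cnj (v k b)) * x b)"
    using pv a by (simp add: mat_vec_def spectral_decomposition_def)
  also have "\<dots> = (\<Sum>k\<in>X. of_real (p k) * ip X (v k) x * v k a)"
    unfolding ip_def sum_distrib_left sum_distrib_right
    by (subst sum.swap) (simp add: mult_ac)
  finally show ?thesis .
qed

lemma spectral_ip_mat_vec:
  assumes X: "finite X" and pv: "spectral_decomposition X R p v" and k: "k \<in> X"
  shows "ip X (v k) (mat_vec X R x) = of_real (p k) * ip X (v k) x"
proof -
  have "ip X (v k) (mat_vec X R x) = ip X (v k) (\<lambda>a. \<Sum>l\<in>X. (of_real (p l) * ip X (v l) x) * v l a)"
    by (rule ip_cong) (simp_all add: spectral_mat_vec[OF pv])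
  also have "\<dots> = (\<Sum>l\<in>X. if l = k then of_real (p k) * ip X (v k) x else 0)"
    unfolding ip_sum_right ip_scale_right
    by (intro sum.cong refl) (auto simp: orthonormalD[OF spectral_orthonormal[OF pv] k])
  finally show ?thesis using X k by simp
qed

text \<open>The numbers |<v_k, x>|^2 act as weights on the spectrum: the Rayleigh quotient is the
  first moment, and in \<open>spectral_defect\<close> the defect is the second moment about y.
  Averaging a scalar bound in p therefore produces quantities computable from x alone.\<close>

lemma spectral_rayleigh:
  assumes X: "finite X" and pv: "spectral_decomposition X R p v"
  shows "rayleigh X R x = (\<Sum>k\<in>X. p k * (cmod (ip X (v k) x))\<^sup>2)"
proof -
  have "ip X x (mat_vec X R x) = ip X x (\<lambda>a. \<Sum>l\<in>X. (of_real (p l) * ip X (v l) x) * v l a)"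
    by (rule ip_cong) (simp_all add: spectral_mat_vec[OF pv])
  also have "\<dots> = (\<Sum>k\<in>X. of_real (p k) * (ip X (v k) x * cnj (ip X (v k) x)))"
    unfolding ip_sum_right ip_scale_right cnj_ip by (simp add: mult_ac)
  also have "\<dots> = of_real (\<Sum>k\<in>X. p k * (cmod (ip X (v k) x))\<^sup>2)"
    by (simp add: complex_norm_square del: of_real_power)
  finally show ?thesis by (simp add: rayleigh_def)
qed

lemma spectral_defect:
  assumes X: "finite X" and pv: "spectral_decomposition X R p v"
  shows "norm_sq X (\<lambda>a. mat_vec X R x a - of_real y * x a) = (\<Sum>k\<in>X. (p k - y)\<^sup>2 * (cmod (ip X (v k) x))\<^sup>2)"
  unfolding parseval[OF X spectral_orthonormal[OF pv], symmetric]
proof (intro sum.cong refl)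
  fix k assume k: "k \<in> X"
  have "ip X (v k) (\<lambda>a. mat_vec X R x a - of_real y * x a) = of_real (p k - y) * ip X (v k) x"
    unfolding ip_diff_right ip_scale_right by (simp add: spectral_ip_mat_vec[OF X pv k] algebra_simps)
  then show "(cmod (ip X (v k) (\<lambda>a. mat_vec X R x a - of_real y * x a)))\<^sup>2 = (p k - y)\<^sup>2 * (cmod (ip X (v k) x))\<^sup>2"
    by (simp only: norm_mult norm_of_real power_mult_distrib power2_abs)
qed

text \<open>Tangent line of the convex function p ln p at y.\<close>

lemma entropy_lower_pointwise:
  fixes p y :: real
  assumes "p \<ge> 0" "y > 0"
  shows "p * ln y + p - y \<le> p * ln p"
proof (cases "p = 0")
  case False
  then have p: "p > 0" using assms by simp
  have "p * ln (y / p) \<le> p * (y / p - 1)"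
    using p assms by (intro mult_left_mono ln_le_minus_one) auto
  then show ?thesis using p assms by (simp add: ln_div algebra_simps)
qed (use assms in simp)

text \<open>From ln x <= x - 1 at x = p / y. The excess over the tangent line is the quadratic term,
  which averages to a defect divided by y.\<close>

lemma entropy_upper_pointwise:
  fixes p y :: real
  assumes "p \<ge> 0" "y > 0"
  shows "p * ln p \<le> p * ln y + p - y + (p - y)\<^sup>2 / y"
proof (cases "p = 0")
  case False
  then have p: "p > 0" using assms by simp
  have "p * ln (p / y) \<le> p * (p / y - 1)"
    using p assms by (intro mult_left_mono ln_le_minus_one) auto
  also have "p * (p / y - 1) = p - y + (p - y)\<^sup>2 / y"
    using assms by (simp add: field_simps power2_eq_square)
  finally show ?thesis using p assms by (simp add: ln_div algebra_simps)
qed (use assms in \<open>simp add: power2_eq_square\<close>)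

text \<open>
  In the upper bound the part of an eigenvector outside the span of the trial vectors is estimated
  by \<open>p ln p \<le> p\<^sup>2 - p\<close>, which costs only the purity. In the lower bound it is compared with a
  single small level \<open>z\<close>.
\<close>

lemma entropy_sum_upper:
  assumes X: "finite X" and pv: "spectral_decomposition X R p v"
    and p0: "\<And>k. k \<in> X \<Longrightarrow> p k \<ge> 0" and p1: "(\<Sum>k\<in>X. p k) = 1"
    and J: "finite J" and u: "orthonormal X J u" and y: "\<And>j. j \<in> J \<Longrightarrow> y j > 0"
  shows "(\<Sum>k\<in>X. p k * ln (p k)) \<le>
     (\<Sum>j\<in>J. rayleigh X R (u j) * ln (y j) + rayleigh X R (u j) - y j
        + norm_sq X (\<lambda>a. mat_vec X R (u j) a - of_real (y j) * u j a) / y j)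
     + (\<Sum>k\<in>X. (p k)\<^sup>2) - 1 + (\<Sum>j\<in>J. rayleigh X R (u j))"
proof -
  note v = spectral_orthonormal[OF pv]
  define c where "c k j = (cmod (ip X (v k) (u j)))\<^sup>2" for k j
  have c0: "c k j \<ge> 0" for k j by (simp add: c_def)
  have cs: "(\<Sum>j\<in>J. c k j) \<le> 1" if "k \<in> X" for k
  proof -
    have "(\<Sum>j\<in>J. c k j) = (\<Sum>j\<in>J. (cmod (ip X (u j) (v k)))\<^sup>2)"
      unfolding c_def by (subst cnj_ip[symmetric]) simp
    also have "\<dots> \<le> norm_sq X (v k)" by (rule bessel[OF J u])
    finally show ?thesis using orthonormal_norm_sq[OF v that] by simp
  qed
  have cn: "(\<Sum>k\<in>X. c k j) = 1" if "j \<in> J" for j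
    using parseval[OF X v, of "u j"] orthonormal_norm_sq[OF u that] by (simp add: c_def)
  have cr: "(\<Sum>k\<in>X. c k j * p k) = rayleigh X R (u j)" for j
    unfolding spectral_rayleigh[OF X pv] c_def by (simp add: mult.commute)
  have cd: "(\<Sum>k\<in>X. c k j * (p k - y j)\<^sup>2) = norm_sq X (\<lambda>a. mat_vec X R (u j) a - of_real (y j) * u j a)" for j
    unfolding spectral_defect[OF X pv] c_def by (simp add: mult.commute)
  have ple: "p k \<le> 1" if "k \<in> X" for k
    using member_le_sum[of k X p] p0 p1 X that by simp
  have pt: "p k * ln (p k) \<le>
      (\<Sum>j\<in>J. c k j * (p k * ln (y j) + p k - y j + (p k - y j)\<^sup>2 / y j)) + ((p k)\<^sup>2 - p k)
      + (\<Sum>j\<in>J. c k j * p k)" if k: "k \<in> X" for k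
  proof -
    have "p k * ln (p k) \<le> p k * ln 1 + p k - 1 + (p k - 1)\<^sup>2 / 1"
      by (rule entropy_upper_pointwise) (use p0[OF k] in auto)
    then have "p k * ln (p k) \<le> (p k)\<^sup>2 - p k" by (simp add: power2_eq_square algebra_simps)
    \<comment> \<open>Bessel makes the weight left over by the trial vectors nonnegative, so the
      crude estimate p^2 - p is spent only on this share of the eigenvector.\<close>
    then have "(1 - (\<Sum>j\<in>J. c k j)) * (p k * ln (p k)) \<le> (1 - (\<Sum>j\<in>J. c k j)) * ((p k)\<^sup>2 - p k)"
      by (intro mult_left_mono) (use cs[OF k] in auto)
    also have "\<dots> \<le> ((p k)\<^sup>2 - p k) + (\<Sum>j\<in>J. c k j) * p k"
      using mult_nonneg_nonneg[OF sum_nonneg[of J "c k"], of "(p k)\<^sup>2"] c0 by (simp add: algebra_simps)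
    finally have "p k * ln (p k) \<le> (\<Sum>j\<in>J. c k j * (p k * ln (p k))) + ((p k)\<^sup>2 - p k) + (\<Sum>j\<in>J. c k j * p k)"
      by (simp add: algebra_simps sum_distrib_left sum_distrib_right)
    also have "(\<Sum>j\<in>J. c k j * (p k * ln (p k))) \<le>
       (\<Sum>j\<in>J. c k j * (p k * ln (y j) + p k - y j + (p k - y j)\<^sup>2 / y j))"
      by (intro sum_mono mult_left_mono entropy_upper_pointwise) (use p0[OF k] y c0 in auto)
    finally show ?thesis by simp
  qed
  have "(\<Sum>k\<in>X. p k * ln (p k)) \<le> (\<Sum>k\<in>X.
      (\<Sum>j\<in>J. c k j * (p k * ln (y j) + p k - y j + (p k - y j)\<^sup>2 / y j)) + ((p k)\<^sup>2 - p k)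
      + (\<Sum>j\<in>J. c k j * p k))"
    by (rule sum_mono) (rule pt)
  also have "\<dots> = (\<Sum>j\<in>J. \<Sum>k\<in>X. c k j * (p k * ln (y j) + p k - y j + (p k - y j)\<^sup>2 / y j))
      + (\<Sum>k\<in>X. (p k)\<^sup>2) - 1 + (\<Sum>j\<in>J. \<Sum>k\<in>X. c k j * p k)"
    by (simp add: sum.distrib sum_subtractf p1 sum.swap[of _ X J])
  also have "(\<Sum>j\<in>J. \<Sum>k\<in>X. c k j * (p k * ln (y j) + p k - y j + (p k - y j)\<^sup>2 / y j))
     = (\<Sum>j\<in>J. (\<Sum>k\<in>X. c k j * p k) * ln (y j) + (\<Sum>k\<in>X. c k j * p k) - (\<Sum>k\<in>X. c k j) * y j
        + (\<Sum>k\<in>X. c k j * (p k - y j)\<^sup>2) / y j)"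
    by (intro sum.cong refl)
      (simp add: sum_distrib_right sum_distrib_left sum_divide_distrib algebra_simps sum.distrib sum_subtractf)
  also have "\<dots> = (\<Sum>j\<in>J. rayleigh X R (u j) * ln (y j) + rayleigh X R (u j) - y j
        + norm_sq X (\<lambda>a. mat_vec X R (u j) a - of_real (y j) * u j a) / y j)"
    by (intro sum.cong refl) (simp add: cr cd cn)
  finally show ?thesis by (simp add: cr)
qed

text \<open>The level z trades two costs: each eigenvector loses at most z through the tangent line,
  hence \<open>card X * z\<close>, while the trace not captured by the trial vectors is multiplied
  by ln z.\<close>

lemma entropy_sum_lower:
  fixes z :: real
  assumes X: "finite X" and pv: "spectral_decomposition X R p v"
    and p0: "\<And>k. k \<in> X \<Longrightarrow> p k \<ge> 0" and p1: "(\<Sum>k\<in>X. p k) = 1"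
    and J: "finite J" and u: "orthonormal X J u" and y: "\<And>j. j \<in> J \<Longrightarrow> y j > 0" and z: "z > 0"
  shows "(\<Sum>k\<in>X. p k * ln (p k)) \<ge>
     (\<Sum>j\<in>J. rayleigh X R (u j) * ln (y j) - y j) + 1
      + (1 - (\<Sum>j\<in>J. rayleigh X R (u j))) * ln z - card X * z"
proof -
  note v = spectral_orthonormal[OF pv]
  define c where "c k j = (cmod (ip X (v k) (u j)))\<^sup>2" for k j
  have c0: "c k j \<ge> 0" for k j by (simp add: c_def)
  have cs: "(\<Sum>j\<in>J. c k j) \<le> 1" if "k \<in> X" for k
  proof -
    have "(\<Sum>j\<in>J. c k j) = (\<Sum>j\<in>J. (cmod (ip X (u j) (v k)))\<^sup>2)"
      unfolding c_def by (subst cnj_ip[symmetric]) simp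
    also have "\<dots> \<le> norm_sq X (v k)" by (rule bessel[OF J u])
    finally show ?thesis using orthonormal_norm_sq[OF v that] by simp
  qed
  have cn: "(\<Sum>k\<in>X. c k j) = 1" if "j \<in> J" for j
    using parseval[OF X v, of "u j"] orthonormal_norm_sq[OF u that] by (simp add: c_def)
  have cr: "(\<Sum>k\<in>X. c k j * p k) = rayleigh X R (u j)" for j
    unfolding spectral_rayleigh[OF X pv] c_def by (simp add: mult.commute)
  have pt: "p k * ln (p k) \<ge> (\<Sum>j\<in>J. c k j * (p k * ln (y j) + p k - y j))
      + p k * ln z + p k - (\<Sum>j\<in>J. c k j * (p k * ln z + p k)) - z" if k: "k \<in> X" for k
  proof -
    have s0: "(\<Sum>j\<in>J. c k j) \<ge> 0" by (simp add: sum_nonneg c0)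
    have "(1 - (\<Sum>j\<in>J. c k j)) * (p k * ln z + p k - z) \<le> (1 - (\<Sum>j\<in>J. c k j)) * (p k * ln (p k))"
      by (intro mult_left_mono entropy_lower_pointwise) (use cs[OF k] p0[OF k] z in auto)
    moreover have "(\<Sum>j\<in>J. c k j * (p k * ln (p k))) \<ge> (\<Sum>j\<in>J. c k j * (p k * ln (y j) + p k - y j))"
      by (intro sum_mono mult_left_mono entropy_lower_pointwise) (use p0[OF k] y c0 in auto)
    moreover have "(\<Sum>j\<in>J. c k j) * z \<ge> 0" using s0 z by simp
    ultimately show ?thesis
      by (simp add: algebra_simps sum_distrib_left sum_distrib_right sum.distrib)
  qed
  have "(\<Sum>k\<in>X. p k * ln (p k)) \<ge> (\<Sum>k\<in>X. (\<Sum>j\<in>J. c k j * (p k * ln (y j) + p k - y j))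
      + p k * ln z + p k - (\<Sum>j\<in>J. c k j * (p k * ln z + p k)) - z)"
    by (rule sum_mono) (rule pt)
  also have "(\<Sum>k\<in>X. (\<Sum>j\<in>J. c k j * (p k * ln (y j) + p k - y j))
      + p k * ln z + p k - (\<Sum>j\<in>J. c k j * (p k * ln z + p k)) - z)
     = (\<Sum>j\<in>J. \<Sum>k\<in>X. c k j * (p k * ln (y j) + p k - y j)) + ln z + 1
      - (\<Sum>j\<in>J. \<Sum>k\<in>X. c k j * (p k * ln z + p k)) - card X * z"
    by (simp add: sum.distrib sum_subtractf p1 sum.swap[of _ X J] flip: sum_distrib_right)
  also have "(\<Sum>j\<in>J. \<Sum>k\<in>X. c k j * (p k * ln (y j) + p k - y j))
     = (\<Sum>j\<in>J. (\<Sum>k\<in>X. c k j * p k) * ln (y j) + (\<Sum>k\<in>X. c k j * p k) - (\<Sum>k\<in>X. c k j) * y j)"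
    by (intro sum.cong refl)
      (simp add: sum_distrib_right sum_distrib_left algebra_simps sum.distrib sum_subtractf)
  also have "\<dots> = (\<Sum>j\<in>J. rayleigh X R (u j) * ln (y j) + rayleigh X R (u j) - y j)"
    by (intro sum.cong refl) (simp add: cr cn)
  also have "(\<Sum>j\<in>J. \<Sum>k\<in>X. c k j * (p k * ln z + p k)) = (\<Sum>j\<in>J. (\<Sum>k\<in>X. c k j * p k) * (ln z + 1))"
    by (intro sum.cong refl) (simp add: sum_distrib_right sum_distrib_left algebra_simps sum.distrib)
  also have "\<dots> = (\<Sum>j\<in>J. rayleigh X R (u j)) * (ln z + 1)"
    by (simp add: cr sum_distrib_right)
  finally show ?thesis
    by (simp add: algebra_simps sum.distrib sum_subtractf)
qed

section \<open>Gram matrices and the entropy to third order in eps\<close>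

definition gram :: "'b set \<Rightarrow> ('a \<Rightarrow> 'b \<Rightarrow> complex) \<Rightarrow> 'a \<Rightarrow> 'a \<Rightarrow> complex" where
  "gram Y M = (\<lambda>a a'. \<Sum>b\<in>Y. M a b * cnj (M a' b))"

text \<open>Diagonal entry of M times its adjoint: for a normalized state, the probability of
  finding the part A in configuration a.\<close>

definition mass :: "'b set \<Rightarrow> ('a \<Rightarrow> 'b \<Rightarrow> complex) \<Rightarrow> 'a \<Rightarrow> real" where
  "mass Y M a = (\<Sum>b\<in>Y. (cmod (M a b))\<^sup>2)"

lemma mass_nonneg: "mass Y M a \<ge> 0"
  by (simp add: mass_def sum_nonneg)

lemma hermitian_gram: "hermitian X (gram Y M)"
  by (simp add: hermitian_def gram_def mult.commute)

lemma gram_diag: "gram Y M a a = of_real (mass Y M a)"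
  by (simp add: gram_def mass_def complex_norm_square del: of_real_power)

text \<open>The quadratic form of M times its adjoint is the squared norm of the adjoint applied to
  x. Column by column this gives positivity, and later the share of the trace held by the main
  Schmidt vector.\<close>

lemma rayleigh_gram: "rayleigh X (gram Y M) x = (\<Sum>b\<in>Y. (cmod (\<Sum>a\<in>X. cnj (x a) * M a b))\<^sup>2)"
proof -
  have "ip X x (mat_vec X (gram Y M) x)
     = (\<Sum>a\<in>X. \<Sum>a'\<in>X. \<Sum>b\<in>Y. (cnj (x a) * M a b) * cnj (cnj (x a') * M a' b))"
    by (simp add: ip_def mat_vec_def gram_def sum_distrib_left sum_distrib_right mult_ac)
  also have "\<dots> = (\<Sum>b\<in>Y. (\<Sum>a\<in>X. cnj (x a) * M a b) * cnj (\<Sum>a\<in>X. cnj (x a) * M a b))"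
    unfolding cnj_sum sum_product
    by (rule trans[OF sum.cong[OF refl sum.swap] sum.swap])
  also have "\<dots> = of_real (\<Sum>b\<in>Y. (cmod (\<Sum>a\<in>X. cnj (x a) * M a b))\<^sup>2)"
    by (simp add: complex_norm_square del: of_real_power cnj_sum)
  finally show ?thesis by (simp add: rayleigh_def)
qed

lemma gram_cauchy_schwarz: "(cmod (gram Y M a a'))\<^sup>2 \<le> mass Y M a * mass Y M a'"
proof -
  have "cmod (gram Y M a a') \<le> (\<Sum>b\<in>Y. cmod (M a b) * cmod (M a' b))"
    unfolding gram_def by (rule order_trans[OF norm_sum]) (simp add: norm_mult)
  then have "(cmod (gram Y M a a'))\<^sup>2 \<le> (\<Sum>b\<in>Y. cmod (M a b) * cmod (M a' b))\<^sup>2"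
    by (intro power_mono) auto
  also have "\<dots> \<le> mass Y M a * mass Y M a'"
    unfolding mass_def by (rule Cauchy_Schwarz_ineq_sum)
  finally show ?thesis .
qed

text \<open>Stands in for knowledge of the eigenvalues: apart from Rayleigh quotients and defects,
  the entropy bounds see p only through these three facts, all expressed by matrix elements.\<close>

lemma spectral_gram:
  assumes X: "finite X" and pv: "spectral_decomposition X (gram Y M) p v"
  shows "\<And>k. k \<in> X \<Longrightarrow> p k \<ge> 0" and "(\<Sum>k\<in>X. p k) = (\<Sum>a\<in>X. mass Y M a)"
    and "(\<Sum>k\<in>X. (p k)\<^sup>2) = (\<Sum>a\<in>X. \<Sum>a'\<in>X. (cmod (gram Y M a a'))\<^sup>2)"
proof -
  note v = spectral_orthonormal[OF pv]
  show "p k \<ge> 0" if k: "k \<in> X" for k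
  proof -
    have "rayleigh X (gram Y M) (v k) = (\<Sum>l\<in>X. if l = k then p k else 0)"
      unfolding spectral_rayleigh[OF X pv]
      by (intro sum.cong refl) (auto simp: orthonormalD[OF v _ k])
    then have "p k = rayleigh X (gram Y M) (v k)" using X k by simp
    then show ?thesis by (simp add: rayleigh_gram sum_nonneg)
  qed
  have "(\<Sum>a\<in>X. gram Y M a a) = (\<Sum>a\<in>X. \<Sum>k\<in>X. of_real (p k) * v k a * cnj (v k a))"
    using pv by (simp add: spectral_decomposition_def)
  also have "\<dots> = (\<Sum>k\<in>X. of_real (p k) * ip X (v k) (v k))"
    unfolding ip_def sum_distrib_left by (subst sum.swap) (simp add: mult_ac)
  also have "\<dots> = of_real (\<Sum>k\<in>X. p k)"
    by (simp add: orthonormalD[OF v])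
  finally show "(\<Sum>k\<in>X. p k) = (\<Sum>a\<in>X. mass Y M a)"
    by (simp add: gram_diag flip: of_real_sum)
  have "(\<Sum>a\<in>X. \<Sum>a'\<in>X. gram Y M a a' * gram Y M a' a) = (\<Sum>a\<in>X. \<Sum>a'\<in>X. (\<Sum>k\<in>X. of_real (p k) * v k a * cnj (v k a'))
          * (\<Sum>l\<in>X. of_real (p l) * v l a' * cnj (v l a)))"
    using pv by (intro sum.cong refl) (simp add: spectral_decomposition_def)
  also have "\<dots> = (\<Sum>k\<in>X. of_real (p k) * of_real (p k))"
    by (rule spectral_trace[OF X v])
  finally have "of_real (\<Sum>k\<in>X. (p k)\<^sup>2) = (\<Sum>a\<in>X. \<Sum>a'\<in>X. gram Y M a a' * gram Y M a' a)"
    by (simp add: power2_eq_square)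
  also have "\<dots> = (\<Sum>a\<in>X. \<Sum>a'\<in>X. gram Y M a a' * cnj (gram Y M a a'))"
    by (simp add: gram_def mult.commute)
  also have "\<dots> = of_real (\<Sum>a\<in>X. \<Sum>a'\<in>X. (cmod (gram Y M a a'))\<^sup>2)"
    by (simp add: complex_norm_square del: of_real_power)
  finally show "(\<Sum>k\<in>X. (p k)\<^sup>2) = (\<Sum>a\<in>X. \<Sum>a'\<in>X. (cmod (gram Y M a a'))\<^sup>2)"
    by (simp only: of_real_eq_iff)
qed

text \<open>Cauchy-Schwarz in each block, so that the traces of the blocks suffice.\<close>

lemma purity_block_bound:
  assumes X: "finite X" and X1: "X1 \<subseteq> X"
    and z: "\<And>a a'. a \<in> X1 \<Longrightarrow> a' \<in> X - X1 \<Longrightarrow> gram Y M a a' = 0"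
  shows "(\<Sum>a\<in>X. \<Sum>a'\<in>X. (cmod (gram Y M a a'))\<^sup>2)
    \<le> (\<Sum>a\<in>X - X1. mass Y M a)\<^sup>2 + (\<Sum>a\<in>X1. mass Y M a)\<^sup>2"
proof -
  have z': "gram Y M a' a = 0" if "a \<in> X1" "a' \<in> X - X1" for a a'
  proof -
    have "gram Y M a' a = cnj (gram Y M a a')" by (simp add: gram_def mult.commute)
    then show ?thesis using z[OF that] by simp
  qed
  have split: "(\<Sum>a\<in>X. f a) = (\<Sum>a\<in>X - X1. f a) + (\<Sum>a\<in>X1. f a)" for f :: "'a \<Rightarrow> real"
    by (rule sum.subset_diff[OF X1 X])
  have sq: "(\<Sum>a\<in>S. \<Sum>a'\<in>S. (cmod (gram Y M a a'))\<^sup>2) \<le> (\<Sum>a\<in>S. mass Y M a)\<^sup>2" for S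
    unfolding power2_eq_square[of "sum _ _"] sum_product
    by (intro sum_mono gram_cauchy_schwarz)
  have "(\<Sum>a\<in>X. \<Sum>a'\<in>X. (cmod (gram Y M a a'))\<^sup>2)
     = (\<Sum>a\<in>X - X1. \<Sum>a'\<in>X - X1. (cmod (gram Y M a a'))\<^sup>2) + (\<Sum>a\<in>X1. \<Sum>a'\<in>X1. (cmod (gram Y M a a'))\<^sup>2)"
    using z z' by (simp add: split)
  then show ?thesis using sq[of "X - X1"] sq[of X1] by linarith
qed

text \<open>Crude use of ln (1 / eps) <= 1 / eps: spending one power of eps on the logarithm turns
  an O(eps^4) error of a Rayleigh quotient into the admissible O(eps^3).\<close>

lemma abs_ln_scaled_square_bound:
  fixes \<epsilon> \<mu> :: real
  assumes "0 < \<epsilon>" "\<epsilon> \<le> 1" "\<mu> > 0"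
  shows "\<bar>ln (\<epsilon>\<^sup>2 * \<mu>)\<bar> \<le> (2 + \<bar>ln \<mu>\<bar>) / \<epsilon>"
proof -
  have "ln (1 / \<epsilon>) \<le> 1 / \<epsilon> - 1" using assms by (intro ln_le_minus_one) auto
  then have a: "- ln \<epsilon> \<le> 1 / \<epsilon>" using assms by (simp add: ln_div)
  have b: "ln \<epsilon> \<le> 0" using assms by simp
  have "\<bar>ln \<mu>\<bar> * \<epsilon> \<le> \<bar>ln \<mu>\<bar> * 1" using assms by (intro mult_left_mono) auto
  then have c: "\<bar>ln \<mu>\<bar> \<le> \<bar>ln \<mu>\<bar> / \<epsilon>" using assms by (simp add: pos_le_divide_eq)
  have "ln (\<epsilon>\<^sup>2 * \<mu>) = 2 * ln \<epsilon> + ln \<mu>" using assms by (simp add: ln_mult ln_realpow)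
  then have "\<bar>ln (\<epsilon>\<^sup>2 * \<mu>)\<bar> \<le> 2 * (1 / \<epsilon>) + \<bar>ln \<mu>\<bar> / \<epsilon>" using a b c by linarith
  then show ?thesis by (simp add: add_divide_distrib)
qed

text \<open>The constant adds the costs of both directions: the terms with |ln \<mu>| come from
  Rayleigh errors times ln y, \<open>K / \<mu> j\<close> from defects divided by y, the squared
  bracket from the quadratic part of the purity, the factor 3 from leftover trace times ln (eps^3),
  and \<open>card X\<close> from the level eps^3 itself.\<close>

lemma gram_entropy_bound:
  fixes \<epsilon> K :: real and \<mu> :: "'j \<Rightarrow> real"
  assumes X: "finite X" and X1: "X1 \<subseteq> X" and J: "finite J" and u: "orthonormal X J u"
    and \<mu>: "\<And>j. j \<in> J \<Longrightarrow> \<mu> j > 0" and K: "K \<ge> 0" and \<epsilon>: "0 < \<epsilon>" "\<epsilon> \<le> 1"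
    and tr: "(\<Sum>a\<in>X. mass Y M a) = 1"
    and block: "\<And>a a'. a \<in> X1 \<Longrightarrow> a' \<in> X - X1 \<Longrightarrow> gram Y M a a' = 0"
    and supp: "\<And>j a. j \<in> J \<Longrightarrow> a \<in> X - X1 \<Longrightarrow> u j a = 0"
    and defect: "\<And>j. j \<in> J \<Longrightarrow>
      norm_sq X (\<lambda>a. mat_vec X (gram Y M) (u j) a - of_real (\<epsilon>\<^sup>2 * \<mu> j) * u j a) \<le> K * \<epsilon> ^ 6"
    and ray: "\<And>j. j \<in> J \<Longrightarrow> \<bar>rayleigh X (gram Y M) (u j) - \<epsilon>\<^sup>2 * \<mu> j\<bar> \<le> K * \<epsilon> ^ 4"
    and outer: "\<bar>(\<Sum>a\<in>X1. mass Y M a) - \<epsilon>\<^sup>2 * (\<Sum>j\<in>J. \<mu> j)\<bar> \<le> K * \<epsilon> ^ 4"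
    and w1: "norm_sq X w = 1" and w0: "\<And>a. a \<in> X1 \<Longrightarrow> w a = 0"
    and wray: "1 - (\<Sum>a\<in>X1. mass Y M a) - K * \<epsilon> ^ 4 \<le> rayleigh X (gram Y M) w"
  shows "\<bar>von_neumann_entropy X (gram Y M)
      - (\<Sum>j\<in>J. \<epsilon>\<^sup>2 * \<mu> j * (1 - ln (\<epsilon>\<^sup>2 * \<mu> j)))\<bar>
    \<le> ((\<Sum>j\<in>J. K * (2 + \<bar>ln (\<mu> j)\<bar>) + 2 * K + K / \<mu> j) + 2 * K + 2 * ((\<Sum>j\<in>J. \<mu> j) + K)\<^sup>2
        + 3 * (2 * K + card J * K) + card X) * \<epsilon> ^ 3"
proof -
  define y where "y j = \<epsilon>\<^sup>2 * \<mu> j" for j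
  define r where "r j = rayleigh X (gram Y M) (u j)" for j
  define r0 where "r0 = rayleigh X (gram Y M) w"
  define \<tau> where "\<tau> = (\<Sum>a\<in>X1. mass Y M a)"
  define m where "m = (\<Sum>j\<in>J. \<mu> j)"
  have y: "y j > 0" if "j \<in> J" for j using \<mu>[OF that] \<epsilon> by (simp add: y_def)
  have m: "m \<ge> 0" unfolding m_def by (rule sum_nonneg) (simp add: \<mu> less_imp_le)
  have sy: "(\<Sum>j\<in>J. y j) = \<epsilon>\<^sup>2 * m" by (simp add: y_def m_def sum_distrib_left)
  have e43: "\<epsilon> ^ 4 \<le> \<epsilon> ^ 3" and e42: "\<epsilon> ^ 4 \<le> \<epsilon> ^ 2" using \<epsilon> by (auto intro!: power_decreasing)
  have Ke: "K * \<epsilon> ^ 4 \<le> K * \<epsilon> ^ 3" "K * \<epsilon> ^ 4 \<le> K * \<epsilon> ^ 2"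
    using e43 e42 K by (auto intro: mult_left_mono)
  have e34: "\<epsilon> ^ 4 / \<epsilon> = \<epsilon> ^ 3" using \<epsilon> by (simp add: eval_nat_numeral)
  have ry: "\<bar>r j - y j\<bar> \<le> K * \<epsilon> ^ 4" if "j \<in> J" for j using ray[OF that] by (simp add: r_def y_def)
  have rln: "\<bar>r j * ln (y j) - y j * ln (y j)\<bar> \<le> K * (2 + \<bar>ln (\<mu> j)\<bar>) * \<epsilon> ^ 3" if j: "j \<in> J" for j
  proof -
    have "\<bar>r j * ln (y j) - y j * ln (y j)\<bar> = \<bar>r j - y j\<bar> * \<bar>ln (y j)\<bar>"
      by (simp add: left_diff_distrib flip: abs_mult)
    also have "\<dots> \<le> (K * \<epsilon> ^ 4) * ((2 + \<bar>ln (\<mu> j)\<bar>) / \<epsilon>)"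
      using abs_ln_scaled_square_bound[OF \<epsilon> \<mu>[OF j]] ry[OF j] K \<epsilon>
      by (intro mult_mono) (auto simp: y_def)
    also have "\<dots> = K * (2 + \<bar>ln (\<mu> j)\<bar>) * (\<epsilon> ^ 4 / \<epsilon>)" by simp
    finally show ?thesis unfolding e34 .
  qed
  have \<tau>: "\<bar>\<tau> - \<epsilon>\<^sup>2 * m\<bar> \<le> K * \<epsilon> ^ 4" using outer by (simp add: \<tau>_def m_def)
  have \<tau>0: "\<tau> \<ge> 0" by (simp add: \<tau>_def sum_nonneg mass_nonneg)
  obtain p v where pv: "spectral_decomposition X (gram Y M) p v"
    and S: "von_neumann_entropy X (gram Y M) = - (\<Sum>k\<in>X. p k * ln (p k))"
    using entropy_eq_eigenvalue_sum[OF X hermitian_gram] by blast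
  note sp = spectral_gram[OF X pv]
  have p1: "(\<Sum>k\<in>X. p k) = 1" using sp(2) tr by simp

  have "(\<Sum>k\<in>X. (p k)\<^sup>2) \<le> (\<Sum>a\<in>X - X1. mass Y M a)\<^sup>2 + \<tau>\<^sup>2"
    unfolding sp(3) \<tau>_def by (rule purity_block_bound[OF X X1 block])
  also have "(\<Sum>a\<in>X - X1. mass Y M a) = 1 - \<tau>"
    using sum.subset_diff[OF X1 X, of "mass Y M"] tr by (simp add: \<tau>_def)
  finally have purity: "(\<Sum>k\<in>X. (p k)\<^sup>2) \<le> 1 - 2 * \<tau> + 2 * \<tau>\<^sup>2"
    by (simp add: power2_eq_square algebra_simps)
  have "\<tau> \<le> \<epsilon>\<^sup>2 * (m + K)" using \<tau> Ke(2) by (simp add: algebra_simps)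
  then have "\<tau>\<^sup>2 \<le> (\<epsilon>\<^sup>2 * (m + K))\<^sup>2" using \<tau>0 by (intro power_mono) auto
  also have "\<dots> = (m + K)\<^sup>2 * \<epsilon> ^ 4" by (simp add: power_mult_distrib flip: power_mult)
  also have "\<dots> \<le> (m + K)\<^sup>2 * \<epsilon> ^ 3" using e43 by (intro mult_left_mono) auto
  finally have \<tau>2: "\<tau>\<^sup>2 \<le> (m + K)\<^sup>2 * \<epsilon> ^ 3" .

  have up: "(\<Sum>k\<in>X. p k * ln (p k)) \<le>
     (\<Sum>j\<in>J. r j * ln (y j) + r j - y j + norm_sq X (\<lambda>a. mat_vec X (gram Y M) (u j) a - of_real (y j) * u j a) / y j)
     + (\<Sum>k\<in>X. (p k)\<^sup>2) - 1 + (\<Sum>j\<in>J. r j)"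
    unfolding r_def by (rule entropy_sum_upper[OF X pv sp(1) p1 J u y])
  have "(\<Sum>j\<in>J. r j * ln (y j) + r j - y j + norm_sq X (\<lambda>a. mat_vec X (gram Y M) (u j) a - of_real (y j) * u j a) / y j)
      + (\<Sum>j\<in>J. r j)
    \<le> (\<Sum>j\<in>J. y j * ln (y j) + y j + (K * (2 + \<bar>ln (\<mu> j)\<bar>) + 2 * K + K / \<mu> j) * \<epsilon> ^ 3)"
    unfolding sum.distrib[symmetric]
  proof (rule sum_mono)
    fix j assume j: "j \<in> J"
    have "norm_sq X (\<lambda>a. mat_vec X (gram Y M) (u j) a - of_real (y j) * u j a) / y j \<le> K * \<epsilon> ^ 6 / y j"
      using defect[OF j] y[OF j] by (intro divide_right_mono) (auto simp: y_def)
    also have "\<dots> = K / \<mu> j * \<epsilon> ^ 4" using \<epsilon> \<mu>[OF j] by (simp add: y_def eval_nat_numeral)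
    also have "\<dots> \<le> K / \<mu> j * \<epsilon> ^ 3" using e43 K \<mu>[OF j] by (intro mult_left_mono) auto
    finally show "r j * ln (y j) + r j - y j + norm_sq X (\<lambda>a. mat_vec X (gram Y M) (u j) a - of_real (y j) * u j a) / y j + r j
      \<le> y j * ln (y j) + y j + (K * (2 + \<bar>ln (\<mu> j)\<bar>) + 2 * K + K / \<mu> j) * \<epsilon> ^ 3"
      using ry[OF j] rln[OF j] Ke(1) unfolding distrib_right by linarith
  qed
  \<comment> \<open>The purity minus 1 contributes -2 \<tau>, which is -2 times the sum of y up to
    O(eps^4); the extra sum of r gives one of these back. What remains is the single negative sum of
    y in the target.\<close>
  then have upper: "(\<Sum>k\<in>X. p k * ln (p k)) \<le> (\<Sum>j\<in>J. y j * ln (y j)) - (\<Sum>j\<in>J. y j)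
     + (\<Sum>j\<in>J. K * (2 + \<bar>ln (\<mu> j)\<bar>) + 2 * K + K / \<mu> j) * \<epsilon> ^ 3 + 2 * (K * \<epsilon> ^ 3) + 2 * ((m + K)\<^sup>2 * \<epsilon> ^ 3)"
    using up purity \<tau> \<tau>2 Ke(1) unfolding sum.distrib sy sum_distrib_right[symmetric] by linarith

  define u' where "u' = case_option w u"
  define y' where "y' = case_option 1 y"
  have uw: "ip X (u j) w = 0" "ip X w (u j) = 0" if "j \<in> J" for j
  proof -
    have "cnj (u j a) * w a = 0" if "a \<in> X" for a
      using w0[of a] supp[OF \<open>j \<in> J\<close>, of a] that by (cases "a \<in> X1") auto
    then show "ip X (u j) w = 0" unfolding ip_def by (rule sum.neutral[OF ballI])
    then show "ip X w (u j) = 0" by (metis cnj_ip complex_cnj_zero)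
  qed
  \<comment> \<open>For the lower bound \<open>w\<close> joins the trial vectors, at level 1 and index \<open>None\<close>.\<close>
  have on: "orthonormal X (insert None (Some ` J)) u'"
    using u uw ip_self[of X w] w1 by (auto simp: orthonormal_def u'_def)
  \<comment> \<open>The level is z = eps^3: then \<open>card X * z\<close> has the order of the
    remainder, and the leftover trace O(eps^4) times |ln z| <= 3 / eps does too.\<close>
  have lo: "(\<Sum>k\<in>X. p k * ln (p k)) \<ge>
     (\<Sum>j\<in>insert None (Some ` J). rayleigh X (gram Y M) (u' j) * ln (y' j) - y' j) + 1
      + (1 - (\<Sum>j\<in>insert None (Some ` J). rayleigh X (gram Y M) (u' j))) * ln (\<epsilon> ^ 3) - card X * \<epsilon> ^ 3"
    by (rule entropy_sum_lower[OF X pv sp(1) p1 _ on]) (use J y \<epsilon> in \<open>auto simp: y'_def\<close>)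
  have o: "(\<Sum>j\<in>insert None (Some ` J). f j) = f None + (\<Sum>j\<in>J. f (Some j))" for f :: "'j option \<Rightarrow> real"
    using J by (simp add: sum.reindex)
  \<comment> \<open>At \<open>None\<close> the factor ln 1 = 0 removes r0 from the first sum, and
    the level 1 cancels the isolated + 1; r0 survives only in the leftover trace.\<close>
  have lo2: "(\<Sum>k\<in>X. p k * ln (p k)) \<ge> (\<Sum>j\<in>J. r j * ln (y j)) - (\<Sum>j\<in>J. y j)
      + (1 - r0 - (\<Sum>j\<in>J. r j)) * ln (\<epsilon> ^ 3) - card X * \<epsilon> ^ 3"
    using lo unfolding o by (simp add: u'_def y'_def r_def r0_def sum_subtractf algebra_simps)
  have "(\<Sum>j\<in>J. y j) - (\<Sum>j\<in>J. r j) \<le> (\<Sum>j\<in>J. K * \<epsilon> ^ 4)"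
    unfolding sum_subtractf[symmetric] using ry by (intro sum_mono) (simp add: abs_le_iff)
  \<comment> \<open>An upper bound on the leftover trace suffices, because its factor ln (eps^3) is
    nonpositive.\<close>
  then have T: "1 - r0 - (\<Sum>j\<in>J. r j) \<le> (2 * K + card J * K) * \<epsilon> ^ 4"
    using wray \<tau> unfolding r0_def[symmetric] \<tau>_def[symmetric] sy by (simp add: algebra_simps)
  have lnneg: "ln (\<epsilon> ^ 3) \<le> 0" using \<epsilon> by (simp add: ln_realpow)
  have "ln (1 / \<epsilon>) \<le> 1 / \<epsilon> - 1" using \<epsilon> by (intro ln_le_minus_one) auto
  then have lb: "ln (\<epsilon> ^ 3) \<ge> - (3 / \<epsilon>)" using \<epsilon> by (simp add: ln_div ln_realpow)
  have "(1 - r0 - (\<Sum>j\<in>J. r j)) * ln (\<epsilon> ^ 3) \<ge> ((2 * K + card J * K) * \<epsilon> ^ 4) * ln (\<epsilon> ^ 3)"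
    by (rule mult_right_mono_neg[OF T lnneg])
  moreover have "((2 * K + card J * K) * \<epsilon> ^ 4) * ln (\<epsilon> ^ 3) \<ge> ((2 * K + card J * K) * \<epsilon> ^ 4) * (- (3 / \<epsilon>))"
    using lb K \<epsilon> by (intro mult_left_mono) auto
  moreover have "((2 * K + card J * K) * \<epsilon> ^ 4) * (- (3 / \<epsilon>)) = - (3 * (2 * K + card J * K) * (\<epsilon> ^ 4 / \<epsilon>))"
    by simp
  ultimately have T2: "(1 - r0 - (\<Sum>j\<in>J. r j)) * ln (\<epsilon> ^ 3) \<ge> - (3 * (2 * K + card J * K) * \<epsilon> ^ 3)"
    unfolding e34 by linarith
  have "(\<Sum>j\<in>J. y j * ln (y j)) - (\<Sum>j\<in>J. r j * ln (y j)) \<le> (\<Sum>j\<in>J. K * (2 + \<bar>ln (\<mu> j)\<bar>) * \<epsilon> ^ 3)"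
    unfolding sum_subtractf[symmetric] using rln by (intro sum_mono) (simp add: abs_le_iff)
  also have "\<dots> \<le> (\<Sum>j\<in>J. (K * (2 + \<bar>ln (\<mu> j)\<bar>) + 2 * K + K / \<mu> j) * \<epsilon> ^ 3)"
    using K \<mu> \<epsilon> by (intro sum_mono mult_right_mono) (auto simp: less_imp_le)
  finally have lower: "(\<Sum>k\<in>X. p k * ln (p k)) \<ge> (\<Sum>j\<in>J. y j * ln (y j)) - (\<Sum>j\<in>J. y j)
     - (\<Sum>j\<in>J. K * (2 + \<bar>ln (\<mu> j)\<bar>) + 2 * K + K / \<mu> j) * \<epsilon> ^ 3
     - 3 * (2 * K + card J * K) * \<epsilon> ^ 3 - card X * \<epsilon> ^ 3"
    using lo2 T2 unfolding sum_distrib_right[symmetric] by linarith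
  have tgt: "(\<Sum>j\<in>J. \<epsilon>\<^sup>2 * \<mu> j * (1 - ln (\<epsilon>\<^sup>2 * \<mu> j))) = (\<Sum>j\<in>J. y j) - (\<Sum>j\<in>J. y j * ln (y j))"
    by (simp add: y_def sum_subtractf algebra_simps)
  have pos: "0 \<le> 2 * (K * \<epsilon> ^ 3)" "0 \<le> 2 * ((m + K)\<^sup>2 * \<epsilon> ^ 3)" "0 \<le> 3 * (2 * K + card J * K) * \<epsilon> ^ 3"
    "0 \<le> card X * \<epsilon> ^ 3" using K \<epsilon> by auto
  show ?thesis
    unfolding S tgt m_def[symmetric] using upper lower pos unfolding abs_le_iff distrib_right
    by (simp only: mult.assoc) linarith
qed

section \<open>The Bose-Hubbard Hamiltonian near the Mott state\<close>

definition ones :: "nat set \<Rightarrow> occ" where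
  "ones A = (\<lambda>x. if x \<in> A then 1 else 0)"

definition nbr :: "nat \<Rightarrow> nat \<Rightarrow> nat \<Rightarrow> bool" where
  "nbr Ns i j \<longleftrightarrow> i \<in> {1..Ns} \<and> j \<in> {1..Ns} \<and> (j = next_site Ns i \<or> i = next_site Ns j)"

text \<open>The hop is read backwards: the value of b_i^\<dagger> b_j \<psi> at n involves \<psi> at
  the configuration in which a particle of n is returned from i to j. The truncated subtraction at n
  i = 0 is multiplied by \<open>hop_amp\<close> = 0.\<close>

definition move :: "occ \<Rightarrow> nat \<Rightarrow> nat \<Rightarrow> occ" where
  "move n i j = n(i := n i - 1, j := n j + 1)"

definition hop_amp :: "occ \<Rightarrow> nat \<Rightarrow> nat \<Rightarrow> real" where
  "hop_amp n i j = sqrt (real (n i)) * sqrt (real (n j + 1))"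

definition hopping :: "nat \<Rightarrow> state \<Rightarrow> state" where
  "hopping Ns \<psi> n = (\<Sum>i = 1..Ns.
      of_real (hop_amp n i (next_site Ns i)) * \<psi> (move n i (next_site Ns i))
    + of_real (hop_amp n (next_site Ns i) i) * \<psi> (move n (next_site Ns i) i))"

definition onsite :: "nat \<Rightarrow> occ \<Rightarrow> real" where
  "onsite Ns n = (\<Sum>i = 1..Ns. real (n i) * (real (n i) - 1) / 2)"

text \<open>
  For even \<open>Ns\<close> this is a sublattice parity: modulo 2 only the odd sites contribute, and the
  shift \<open>n i + 1\<close> makes the Mott state \<open>ones {1..Ns}\<close> unflipped. Every hop changes it.
\<close>

definition flipped :: "nat \<Rightarrow> occ \<Rightarrow> bool" where
  "flipped Ns n \<longleftrightarrow> odd (\<Sum>i = 1..Ns. i * (n i + 1))"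

definition dipole :: "nat \<Rightarrow> occ \<Rightarrow> bool" where
  "dipole Ns n \<longleftrightarrow> (\<exists>i j. nbr Ns i j \<and> n = (ones {1..Ns})(i := 2, j := 0))"

lemma next_site_cases:
  assumes "i \<in> {1..Ns}"
  shows "next_site Ns i = (if i = Ns then 1 else i + 1)"
  using assms by (auto simp: next_site_def)

lemma next_site_in: "i \<in> {1..Ns} \<Longrightarrow> next_site Ns i \<in> {1..Ns}"
  by (subst next_site_cases) auto

lemma next_site_neq: "i \<in> {1..Ns} \<Longrightarrow> Ns \<ge> 2 \<Longrightarrow> next_site Ns i \<noteq> i"
  by (subst next_site_cases) auto

lemma next_next_site_neq: "i \<in> {1..Ns} \<Longrightarrow> Ns \<ge> 3 \<Longrightarrow> next_site Ns (next_site Ns i) \<noteq> i"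
  using next_site_in[of i Ns] by (subst next_site_cases, simp, subst next_site_cases) (auto split: if_splits simp: next_site_cases)

lemma nbr_neq: "nbr Ns i j \<Longrightarrow> Ns \<ge> 2 \<Longrightarrow> i \<noteq> j"
  using next_site_neq by (fastforce simp: nbr_def)

lemma nbr_sym: "nbr Ns i j \<Longrightarrow> nbr Ns j i"
  by (auto simp: nbr_def)

lemma nbr_next: "i \<in> {1..Ns} \<Longrightarrow> nbr Ns i (next_site Ns i)" "i \<in> {1..Ns} \<Longrightarrow> nbr Ns (next_site Ns i) i"
  using next_site_in by (auto simp: nbr_def)

lemma nbr_odd_sum: "nbr Ns i j \<Longrightarrow> even Ns \<Longrightarrow> odd (i + j)"
  unfolding nbr_def by (auto simp: next_site_cases split: if_splits)

lemma create_annihilate: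
  "i \<noteq> j \<Longrightarrow> create i (annihilate j \<psi>) n = of_real (hop_amp n i j) * \<psi> (move n i j)"
  by (simp add: create_def annihilate_def hop_amp_def move_def)

lemma number_eq: "number i \<psi> n = of_nat (n i) * \<psi> n"
proof (cases "n i = 0")
  case False
  have "complex_of_real (sqrt (real (n i))) * complex_of_real (sqrt (real (n i))) = of_nat (n i)"
    by (simp only: of_real_mult[symmetric] real_sqrt_mult_self abs_of_nat of_real_of_nat_eq)
  then show ?thesis using False
    by (simp add: number_def create_def annihilate_def flip: mult.assoc)
qed (simp add: number_def create_def)

lemma bose_hubbard_eq:
  assumes "Ns \<ge> 2"
  shows "bose_hubbard Ns t U \<psi> n = - of_real t * hopping Ns \<psi> n + of_real (U * onsite Ns n) * \<psi> n"
proof -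
  have 1: "(\<Sum>i = 1..Ns. create i (annihilate (next_site Ns i) \<psi>) n
       + create (next_site Ns i) (annihilate i \<psi>) n) = hopping Ns \<psi> n"
    unfolding hopping_def
    using next_site_neq[OF _ assms] by (intro sum.cong refl) (simp add: create_annihilate[OF not_sym] create_annihilate)
  have 2: "(\<Sum>i = 1..Ns. number i (\<lambda>k. number i \<psi> k - \<psi> k) n)
      = of_real (2 * onsite Ns n) * \<psi> n"
    unfolding onsite_def number_eq sum_distrib_left of_real_sum sum_distrib_right
    by (intro sum.cong refl) (simp add: algebra_simps)
  show ?thesis unfolding bose_hubbard_def 1 2 by simp
qed

text \<open>Stated additively to avoid subtraction, and with the shift n x + 1 of
  \<open>flipped\<close>. The weights f x = x give the parity change of a hop, and f = 1 gives
  conservation of the particle number.\<close>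

lemma move_sum:
  fixes f :: "nat \<Rightarrow> nat"
  assumes "i \<in> S" "j \<in> S" "i \<noteq> j" "n i \<ge> 1" "finite S"
  shows "(\<Sum>x\<in>S. f x * (move n i j x + 1)) + f i = (\<Sum>x\<in>S. f x * (n x + 1)) + f j"
proof -
  have "(\<Sum>x\<in>S. f x * (move n i j x + 1)) + (\<Sum>x\<in>S. if x = i then f x else 0)
      = (\<Sum>x\<in>S. f x * (n x + 1)) + (\<Sum>x\<in>S. if x = j then f x else 0)"
    unfolding sum.distrib[symmetric]
    using assms by (intro sum.cong refl) (auto simp: move_def algebra_simps simp flip: mult_Suc_right)
  then show ?thesis using assms by simp
qed

text \<open>A hop changes the weighted sum by j - i, which is odd for neighbours; for even Ns this
  includes the closing bond between Ns and 1.\<close>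

lemma move_flips:
  assumes "nbr Ns i j" "n i \<ge> 1" "even Ns" "Ns \<ge> 2"
  shows "flipped Ns (move n i j) \<longleftrightarrow> \<not> flipped Ns n"
  using move_sum[of i "{1..Ns}" j n "\<lambda>x. x"] nbr_neq[OF assms(1,4)] nbr_odd_sum[OF assms(1,3)] assms(1,2)
  unfolding flipped_def nbr_def by (metis (no_types, lifting) even_add finite_atLeastAtMost)

lemma move_occs_eq:
  assumes "i \<in> S" "j \<in> S" "i \<noteq> j" "n i \<ge> 1" "finite S"
  shows "move n i j \<in> occs_eq S N \<longleftrightarrow> n \<in> occs_eq S N"
proof -
  have "(\<Sum>x\<in>S. move n i j x) = (\<Sum>x\<in>S. n x)"
  proof -
    have "(\<Sum>x\<in>S. 1 * (move n i j x + 1)) + 1 = (\<Sum>x\<in>S. 1 * (n x + 1)) + 1"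
      by (rule move_sum) (use assms in auto)
    then show ?thesis by (simp only: mult_1 sum.distrib add_right_cancel)
  qed
  moreover have "move n i j \<in> occs S \<longleftrightarrow> n \<in> occs S"
    using assms by (auto simp: occs_def move_def)
  ultimately show ?thesis by (simp add: occs_eq_def)
qed

lemma move_eq_ones:
  assumes "i \<in> {1..Ns}" "j \<in> {1..Ns}" "i \<noteq> j" "n i \<ge> 1"
  shows "move n i j = ones {1..Ns} \<longleftrightarrow> n = (ones {1..Ns})(i := 2, j := 0)"
proof
  assume m: "move n i j = ones {1..Ns}"
  have "n x = ((ones {1..Ns})(i := 2, j := 0)) x" for x
    using fun_cong[OF m, of x] assms by (auto simp: move_def ones_def split: if_splits)
  then show "n = (ones {1..Ns})(i := 2, j := 0)" by blast
next
  assume "n = (ones {1..Ns})(i := 2, j := 0)"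
  then show "move n i j = ones {1..Ns}"
    using assms by (auto simp: move_def ones_def fun_eq_iff)
qed

lemma dipole_pair_unique:
  assumes "(ones {1..Ns})(i := 2, j := 0) = (ones {1..Ns})(i' := 2, j' := 0)" "i \<noteq> j" "i' \<noteq> j'"
    "j \<in> {1..Ns}" "j' \<in> {1..Ns}"
  shows "i = i' \<and> j = j'"
proof -
  have "i = i'" using fun_cong[OF assms(1), of i] assms(2) by (auto simp: ones_def split: if_splits)
  moreover have "j = j'" using fun_cong[OF assms(1), of j] assms by (auto simp: ones_def split: if_splits)
  ultimately show ?thesis by blast
qed

text \<open>A dipole returns to the Mott state by exactly one directed hop, whose amplitude sqrt 2
  comes from the doubly occupied site; this is the sqrt 2 in eps. From three sites on, each bond of
  the ring is counted only once in each direction.\<close>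

lemma hopping_ones:
  assumes "Ns \<ge> 3"
  shows "hopping Ns (\<lambda>q. if q = ones {1..Ns} then c else 0) n = (if dipole Ns n then of_real (sqrt 2) * c else 0)"
proof (cases "dipole Ns n")
  case False
  have z: "of_real (hop_amp n i j) * (if move n i j = ones {1..Ns} then c else 0) = 0" if "nbr Ns i j" for i j
  proof (cases "n i = 0")
    case False
    then have "move n i j \<noteq> ones {1..Ns}"
      using move_eq_ones[of i Ns j n] that nbr_neq[OF that] assms \<open>\<not> dipole Ns n\<close>
      by (auto simp: dipole_def nbr_def)
    then show ?thesis by simp
  qed (simp add: hop_amp_def)
  have "hopping Ns (\<lambda>q. if q = ones {1..Ns} then c else 0) n = 0"
    unfolding hopping_def by (intro sum.neutral ballI) (simp only: z[OF nbr_next(1)] z[OF nbr_next(2)] add_0)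
  then show ?thesis using False by simp
next
  case True
  then obtain i0 j0 where ij: "nbr Ns i0 j0" and n: "n = (ones {1..Ns})(i0 := 2, j0 := 0)"
    by (auto simp: dipole_def)
  have ij': "i0 \<noteq> j0" "i0 \<in> {1..Ns}" "j0 \<in> {1..Ns}" using ij nbr_neq[OF ij] assms by (auto simp: nbr_def)
  have t: "of_real (hop_amp n i j) * (if move n i j = ones {1..Ns} then c else 0)
      = (if i = i0 \<and> j = j0 then of_real (sqrt 2) * c else 0)" if "nbr Ns i j" for i j
  proof (cases "n i = 0")
    case True
    then have "i \<noteq> i0" using n ij' by auto
    then show ?thesis using True by (simp add: hop_amp_def)
  next
    case False
    have a: "i \<noteq> j" "i \<in> {1..Ns}" "j \<in> {1..Ns}" using that nbr_neq[OF that] assms by (auto simp: nbr_def)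
    have "move n i j = ones {1..Ns} \<longleftrightarrow> i = i0 \<and> j = j0"
      using move_eq_ones[of i Ns j n] a False dipole_pair_unique[of Ns i0 j0 i j] ij' n by auto
    moreover have "hop_amp n i0 j0 = sqrt 2" using ij' by (simp add: hop_amp_def n)
    ultimately show ?thesis by auto
  qed
  have "hopping Ns (\<lambda>q. if q = ones {1..Ns} then c else 0) n
     = (\<Sum>i = 1..Ns. (if i = i0 then if next_site Ns i0 = j0 then of_real (sqrt 2) * c else 0 else 0)
          + (if i = j0 then if next_site Ns j0 = i0 then of_real (sqrt 2) * c else 0 else 0))"
    unfolding hopping_def
  proof (intro sum.cong refl)
    fix i assume i: "i \<in> {1..Ns}"
    show "of_real (hop_amp n i (next_site Ns i)) * (if move n i (next_site Ns i) = ones {1..Ns} then c else 0)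
        + of_real (hop_amp n (next_site Ns i) i) * (if move n (next_site Ns i) i = ones {1..Ns} then c else 0)
      = (if i = i0 then if next_site Ns i0 = j0 then of_real (sqrt 2) * c else 0 else 0)
          + (if i = j0 then if next_site Ns j0 = i0 then of_real (sqrt 2) * c else 0 else 0)"
      unfolding t[OF nbr_next(1)[OF i]] t[OF nbr_next(2)[OF i]] by simp
  qed
  also have "\<dots> = (if next_site Ns i0 = j0 then of_real (sqrt 2) * c else 0)
     + (if next_site Ns j0 = i0 then of_real (sqrt 2) * c else 0)"
    using ij' by (simp add: sum.distrib)
  also have "\<dots> = of_real (sqrt 2) * c"
    using ij ij' next_next_site_neq[of i0 Ns] assms by (auto simp: nbr_def)
  finally show ?thesis using True by simp
qed

text \<open>There are 2 Ns directed hops, each of amplitude at most N + 1. The bound on \<psi> is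
  asked only one hop away from n, so that knowledge of the parity of those configurations can be
  inserted.\<close>

lemma hopping_bound:
  assumes n: "n \<in> occs_eq {1..Ns} N" and Ns: "Ns \<ge> 2" and c: "c \<ge> 0"
    and \<psi>: "\<And>i j. nbr Ns i j \<Longrightarrow> n i \<ge> 1 \<Longrightarrow> cmod (\<psi> (move n i j)) \<le> c"
  shows "cmod (hopping Ns \<psi> n) \<le> 2 * real Ns * (real N + 1) * c"
proof -
  have le: "n i \<le> N" if "i \<in> {1..Ns}" for i
    using member_le_sum[of i "{1..Ns}" n] n that by (simp add: occs_eq_def)
  have h: "cmod (of_real (hop_amp n i j) * \<psi> (move n i j)) \<le> (real N + 1) * c" if "nbr Ns i j" for i j
  proof (cases "n i = 0")
    case True
    then show ?thesis using c by (simp add: hop_amp_def)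
  next
    case False
    have "hop_amp n i j \<le> sqrt (real N + 1) * sqrt (real N + 1)"
      unfolding hop_amp_def using le[of i] le[of j] that by (intro mult_mono) (auto simp: nbr_def)
    then have "\<bar>hop_amp n i j\<bar> \<le> real N + 1" by (simp add: hop_amp_def)
    then show ?thesis using \<psi>[OF that] False by (simp add: norm_mult mult_mono)
  qed
  have "cmod (hopping Ns \<psi> n) \<le> (\<Sum>i = 1..Ns. (real N + 1) * c + (real N + 1) * c)"
    unfolding hopping_def using nbr_next
    by (intro order_trans[OF norm_sum] sum_mono order_trans[OF norm_triangle_ineq] add_mono h) auto
  then show ?thesis by (simp add: algebra_simps)
qed

lemma onsite_ones: "onsite Ns (ones {1..Ns}) = 0"
  by (simp add: onsite_def ones_def)

lemma onsite_exc:
  assumes "dipole Ns n" "Ns \<ge> 2"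
  shows "onsite Ns n = 1"
proof -
  obtain i j where ij: "nbr Ns i j" "n = (ones {1..Ns})(i := 2, j := 0)"
    using assms by (auto simp: dipole_def)
  have "onsite Ns n = (\<Sum>x = 1..Ns. if x = i then 1 else 0)"
    unfolding onsite_def using ij nbr_neq[OF ij(1) assms(2)] by (intro sum.cong refl) (auto simp: ones_def)
  then show ?thesis using ij by (simp add: nbr_def)
qed

text \<open>The gap, by pigeonhole: Ns particles on Ns sites with no double occupation can only form
  the Mott state, and one doubly occupied site already costs 1 in units of U.\<close>

lemma onsite_ge_1:
  assumes n: "n \<in> occs_eq {1..Ns} Ns" and ne: "n \<noteq> ones {1..Ns}"
  shows "onsite Ns n \<ge> 1"
proof -
  have "\<exists>i\<in>{1..Ns}. n i \<ge> 2"
  proof (rule ccontr)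
    assume "\<not> ?thesis"
    then have "\<not> n i \<ge> 2" if "i \<in> {1..Ns}" for i using that by blast
    then have le: "\<And>i. i \<in> {1..Ns} \<Longrightarrow> n i \<le> 1" by (simp add: not_le less_Suc_eq_le numeral_2_eq_2)
    have "(\<Sum>i = 1..Ns. 1 - n i) = (\<Sum>i = 1..Ns. 1) - (\<Sum>i = 1..Ns. n i)"
      by (rule sum_subtractf_nat) (rule le)
    then have "\<And>i. i \<in> {1..Ns} \<Longrightarrow> 1 - n i = 0" using n by (simp add: occs_eq_def)
    then have "\<And>i. i \<in> {1..Ns} \<Longrightarrow> n i = 1" using le by (metis diff_is_0_eq le_antisym)
    then have "n = ones {1..Ns}" using n by (auto simp: ones_def occs_eq_def occs_def fun_eq_iff)
    then show False using ne by simp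
  qed
  then obtain i where i: "i \<in> {1..Ns}" "n i \<ge> 2" by blast
  have nn: "real (n x) * (real (n x) - 1) / 2 \<ge> 0" for x
    by (cases "n x") auto
  have "2 * 1 \<le> real (n i) * (real (n i) - 1)" using i by (intro mult_mono) auto
  then have "1 \<le> real (n i) * (real (n i) - 1) / 2" by simp
  also have "\<dots> \<le> onsite Ns n"
    unfolding onsite_def by (rule member_le_sum) (use i nn in auto)
  finally show ?thesis .
qed

lemma ones_in_occs_eq: "ones {1..Ns} \<in> occs_eq {1..Ns} Ns"
  by (simp add: occs_eq_def occs_def ones_def)

lemma not_flipped_ones: "\<not> flipped Ns (ones {1..Ns})"
  by (auto simp: flipped_def ones_def intro!: dvd_sum)

section \<open>The Hamiltonian as a Hermitian matrix and the sign of its lowest energy\<close>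

definition ham_matrix :: "nat \<Rightarrow> real \<Rightarrow> real \<Rightarrow> occ \<Rightarrow> occ \<Rightarrow> complex" where
  "ham_matrix Ns t U n n' = bose_hubbard Ns t U (\<lambda>q. if q = n' then 1 else 0) n"

text \<open>The reversed hop has the same real amplitude, and the amplitudes vanish exactly where
  truncated subtraction would spoil the reversal.\<close>

lemma hop_swap:
  assumes "i \<noteq> j"
  shows "of_real (hop_amp n i j) * (if move n i j = n' then 1 else 0 :: complex)
     = of_real (hop_amp n' j i) * (if move n' j i = n then 1 else 0)"
proof -
  have *: "n' j \<ge> 1 \<and> move n' j i = n \<and> hop_amp n' j i = hop_amp n i j"
    if "n i \<ge> 1" "move n i j = n'" "i \<noteq> j" for n n' :: occ and i j
  proof -
    have n': "n' = move n i j" using that by simp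
    show ?thesis unfolding n' using that(1,3) by (auto simp: move_def hop_amp_def fun_eq_iff)
  qed
  show ?thesis
  proof (cases "n i \<ge> 1 \<and> move n i j = n'")
    case True
    then show ?thesis using *[of n i j n'] assms by simp
  next
    case False
    then have "\<not> (n' j \<ge> 1 \<and> move n' j i = n)" using *[of n' j i n] assms by auto
    then have "hop_amp n' j i = 0 \<or> move n' j i \<noteq> n" by (cases "n' j") (auto simp: hop_amp_def)
    moreover have "hop_amp n i j = 0 \<or> move n i j \<noteq> n'" using False by (cases "n i") (auto simp: hop_amp_def)
    ultimately show ?thesis by auto
  qed
qed

lemma hermitian_ham_matrix:
  assumes "Ns \<ge> 2"
  shows "hermitian X (ham_matrix Ns t U)"
proof -
  have k: "hopping Ns (\<lambda>q. if q = n' then 1 else 0) n = hopping Ns (\<lambda>q. if q = n then 1 else 0) n'" for n n'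
    unfolding hopping_def
  proof (intro sum.cong refl)
    fix i assume "i \<in> {1..Ns}"
    then have "next_site Ns i \<noteq> i" using next_site_neq assms by blast
    then show "of_real (hop_amp n i (next_site Ns i)) * (if move n i (next_site Ns i) = n' then 1 else 0)
      + of_real (hop_amp n (next_site Ns i) i) * (if move n (next_site Ns i) i = n' then 1 else 0)
     = of_real (hop_amp n' i (next_site Ns i)) * (if move n' i (next_site Ns i) = n then 1 else 0)
      + of_real (hop_amp n' (next_site Ns i) i) * (if move n' (next_site Ns i) i = n then 1 else (0::complex))"
      using hop_swap[of i "next_site Ns i" n n'] hop_swap[of "next_site Ns i" i n n'] by simp
  qed
  have r: "cnj (hopping Ns (\<lambda>q. if q = n' then 1 else 0) n) = hopping Ns (\<lambda>q. if q = n' then 1 else 0) n" for n n'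
    unfolding hopping_def cnj_sum by (intro sum.cong refl) auto
  show ?thesis
    unfolding hermitian_def ham_matrix_def bose_hubbard_eq[OF assms]
    by (auto simp: r k)
qed

lemma bose_hubbard_mat_vec:
  assumes Ns: "Ns \<ge> 2" and X: "finite X" and \<psi>: "\<And>n. n \<notin> X \<Longrightarrow> \<psi> n = 0"
  shows "bose_hubbard Ns t U \<psi> n = mat_vec X (ham_matrix Ns t U) \<psi> n"
proof -
  have e: "\<psi> q = (\<Sum>n'\<in>X. \<psi> n' * (if q = n' then 1 else 0))" for q
  proof -
    have "(\<Sum>n'\<in>X. \<psi> n' * (if q = n' then 1 else 0)) = (\<Sum>n'\<in>X. if n' = q then \<psi> n' else 0)"
      by (intro sum.cong) auto
    then show ?thesis using X \<psi>[of q] by simp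
  qed
  have k: "hopping Ns \<psi> n = (\<Sum>n'\<in>X. \<psi> n' * hopping Ns (\<lambda>q. if q = n' then 1 else 0) n)"
  proof -
    have "hopping Ns \<psi> n = (\<Sum>i = 1..Ns. \<Sum>n'\<in>X. \<psi> n' *
      (of_real (hop_amp n i (next_site Ns i)) * (if move n i (next_site Ns i) = n' then 1 else 0)
      + of_real (hop_amp n (next_site Ns i) i) * (if move n (next_site Ns i) i = n' then 1 else 0)))"
      unfolding hopping_def
      by (intro sum.cong refl, subst (1 2) e) (simp add: sum_distrib_left distrib_left sum.distrib mult_ac)
    then show ?thesis unfolding hopping_def by (subst (asm) sum.swap) (simp add: sum_distrib_left)
  qed
  have "bose_hubbard Ns t U \<psi> n = - of_real t * hopping Ns \<psi> n + of_real (U * onsite Ns n) * (\<Sum>n'\<in>X. \<psi> n' * (if n = n' then 1 else 0))"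
    unfolding bose_hubbard_eq[OF Ns] by (subst e[of n]) simp
  also have "\<dots> = mat_vec X (ham_matrix Ns t U) \<psi> n"
    unfolding k mat_vec_def ham_matrix_def bose_hubbard_eq[OF Ns] sum_distrib_left sum.distrib[symmetric]
    by (intro sum.cong refl) (simp add: algebra_simps)
  finally show ?thesis .
qed

lemma bose_hubbard_sector:
  assumes Ns: "Ns \<ge> 2" and \<psi>: "\<psi> \<in> sector Ns N"
  shows "bose_hubbard Ns t U \<psi> \<in> sector Ns N"
  unfolding sector_def
proof (intro CollectI allI impI)
  fix n assume n: "n \<notin> occs_eq {1..Ns} N"
  have z: "of_real (hop_amp n i j) * \<psi> (move n i j) = 0" if "nbr Ns i j" for i j
  proof (cases "n i = 0")
    case False
    then have "move n i j \<notin> occs_eq {1..Ns} N"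
      using move_occs_eq[of i "{1..Ns}" j n N] n that nbr_neq[OF that Ns] by (auto simp: nbr_def)
    then show ?thesis using \<psi> by (simp add: sector_def)
  qed (simp add: hop_amp_def)
  have "hopping Ns \<psi> n = 0" unfolding hopping_def by (simp add: z nbr_next)
  then show "bose_hubbard Ns t U \<psi> n = 0"
    unfolding bose_hubbard_eq[OF Ns] using \<psi> n by (simp add: sector_def)
qed

text \<open>Variational bound with the Mott state as trial state.\<close>

lemma nonpos_energy_exists:
  assumes Ns: "Ns \<ge> 3"
  obtains E where "is_energy Ns Ns t U E" "E \<le> 0"
proof -
  have Ns2: "Ns \<ge> 2" using Ns by simp
  define X where "X = occs_eq {1..Ns} Ns"
  have X: "finite X" by (simp add: X_def finite_occs_eq)
  have one: "ones {1..Ns} \<in> X" unfolding X_def by (rule ones_in_occs_eq)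
  obtain p v where pv: "spectral_decomposition X (ham_matrix Ns t U) p v"
    using hermitian_spectral_decomposition[OF X hermitian_ham_matrix[OF Ns2]] by blast
  note v = spectral_orthonormal[OF pv]
  have "\<not> dipole Ns (ones {1..Ns})"
  proof
    assume "dipole Ns (ones {1..Ns})"
    then have "onsite Ns (ones {1..Ns}) = 1" by (rule onsite_exc[OF _ Ns2])
    then show False unfolding onsite_ones by simp
  qed
  \<comment> \<open>The Mott state has no interaction energy and a hop does not map it to itself, so
    its energy expectation is 0. This expectation is also the mean of the eigenvalues with weights
    adding up to 1, so some eigenvalue is at most 0.\<close>
  then have "ham_matrix Ns t U (ones {1..Ns}) (ones {1..Ns}) = 0"
    unfolding ham_matrix_def bose_hubbard_eq[OF Ns2] hopping_ones[OF Ns] onsite_ones by simp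
  moreover have "ham_matrix Ns t U (ones {1..Ns}) (ones {1..Ns})
     = of_real (\<Sum>k\<in>X. p k * (cmod (v k (ones {1..Ns})))\<^sup>2)"
    using pv one by (simp add: spectral_decomposition_def complex_norm_square mult.assoc del: of_real_power)
  ultimately have s: "(\<Sum>k\<in>X. p k * (cmod (v k (ones {1..Ns})))\<^sup>2) = 0"
    by (simp only: of_real_eq_0_iff)
  have n: "(\<Sum>k\<in>X. (cmod (v k (ones {1..Ns})))\<^sup>2) = 1"
  proof -
    have "of_real (\<Sum>k\<in>X. (cmod (v k (ones {1..Ns})))\<^sup>2) = (1::complex)"
      using orthonormal_complete[OF X v one one] by (simp add: complex_norm_square del: of_real_power)
    then show ?thesis by (simp only: of_real_eq_1_iff)
  qed
  have "\<exists>k\<in>X. p k \<le> 0"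
  proof (rule ccontr)
    assume "\<not> ?thesis"
    then have pp: "\<And>k. k \<in> X \<Longrightarrow> p k > 0" by force
    then have "\<And>k. k \<in> X \<Longrightarrow> p k * (cmod (v k (ones {1..Ns})))\<^sup>2 = 0"
      using s X by (subst (asm) sum_nonneg_eq_0_iff) (auto simp: less_imp_le)
    then have "\<And>k. k \<in> X \<Longrightarrow> (cmod (v k (ones {1..Ns})))\<^sup>2 = 0" using pp by fastforce
    then show False using n by simp
  qed
  then obtain k where k: "k \<in> X" "p k \<le> 0" by blast
  \<comment> \<open>\<open>spectral_decomposition\<close> constrains v only on X; cutting v k off
    outside makes it a member of the sector.\<close>
  define \<phi> where "\<phi> n = (if n \<in> X then v k n else 0)" for n
  have \<phi>: "\<phi> \<in> sector Ns Ns" by (simp add: sector_def \<phi>_def X_def)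
  have "\<phi> \<noteq> (\<lambda>_. 0)"
  proof
    assume "\<phi> = (\<lambda>_. 0)"
    then have "\<And>n. n \<in> X \<Longrightarrow> v k n = 0" by (metis \<phi>_def)
    then have "norm_sq X (v k) = 0" by (simp add: norm_sq_def)
    then show False using orthonormal_norm_sq[OF v k(1)] by simp
  qed
  moreover have "bose_hubbard Ns t U \<phi> n = of_real (p k) * \<phi> n" for n
  proof (cases "n \<in> X")
    case True
    have "bose_hubbard Ns t U \<phi> n = mat_vec X (ham_matrix Ns t U) \<phi> n"
      by (rule bose_hubbard_mat_vec[OF Ns2 X]) (simp add: \<phi>_def)
    also have "\<dots> = mat_vec X (ham_matrix Ns t U) (v k) n" by (simp add: mat_vec_def \<phi>_def)
    also have "\<dots> = (\<Sum>l\<in>X. if l = k then of_real (p k) * v k n else 0)"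
      unfolding spectral_mat_vec[OF pv True] by (intro sum.cong refl) (auto simp: orthonormalD[OF v _ k(1)])
    finally show ?thesis using X k True by (simp add: \<phi>_def)
  next
    case False
    then show ?thesis using bose_hubbard_sector[OF Ns2 \<phi>, of t U] by (simp add: sector_def X_def \<phi>_def)
  qed
  ultimately have "is_energy Ns Ns t U (p k)" unfolding is_energy_def using \<phi> by blast
  then show ?thesis using that k by blast
qed

section \<open>Ground-state amplitudes by iterating the eigenvalue equation\<close>

definition dipole_amp :: "nat \<Rightarrow> occ \<Rightarrow> real" where
  "dipole_amp Ns n = (if dipole Ns n then 1 else 0)"

text \<open>Two tiers of accuracy by sublattice parity: flipped amplitudes are known to third order,
  unflipped ones other than the Mott amplitude are merely of second order. Closeness of the Mott
  amplitude to 1 also fixes the phase.\<close>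

definition near_mott :: "nat \<Rightarrow> real \<Rightarrow> real \<Rightarrow> state \<Rightarrow> bool" where
  "near_mott Ns K \<epsilon> \<phi> \<longleftrightarrow>
     \<phi> \<in> sector Ns Ns \<and> (\<Sum>n \<in> occs_eq {1..Ns} Ns. (cmod (\<phi> n))\<^sup>2) = 1 \<and>
     cmod (\<phi> (ones {1..Ns}) - 1) \<le> K * \<epsilon>\<^sup>2 \<and>
     (\<forall>n \<in> occs_eq {1..Ns} Ns. flipped Ns n \<longrightarrow> cmod (\<phi> n - of_real (\<epsilon> * dipole_amp Ns n)) \<le> K * \<epsilon> ^ 3) \<and>
     (\<forall>n \<in> occs_eq {1..Ns} Ns. \<not> flipped Ns n \<longrightarrow> n \<noteq> ones {1..Ns} \<longrightarrow> cmod (\<phi> n) \<le> K * \<epsilon>\<^sup>2)"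

lemma hopping_diff: "hopping Ns (\<lambda>q. \<psi> q - \<phi> q) n = hopping Ns \<psi> n - hopping Ns \<phi> n"
  by (simp add: hopping_def algebra_simps sum_subtractf sum.distrib)

text \<open>Divided by U, the eigenvalue equation reads (onsite - e) \<psi> = \<tau> hopping \<psi>
  with e <= 0. Away from the Mott state the left factor is at least 1, so each pass through the
  equation gains a factor \<tau>; since a hop changes the parity, the gains pass from one parity
  class to the other.\<close>

lemma ground_state_near_mott:
  assumes Ns: "Ns \<ge> 3" and ev: "even Ns"
  obtains K \<delta> :: real where "K \<ge> 0" "\<delta> > 0"
    "\<And>t U \<psi>. t > 0 \<Longrightarrow> U > 0 \<Longrightarrow> sqrt 2 * t / U < \<delta> \<Longrightarrow> ground_state Ns Ns t U \<psi> \<Longrightarrow>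
      \<exists>z. cmod z = 1 \<and> near_mott Ns K (sqrt 2 * t / U) (\<lambda>n. z * \<psi> n)"
proof -
  have Ns2: "Ns \<ge> 2" using Ns by simp
  define X where "X = occs_eq {1..Ns} Ns"
  define I where "I = ones {1..Ns}"
  have X: "finite X" by (simp add: X_def finite_occs_eq)
  have one: "I \<in> X" unfolding X_def I_def by (rule ones_in_occs_eq)
  define L where "L = 2 * real Ns * (real Ns + 1)"
  define D where "D = real (card X)"
  have L: "L \<ge> 1" unfolding L_def using Ns mult_mono[of 1 "2 * real Ns" 1 "real Ns + 1"] by simp
  have D: "D \<ge> 0" by (simp add: D_def)
  define K where "K = L ^ 3 + 4 * L\<^sup>2 + 2 * (D * L\<^sup>2)"
  \<comment> \<open>L bounds the hopping and D is the dimension of the sector. This radius keeps the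
    total weight D (\<tau> L)^2 of the excited configurations at most 1/4, so that the Mott
    amplitude stays away from 0.\<close>
  define \<delta> where "\<delta> = 1 / (2 * L * (D + 1))"
  have L3: "0 \<le> L ^ 3" "0 \<le> L\<^sup>2" "0 \<le> D * L\<^sup>2" using L D by auto
  have K: "K \<ge> 0" "L\<^sup>2 \<le> K" "D * L\<^sup>2 \<le> K" unfolding K_def using L3 by auto
  have \<delta>: "\<delta> > 0" using L D by (simp add: \<delta>_def)
  have "\<exists>z. cmod z = 1 \<and> near_mott Ns K (sqrt 2 * t / U) (\<lambda>n. z * \<psi> n)"
    if t: "t > 0" and U: "U > 0" and small: "sqrt 2 * t / U < \<delta>" and gs: "ground_state Ns Ns t U \<psi>"
    for t U \<psi>
  proof -
    define \<tau> where "\<tau> = t / U"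
    define \<epsilon> where "\<epsilon> = sqrt 2 * t / U"
    have \<epsilon>\<tau>: "\<epsilon> = sqrt 2 * \<tau>" by (simp add: \<epsilon>_def \<tau>_def)
    have \<tau>: "\<tau> > 0" using t U by (simp add: \<tau>_def)
    have "\<tau> * 1 \<le> \<tau> * sqrt 2" using \<tau> by (intro mult_left_mono) auto
    then have \<tau>\<epsilon>: "\<tau> \<le> \<epsilon>" by (simp add: \<epsilon>\<tau> mult.commute)
    have "\<tau> < 1 / (2 * L * (D + 1))" using \<tau>\<epsilon> small by (simp add: \<epsilon>_def \<delta>_def)
    moreover have "0 < 2 * L * (D + 1)" using L D by simp
    ultimately have "\<tau> * (2 * L * (D + 1)) < 1" by (simp only: pos_less_divide_eq)
    then have "\<tau> * L * (D + 1) < 1 / 2" by (simp add: algebra_simps)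
    then have tld: "(\<tau> * L * (D + 1))\<^sup>2 \<le> (1/2)\<^sup>2" using \<tau> L D by (intro power_mono) auto
    have "D \<le> (D + 1)\<^sup>2" using D by (simp add: power2_eq_square algebra_simps)
    then have "(\<tau> * L)\<^sup>2 * D \<le> (\<tau> * L)\<^sup>2 * (D + 1)\<^sup>2" by (intro mult_left_mono) auto
    then have small': "D * (\<tau> * L)\<^sup>2 \<le> 1 / 4" 
      using tld unfolding power_mult_distrib[of "\<tau> * L"] by (simp add: mult.commute[of D] power_one_over)
    obtain E where sec: "\<psi> \<in> sector Ns Ns" and nrm: "(\<Sum>n\<in>X. (cmod (\<psi> n))\<^sup>2) = 1"
      and eig: "bose_hubbard Ns t U \<psi> = (\<lambda>n. of_real E * \<psi> n)"
      and mn: "\<And>E'. is_energy Ns Ns t U E' \<Longrightarrow> E \<le> E'"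
      using gs unfolding ground_state_def X_def by blast
    obtain E' where "is_energy Ns Ns t U E'" "E' \<le> 0"
      by (rule nonpos_energy_exists[OF Ns])
    then have "E \<le> 0" using mn[of E'] by simp
    define e where "e = E / U"
    have e0: "e \<le> 0" using \<open>E \<le> 0\<close> U by (simp add: e_def divide_nonpos_pos)
    have eq: "of_real (onsite Ns n - e) * \<psi> n = of_real \<tau> * hopping Ns \<psi> n" for n
    proof -
      have "- of_real t * hopping Ns \<psi> n + of_real (U * onsite Ns n) * \<psi> n = of_real E * \<psi> n"
        using fun_cong[OF eig, of n] unfolding bose_hubbard_eq[OF Ns2] .
      then have "of_real (U * onsite Ns n - E) * \<psi> n = of_real t * hopping Ns \<psi> n"
        by (simp add: algebra_simps)
      moreover have "U * onsite Ns n - E = U * (onsite Ns n - e)" "t = U * \<tau>"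
        using U by (auto simp: e_def \<tau>_def algebra_simps)
      ultimately have "of_real U * (of_real (onsite Ns n - e) * \<psi> n) = of_real U * (of_real \<tau> * hopping Ns \<psi> n)"
        by simp
      then show ?thesis using U by (subst (asm) mult_cancel_left) simp
    qed
    have \<psi>0: "\<psi> n = 0" if "n \<notin> X" for n using sec that by (simp add: sector_def X_def)
    have \<psi>1: "cmod (\<psi> n) \<le> 1" for n
    proof (cases "n \<in> X")
      case True
      then have "(cmod (\<psi> n))\<^sup>2 \<le> (\<Sum>n\<in>X. (cmod (\<psi> n))\<^sup>2)" using X by (intro member_le_sum) auto
      then show ?thesis by (simp add: nrm abs_square_le_1)
    qed (simp add: \<psi>0)
    have moveX: "move n i j \<in> X" if "n \<in> X" "nbr Ns i j" "n i \<ge> 1" for n i j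
      using move_occs_eq[of i "{1..Ns}" j n Ns] that nbr_neq[OF that(2) Ns2] by (simp add: X_def nbr_def)
    have kb: "cmod (hopping Ns \<phi> n) \<le> L * c"
      if "n \<in> X" "c \<ge> 0" "\<And>i j. nbr Ns i j \<Longrightarrow> n i \<ge> 1 \<Longrightarrow> cmod (\<phi> (move n i j)) \<le> c" for \<phi> n c
      unfolding L_def by (rule hopping_bound) (use that Ns2 in \<open>auto simp: X_def\<close>)
    have gap: "cmod a \<le> b" if "n \<in> X" "n \<noteq> I" "cmod (of_real (onsite Ns n - e) * a) \<le> b" for n a b
    proof -
      have "1 * cmod a \<le> \<bar>onsite Ns n - e\<bar> * cmod a"
        using onsite_ge_1[of n Ns] that e0 by (intro mult_right_mono) (auto simp: X_def I_def)
      then show ?thesis using that(3) unfolding norm_mult norm_of_real by linarith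
    qed
    have first: "cmod (\<psi> n) \<le> L * \<tau>" if n: "n \<in> X" "n \<noteq> I" for n
    proof (rule gap[OF n])
      have "cmod (hopping Ns \<psi> n) \<le> L * 1" by (rule kb[OF n(1)]) (auto simp: \<psi>1)
      then have "\<tau> * cmod (hopping Ns \<psi> n) \<le> \<tau> * L" using \<tau> by (intro mult_left_mono) auto
      then show "cmod (of_real (onsite Ns n - e) * \<psi> n) \<le> L * \<tau>"
        unfolding eq using \<tau> by (simp add: norm_mult mult.commute)
    qed
    define c where "c = \<psi> I"
    have "1 = (\<Sum>n\<in>X - {I}. (cmod (\<psi> n))\<^sup>2) + (cmod c)\<^sup>2"
      using sum.subset_diff[of "{I}" X "\<lambda>n. (cmod (\<psi> n))\<^sup>2"] one X nrm by (simp add: c_def)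
    also have "(\<Sum>n\<in>X - {I}. (cmod (\<psi> n))\<^sup>2) \<le> (\<Sum>n\<in>X - {I}. (L * \<tau>)\<^sup>2)"
      using first by (intro sum_mono power_mono) auto
    also have "\<dots> \<le> D * (\<tau> * L)\<^sup>2"
      using X by (simp add: D_def mult.commute[of L]) (intro mult_right_mono, auto simp: card_Diff1_le)
    finally have cc: "1 - (cmod c)\<^sup>2 \<le> D * (\<tau> * L)\<^sup>2" by simp
    then have "(1/2)\<^sup>2 \<le> (cmod c)\<^sup>2" using small' by (simp add: power2_eq_square)
    then have chalf: "cmod c \<ge> 1 / 2" by (rule power2_le_imp_le) simp
    have c1: "cmod c \<le> 1" by (simp add: c_def \<psi>1)
    have "(1 - cmod c) * 1 \<le> (1 - cmod c) * (1 + cmod c)" using c1 by (intro mult_left_mono) auto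
    then have cdev: "1 - cmod c \<le> D * L\<^sup>2 * \<tau>\<^sup>2"
      using cc by (simp add: power2_eq_square algebra_simps)
    have nbI: "move I i j \<noteq> I" if "nbr Ns i j" "I i \<ge> 1" for i j
      using move_flips[of Ns i j I, OF that ev Ns2] by auto
    \<comment> \<open>At the Mott state the equation reads - e c = \<tau> hopping \<psi> I. All
      configurations one hop away are of first order, so e is of second order once |c| >=
      1/2.\<close>
    have "cmod (hopping Ns \<psi> I) \<le> L * (L * \<tau>)"
      by (rule kb[OF one]) (use L \<tau> first moveX[of I, OF one] nbI in auto)
    then have "\<tau> * cmod (hopping Ns \<psi> I) \<le> \<tau> * (L * (L * \<tau>))" using \<tau> by (intro mult_left_mono) auto
    also have "\<dots> = L\<^sup>2 * \<tau>\<^sup>2" by (simp add: power2_eq_square)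
    finally have "\<tau> * cmod (hopping Ns \<psi> I) \<le> L\<^sup>2 * \<tau>\<^sup>2" .
    moreover have "cmod (of_real (onsite Ns I - e) * \<psi> I) = \<bar>e\<bar> * cmod c"
      unfolding norm_mult norm_of_real I_def onsite_ones by (simp add: c_def I_def)
    ultimately have "\<bar>e\<bar> * cmod c \<le> L\<^sup>2 * \<tau>\<^sup>2"
      unfolding eq norm_mult norm_of_real abs_of_pos[OF \<tau>] by linarith
    moreover have "\<bar>e\<bar> * (1/2) \<le> \<bar>e\<bar> * cmod c" using chalf by (intro mult_left_mono) auto
    ultimately have eb: "\<bar>e\<bar> \<le> 2 * L\<^sup>2 * \<tau>\<^sup>2" by simp
    have second: "cmod (\<psi> n) \<le> L\<^sup>2 * \<tau>\<^sup>2" if n: "n \<in> X" "n \<noteq> I" "\<not> flipped Ns n" for n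
    proof (rule gap[OF n(1,2)])
      have "cmod (hopping Ns \<psi> n) \<le> L * (L * \<tau>)"
      proof (rule kb[OF n(1)])
        fix i j assume ij: "nbr Ns i j" "1 \<le> n i"
        then have "flipped Ns (move n i j)" using move_flips[of Ns i j n, OF ij ev Ns2] n by simp
        then have "move n i j \<noteq> I" using not_flipped_ones I_def by metis
        then show "cmod (\<psi> (move n i j)) \<le> L * \<tau>" using first moveX[of n i j, OF n(1) ij] by simp
      qed (use L \<tau> in auto)
      then have "\<tau> * cmod (hopping Ns \<psi> n) \<le> \<tau> * (L * (L * \<tau>))" using \<tau> by (intro mult_left_mono) auto
      also have "\<dots> = L\<^sup>2 * \<tau>\<^sup>2" by (simp add: power2_eq_square)
      finally show "cmod (of_real (onsite Ns n - e) * \<psi> n) \<le> L\<^sup>2 * \<tau>\<^sup>2"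
        unfolding eq norm_mult norm_of_real abs_of_pos[OF \<tau>] .
    qed
    have third: "cmod (\<psi> n - of_real (\<epsilon> * dipole_amp Ns n) * c) \<le> (L ^ 3 + 4 * L\<^sup>2) * \<tau> ^ 3"
      if n: "n \<in> X" "flipped Ns n" for n
    proof (rule gap[OF n(1)])
      show "n \<noteq> I" using n(2) not_flipped_ones I_def by metis
      \<comment> \<open>A flipped configuration has only unflipped neighbours, all of second order
        except the Mott state. The contribution of the latter, sqrt 2 c on dipoles, is split off as
        the leading term.\<close>
      let ?r = "\<lambda>q. \<psi> q - (if q = I then c else 0)"
      have "cmod (hopping Ns ?r n) \<le> L * (L\<^sup>2 * \<tau>\<^sup>2)"
      proof (rule kb[OF n(1)])
        fix i j assume ij: "nbr Ns i j" "1 \<le> n i"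
        then have "\<not> flipped Ns (move n i j)" using move_flips[of Ns i j n, OF ij ev Ns2] n by simp
        then show "cmod (?r (move n i j)) \<le> L\<^sup>2 * \<tau>\<^sup>2"
          using second moveX[of n i j, OF n(1) ij] L3 by (simp add: c_def)
      qed (use L3 in auto)
      then have kr: "\<tau> * cmod (hopping Ns ?r n) \<le> \<tau> * (L * (L\<^sup>2 * \<tau>\<^sup>2))" using \<tau> by (intro mult_left_mono) auto
      have kd: "hopping Ns \<psi> n = hopping Ns ?r n + of_real (sqrt 2 * dipole_amp Ns n) * c"
        using hopping_ones[OF Ns, of c n] unfolding hopping_diff I_def[symmetric] by (simp add: dipole_amp_def)
      \<comment> \<open>The interaction energy of a dipole is exactly 1, so eps c solves the
        equation up to the energy shift, an error |e| eps of third order.\<close>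
      have og: "onsite Ns n * dipole_amp Ns n = dipole_amp Ns n"
        using onsite_exc[OF _ Ns2, of n] by (simp add: dipole_amp_def)
      have "of_real (onsite Ns n - e) * (\<psi> n - of_real (\<epsilon> * dipole_amp Ns n) * c)
        = of_real (onsite Ns n - e) * \<psi> n - of_real (\<epsilon> * (onsite Ns n * dipole_amp Ns n)) * c + of_real (e * (\<epsilon> * dipole_amp Ns n)) * c"
        by (simp add: algebra_simps)
      also have "\<dots> = of_real \<tau> * hopping Ns ?r n + of_real (e * (\<epsilon> * dipole_amp Ns n)) * c"
        unfolding eq og kd \<epsilon>\<tau> by (simp add: algebra_simps)
      also have "cmod \<dots> \<le> \<tau> * cmod (hopping Ns ?r n) + \<bar>e\<bar> * (\<epsilon> * dipole_amp Ns n) * cmod c"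
        using \<tau> \<tau>\<epsilon> by (intro order_trans[OF norm_triangle_ineq]) (simp add: norm_mult dipole_amp_def)
      also have "\<dots> \<le> \<tau> * (L * (L\<^sup>2 * \<tau>\<^sup>2)) + (2 * L\<^sup>2 * \<tau>\<^sup>2) * (2 * \<tau> * 1) * 1"
      proof (intro add_mono kr mult_mono)
        show "\<bar>e\<bar> \<le> 2 * L\<^sup>2 * \<tau>\<^sup>2" by (rule eb)
        have "sqrt 2 \<le> sqrt 4" by (rule real_sqrt_le_mono) simp
        then show "\<epsilon> \<le> 2 * \<tau>" using \<tau> unfolding \<epsilon>\<tau> by (intro mult_right_mono) auto
      qed (use c1 \<tau> \<tau>\<epsilon> in \<open>auto simp: dipole_amp_def\<close>)
      also have "\<dots> = (L ^ 3 + 4 * L\<^sup>2) * \<tau> ^ 3" by (simp add: eval_nat_numeral algebra_simps)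
      finally show "cmod (of_real (onsite Ns n - e) * (\<psi> n - of_real (\<epsilon> * dipole_amp Ns n) * c)) \<le> (L ^ 3 + 4 * L\<^sup>2) * \<tau> ^ 3" .
    qed
    have c0: "cmod c > 0" using chalf by linarith
    \<comment> \<open>Rotates the Mott amplitude onto the positive axis, where its distance to 1 is
      1 - |c|.\<close>
    define z where "z = cnj c / of_real (cmod c)"
    have z1: "cmod z = 1" using c0 by (simp add: z_def norm_divide)
    have zc: "z * c = of_real (cmod c)"
      using c0 complex_norm_square[of c] by (simp add: z_def power2_eq_square field_simps)
    have pw: "\<tau>\<^sup>2 \<le> \<epsilon>\<^sup>2" "\<tau> ^ 3 \<le> \<epsilon> ^ 3" "0 \<le> \<tau>\<^sup>2" "0 \<le> \<tau> ^ 3" "\<epsilon> \<ge> 0" using \<tau> \<tau>\<epsilon> by (auto intro!: power_mono)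
    have "near_mott Ns K \<epsilon> (\<lambda>n. z * \<psi> n)"
      unfolding near_mott_def X_def[symmetric] I_def[symmetric]
    proof (intro conjI ballI impI)
      show "(\<lambda>n. z * \<psi> n) \<in> sector Ns Ns" using sec by (simp add: sector_def)
      show "(\<Sum>n\<in>X. (cmod (z * \<psi> n))\<^sup>2) = 1" using nrm by (simp add: norm_mult z1)
      have "z * \<psi> I - 1 = of_real (cmod c - 1)" using zc by (simp add: c_def)
      then have "cmod (z * \<psi> I - 1) = 1 - cmod c" using c1 by (simp only: norm_of_real)
      also have "\<dots> \<le> D * L\<^sup>2 * \<tau>\<^sup>2" by (rule cdev)
      also have "\<dots> \<le> K * \<epsilon>\<^sup>2" using K pw by (intro mult_mono) auto
      finally show "cmod (z * \<psi> I - 1) \<le> K * \<epsilon>\<^sup>2" .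
    next
      fix n assume n: "n \<in> X" "flipped Ns n"
      have n2: "cmod (of_real (\<epsilon> * dipole_amp Ns n * (cmod c - 1))) = \<epsilon> * dipole_amp Ns n * (1 - cmod c)"
        unfolding norm_of_real using c1 pw(5) by (cases "dipole Ns n") (auto simp: dipole_amp_def abs_mult)
      have "z * \<psi> n - of_real (\<epsilon> * dipole_amp Ns n)
         = z * (\<psi> n - of_real (\<epsilon> * dipole_amp Ns n) * c) + of_real (\<epsilon> * dipole_amp Ns n * (cmod c - 1))"
        using zc by (simp add: algebra_simps)
      also have "cmod \<dots> \<le> cmod (\<psi> n - of_real (\<epsilon> * dipole_amp Ns n) * c) + \<epsilon> * dipole_amp Ns n * (1 - cmod c)"
        unfolding n2[symmetric]
        by (rule order_trans[OF norm_triangle_ineq]) (simp only: norm_mult[of z] z1 mult_1 order_refl)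
      also have "\<dots> \<le> (L ^ 3 + 4 * L\<^sup>2) * \<epsilon> ^ 3 + \<epsilon> * 1 * (D * L\<^sup>2 * \<epsilon>\<^sup>2)"
      proof (intro add_mono mult_mono)
        show "cmod (\<psi> n - of_real (\<epsilon> * dipole_amp Ns n) * c) \<le> (L ^ 3 + 4 * L\<^sup>2) * \<epsilon> ^ 3"
          using third[OF n] mult_left_mono[OF pw(2), of "L ^ 3 + 4 * L\<^sup>2"] L3 by linarith
        show "1 - cmod c \<le> D * L\<^sup>2 * \<epsilon>\<^sup>2"
          using cdev mult_left_mono[OF pw(1) L3(3)] by linarith
      qed (use pw c1 in \<open>auto simp: dipole_amp_def\<close>)
      also have "\<dots> = (L ^ 3 + 4 * L\<^sup>2 + D * L\<^sup>2) * \<epsilon> ^ 3" by (simp add: eval_nat_numeral algebra_simps)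
      also have "\<dots> \<le> K * \<epsilon> ^ 3" using pw L3 by (intro mult_right_mono) (auto simp: K_def)
      finally show "cmod (z * \<psi> n - of_real (\<epsilon> * dipole_amp Ns n)) \<le> K * \<epsilon> ^ 3" .
    next
      fix n assume n: "n \<in> X" "\<not> flipped Ns n" "n \<noteq> I"
      have "cmod (z * \<psi> n) \<le> L\<^sup>2 * \<tau>\<^sup>2" using second n by (simp add: norm_mult z1)
      also have "\<dots> \<le> K * \<epsilon>\<^sup>2" using K pw by (intro mult_mono) auto
      finally show "cmod (z * \<psi> n) \<le> K * \<epsilon>\<^sup>2" .
    qed
    then show ?thesis using z1 unfolding \<epsilon>_def by blast
  qed
  then show ?thesis using that K(1) \<delta> by blast
qed

section \<open>Reduced density matrices near the Mott state\<close>

lemma dipole_move: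
  assumes "dipole Ns n" "Ns \<ge> 2"
  obtains i j where "nbr Ns i j" "n i \<ge> 1" "move n i j = ones {1..Ns}"
proof -
  obtain i j where ij: "nbr Ns i j" "n = (ones {1..Ns})(i := 2, j := 0)"
    using assms(1) by (auto simp: dipole_def)
  have "i \<noteq> j" "i \<in> {1..Ns}" "j \<in> {1..Ns}" using ij nbr_neq[OF ij(1) assms(2)] by (auto simp: nbr_def)
  then have "n i \<ge> 1" "move n i j = ones {1..Ns}" using ij(2) move_eq_ones[of i Ns j n] by auto
  then show ?thesis using that ij(1) by blast
qed

lemma dipole_flipped:
  assumes "dipole Ns n" "Ns \<ge> 2" "even Ns"
  shows "flipped Ns n"
proof -
  obtain i j where ij: "nbr Ns i j" "n i \<ge> 1" "move n i j = ones {1..Ns}"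
    by (rule dipole_move[OF assms(1,2)])
  show ?thesis
    using move_flips[of Ns i j n, OF ij(1,2) assms(3,2)] not_flipped_ones[of Ns] unfolding ij(3) by blast
qed

lemma dipole_occs_eq:
  assumes "dipole Ns n" "Ns \<ge> 2"
  shows "n \<in> occs_eq {1..Ns} Ns"
proof -
  obtain i j where ij: "nbr Ns i j" "n i \<ge> 1" "move n i j = ones {1..Ns}"
    by (rule dipole_move[OF assms])
  then have "i \<in> {1..Ns}" "j \<in> {1..Ns}" "i \<noteq> j" using nbr_neq[OF ij(1) assms(2)] by (auto simp: nbr_def)
  from move_occs_eq[of i "{1..Ns}" j n Ns, OF this ij(2)] ij(3) show ?thesis
    using ones_in_occs_eq[of Ns] by simp
qed

lemma dipole_amp_bounds: "0 \<le> dipole_amp Ns n" "dipole_amp Ns n \<le> 1"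
  by (simp_all add: dipole_amp_def)

text \<open>Extends the bounds to all n, since off the sector the amplitude and its dipole
  approximation both vanish. The third bound merges the parities for the places where second order
  is enough.\<close>

lemma near_mott_bounds:
  assumes nm: "near_mott Ns K \<epsilon> \<phi>" and Ns: "Ns \<ge> 2" "even Ns" and K: "K \<ge> 0" "\<epsilon> > 0" "\<epsilon> \<le> 1"
  shows "flipped Ns n \<Longrightarrow> cmod (\<phi> n - of_real (\<epsilon> * dipole_amp Ns n)) \<le> K * \<epsilon> ^ 3"
    and "\<not> flipped Ns n \<Longrightarrow> n \<noteq> ones {1..Ns} \<Longrightarrow> cmod (\<phi> n) \<le> K * \<epsilon>\<^sup>2"
    and "n \<noteq> ones {1..Ns} \<Longrightarrow> cmod (\<phi> n - of_real (\<epsilon> * dipole_amp Ns n)) \<le> K * \<epsilon>\<^sup>2"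
proof -
  have out: "\<phi> n = 0" "dipole_amp Ns n = 0" if "n \<notin> occs_eq {1..Ns} Ns"
    using nm that dipole_occs_eq[OF _ Ns(1), of n] by (auto simp: near_mott_def sector_def dipole_amp_def)
  show 1: "cmod (\<phi> n - of_real (\<epsilon> * dipole_amp Ns n)) \<le> K * \<epsilon> ^ 3" if "flipped Ns n"
    using nm that out K by (cases "n \<in> occs_eq {1..Ns} Ns") (auto simp: near_mott_def)
  show 2: "cmod (\<phi> n) \<le> K * \<epsilon>\<^sup>2" if "\<not> flipped Ns n" "n \<noteq> ones {1..Ns}"
    using nm that out K by (cases "n \<in> occs_eq {1..Ns} Ns") (auto simp: near_mott_def)
  show "cmod (\<phi> n - of_real (\<epsilon> * dipole_amp Ns n)) \<le> K * \<epsilon>\<^sup>2" if "n \<noteq> ones {1..Ns}"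
  proof (cases "flipped Ns n")
    case True
    have "K * \<epsilon> ^ 3 \<le> K * \<epsilon> ^ 2" using K by (intro mult_left_mono power_decreasing) auto
    then show ?thesis using 1[OF True] by simp
  next
    case False
    then have "dipole_amp Ns n = 0" using dipole_flipped[OF _ Ns] by (auto simp: dipole_amp_def)
    then show ?thesis using 2[OF False that] by simp
  qed
qed

text \<open>Used with d of order eps^2 in general, giving third order, and with d of order eps^3
  when both amplitudes are flipped, giving fourth order.\<close>

lemma product_perturbation:
  assumes x: "cmod (x - of_real (\<epsilon> * g)) \<le> d" and y: "cmod (y - of_real (\<epsilon> * h)) \<le> d"
    and g: "0 \<le> g" "g \<le> 1" and h: "0 \<le> h" "h \<le> 1" and e: "\<epsilon> \<ge> 0"
  shows "cmod (x * cnj y - of_real (\<epsilon>\<^sup>2 * (g * h))) \<le> 2 * \<epsilon> * d + d\<^sup>2"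
proof -
  have d: "d \<ge> 0" using x norm_ge_zero order_trans by blast
  let ?x = "x - of_real (\<epsilon> * g)" and ?y = "y - of_real (\<epsilon> * h)"
  have "x * cnj y - of_real (\<epsilon>\<^sup>2 * (g * h)) = ?x * cnj ?y + ?x * of_real (\<epsilon> * h) + of_real (\<epsilon> * g) * cnj ?y"
    by (simp add: algebra_simps power2_eq_square)
  also have "cmod \<dots> \<le> cmod (?x * cnj ?y) + cmod (?x * of_real (\<epsilon> * h)) + cmod (of_real (\<epsilon> * g) * cnj ?y)"
    by (intro order_trans[OF norm_triangle_ineq] add_mono order_refl norm_triangle_ineq)
  also have "\<dots> = cmod ?x * cmod ?y + cmod ?x * (\<epsilon> * h) + (\<epsilon> * g) * cmod ?y"
    using g h e unfolding norm_mult complex_mod_cnj norm_of_real by (simp add: abs_mult)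
  also have "\<dots> \<le> d * d + d * (\<epsilon> * 1) + (\<epsilon> * 1) * d"
    using x y g h e d by (intro add_mono mult_mono) auto
  finally show ?thesis by (simp add: power2_eq_square)
qed

text \<open>The projection is the nearest point on the line through w, so any convenient l bounds
  the residual from above. The single vector is treated as an orthonormal family over
  \<open>{()}\<close>.\<close>

lemma line_distance:
  assumes w: "norm_sq V w = 1" and V: "finite V"
  shows "norm_sq V y - (cmod (ip V w y))\<^sup>2 \<le> norm_sq V (\<lambda>a. y a - l * w a)"
proof -
  have on: "orthonormal V {()} (\<lambda>_. w)" by (simp add: orthonormal_def ip_self w)
  let ?x = "\<lambda>a. y a - l * w a"
  have x: "ip V w ?x = ip V w y - l" by (simp add: ip_diff_right ip_scale_right ip_self w)
  have "norm_sq V (\<lambda>a. ?x a - ip V w ?x * w a) = norm_sq V (\<lambda>a. y a - ip V w y * w a)"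
    unfolding x by (simp add: algebra_simps)
  moreover have "norm_sq V (\<lambda>a. ?x a - ip V w ?x * w a) \<le> norm_sq V ?x"
    using residual_norm[OF _ on, of ?x] by simp
  moreover have "norm_sq V (\<lambda>a. y a - ip V w y * w a) = norm_sq V y - (cmod (ip V w y))\<^sup>2"
    using residual_norm[OF _ on, of y] by simp
  ultimately show ?thesis by simp
qed

text \<open>One particle per site of A except at i: s = 2 is a surplus and s = 0 a hole, the trace
  that a dipole across the cut leaves in A.\<close>

definition conf :: "nat set \<Rightarrow> nat \<Rightarrow> nat \<Rightarrow> occ" where
  "conf A i s = (ones A)(i := s)"

lemma conf_inj:
  assumes "s \<in> {0, 2}" "s' \<in> {0, 2}" "i \<in> A" "i' \<in> A"
  shows "conf A i s = conf A i' s' \<longleftrightarrow> i = i' \<and> s = s'"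
proof
  assume c: "conf A i s = conf A i' s'"
  show "i = i' \<and> s = s'"
    using fun_cong[OF c, of i] fun_cong[OF c, of i'] assms by (auto simp: conf_def ones_def split: if_splits)
qed simp

lemma conf_sum:
  fixes h :: "nat \<Rightarrow> nat"
  assumes "i \<in> A" "A \<subseteq> S" "finite S"
  shows "(\<Sum>x\<in>S. h x * conf A i s x) + h i = (\<Sum>x\<in>A. h x) + h i * s"
proof -
  have "(\<Sum>x\<in>S. h x * conf A i s x) + (\<Sum>x\<in>S. if x = i then h i else 0)
     = (\<Sum>x\<in>S. if x \<in> A then h x else 0) + (\<Sum>x\<in>S. if x = i then h i * s else 0)"
    unfolding sum.distrib[symmetric] using assms by (intro sum.cong) (auto simp: conf_def ones_def)
  moreover have "(\<Sum>x\<in>S. if x \<in> A then h x else 0) = (\<Sum>x\<in>A. h x)"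
    using assms by (simp add: sum.inter_restrict[symmetric] Int_absorb1)
  moreover have "i \<in> S" using assms by auto
  ultimately show ?thesis using assms by simp
qed

section \<open>Configurations of the two parts and dipoles across the cut\<close>

locale near_mott_bipartition =
  fixes Ns :: nat and A :: "nat set" and K \<epsilon> :: real and \<phi> :: state
  assumes Ns: "Ns \<ge> 3" and ev: "even Ns" and A: "A \<subseteq> {1..Ns}" "A \<noteq> {}" "A \<noteq> {1..Ns}"
    and K: "K \<ge> 0" and \<epsilon>: "\<epsilon> > 0" "\<epsilon> \<le> 1" and small: "K * \<epsilon>\<^sup>2 \<le> 1 / 2"
    and nm: "near_mott Ns K \<epsilon> \<phi>"
begin

definition "B = {1..Ns} - A"
definition "X = occs_le A Ns"
definition "Y = occs_le B Ns"
definition "M a b = \<phi> (\<lambda>x. a x + b x)"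
text \<open>Away from the Mott configuration \<open>\<epsilon> * G\<close> is the first-order part
  of M, so \<open>\<epsilon>\<^sup>2 * S\<close> is the leading part of the reduced density matrix
  on X1.\<close>

definition "G a b = dipole_amp Ns (\<lambda>x. a x + b x)"
definition "S a a' = (\<Sum>b\<in>Y. G a b * G a' b)"
text \<open>Configurations of \<open>A\<close> whose particle number differs from that of the Mott state.\<close>

definition "X1 = {a \<in> X. (\<Sum>x\<in>A. a x) \<noteq> card A}"

lemma finA: "finite A" and finB: "finite B"
  using A finite_subset by (auto simp: B_def)

lemma finX: "finite X" and finY: "finite Y"
  unfolding X_def Y_def by (auto intro!: finite_occs_le finA finB)

lemma X1: "X1 \<subseteq> X" by (auto simp: X1_def)

lemma Ns2: "Ns \<ge> 2" using Ns by simp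

lemma cardAB: "card A + card B = Ns" "card A \<ge> 1" "card B \<ge> 1"
proof -
  show "card A + card B = Ns"
    using card_Diff_subset[OF finA A(1)] card_mono[OF _ A(1)] by (simp add: B_def)
  show "card A \<ge> 1" using A finA by (simp add: Suc_le_eq card_gt_0_iff)
  have "B \<noteq> {}" using A by (auto simp: B_def)
  then show "card B \<ge> 1" using finB by (simp add: Suc_le_eq card_gt_0_iff)
qed

lemma bounds:
  "flipped Ns n \<Longrightarrow> cmod (\<phi> n - of_real (\<epsilon> * dipole_amp Ns n)) \<le> K * \<epsilon> ^ 3"
  "\<not> flipped Ns n \<Longrightarrow> n \<noteq> ones {1..Ns} \<Longrightarrow> cmod (\<phi> n) \<le> K * \<epsilon>\<^sup>2"
  "n \<noteq> ones {1..Ns} \<Longrightarrow> cmod (\<phi> n - of_real (\<epsilon> * dipole_amp Ns n)) \<le> K * \<epsilon>\<^sup>2"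
  using near_mott_bounds[OF nm Ns2 ev K \<epsilon>, of n] by auto

lemma reduced_density_gram: "reduced_density Ns Ns A \<phi> = gram Y M"
  unfolding reduced_density_def gram_def M_def Y_def B_def by simp

lemma sum_split: "(\<Sum>x = 1..Ns. h x) = (\<Sum>x\<in>A. h x) + (\<Sum>x\<in>B. h x)" for h :: "nat \<Rightarrow> nat"
  unfolding B_def using sum.subset_diff[OF A(1), of h] by (simp add: add.commute)

lemma XD: "a \<in> X \<Longrightarrow> x \<notin> A \<Longrightarrow> a x = 0" and YD: "b \<in> Y \<Longrightarrow> x \<notin> B \<Longrightarrow> b x = 0"
  by (auto simp: X_def Y_def occs_le_def occs_def)

lemma add_occs:
  assumes "a \<in> X" "b \<in> Y"
  shows "(\<lambda>x. a x + b x) \<in> occs {1..Ns}"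
  unfolding occs_def
proof (intro CollectI allI impI)
  fix i assume "i \<notin> {1..Ns}"
  then have "i \<notin> A" "i \<notin> B" using A(1) by (auto simp: B_def)
  then show "a i + b i = 0" using XD[OF assms(1)] YD[OF assms(2)] by simp
qed

lemma add_num:
  assumes "a \<in> X" "b \<in> Y"
  shows "(\<Sum>x = 1..Ns. a x + b x) = (\<Sum>x\<in>A. a x) + (\<Sum>x\<in>B. b x)"
proof -
  have "(\<Sum>x\<in>A. a x + b x) = (\<Sum>x\<in>A. a x)"
    using YD[OF assms(2)] by (intro sum.cong) (auto simp: B_def)
  moreover have "(\<Sum>x\<in>B. a x + b x) = (\<Sum>x\<in>B. b x)"
    using XD[OF assms(1)] by (intro sum.cong) (auto simp: B_def)
  ultimately show ?thesis unfolding sum_split by simp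
qed

lemma add_occs_eq:
  assumes "a \<in> X" "b \<in> Y"
  shows "(\<lambda>x. a x + b x) \<in> occs_eq {1..Ns} Ns \<longleftrightarrow> (\<Sum>x\<in>A. a x) + (\<Sum>x\<in>B. b x) = Ns"
  unfolding occs_eq_def mem_Collect_eq add_num[OF assms]
  using add_occs[OF assms] by simp

lemma M_nonzero:
  assumes "a \<in> X" "b \<in> Y" "M a b \<noteq> 0"
  shows "(\<Sum>x\<in>A. a x) + (\<Sum>x\<in>B. b x) = Ns"
  using add_occs_eq[OF assms(1,2)] nm assms(3) by (auto simp: near_mott_def sector_def M_def)

text \<open>The factorization of the Fock space on basis vectors: the two summands can be recovered
  as the restrictions of n to A and to B.\<close>

lemma add_eq_split:
  assumes "a \<in> X" "b \<in> Y"
  shows "(\<lambda>x. a x + b x) = n \<longleftrightarrow>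
     a = (\<lambda>x. if x \<in> A then n x else 0) \<and> b = (\<lambda>x. if x \<in> B then n x else 0) \<and> n \<in> occs {1..Ns}"
proof
  assume e: "(\<lambda>x. a x + b x) = n"
  have "a x = (if x \<in> A then n x else 0)" "b x = (if x \<in> B then n x else 0)" for x
    using fun_cong[OF e, of x] XD[OF assms(1), of x] YD[OF assms(2), of x] by (auto simp: B_def)
  moreover have "n \<in> occs {1..Ns}"
    using e add_occs[OF assms] by simp
  ultimately show "a = (\<lambda>x. if x \<in> A then n x else 0) \<and> b = (\<lambda>x. if x \<in> B then n x else 0) \<and> n \<in> occs {1..Ns}"
    by blast
next
  assume "a = (\<lambda>x. if x \<in> A then n x else 0) \<and> b = (\<lambda>x. if x \<in> B then n x else 0) \<and> n \<in> occs {1..Ns}"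
  then show "(\<lambda>x. a x + b x) = n" by (auto simp: fun_eq_iff B_def occs_def)
qed

lemma add_ones:
  assumes "a \<in> X" "b \<in> Y"
  shows "(\<lambda>x. a x + b x) = ones {1..Ns} \<longleftrightarrow> a = ones A \<and> b = ones B"
  unfolding add_eq_split[OF assms] using A
  by (auto simp: ones_def occs_def B_def fun_eq_iff)

lemma ones_X: "ones A \<in> X" and ones_Y: "ones B \<in> Y"
  using cardAB by (auto simp: X_def Y_def occs_le_def occs_def ones_def)

lemma ones_num: "(\<Sum>x\<in>D. ones D x) = card D"
  by (simp add: ones_def)

lemma X1_add_neq:
  assumes "a \<in> X1" "b \<in> Y"
  shows "(\<lambda>x. a x + b x) \<noteq> ones {1..Ns}"
  using assms add_ones[of a b] ones_num[of A] by (auto simp: X1_def)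

lemma conf_num:
  assumes "finite D" "i \<in> D"
  shows "(\<Sum>x\<in>D. conf D i s x) + 1 = card D + s"
  using conf_sum[OF assms(2) order_refl assms(1), of "\<lambda>_. 1"] by simp

lemma conf_X1:
  assumes i: "i \<in> A" and s: "s \<in> {0, 2}"
  shows "conf A i s \<in> X1"
proof -
  have n: "(\<Sum>x\<in>A. conf A i s x) + 1 = card A + s" by (rule conf_num[OF finA i])
  then have "(\<Sum>x\<in>A. conf A i s x) \<le> Ns" using cardAB s by auto
  then have "conf A i s \<in> X" using i by (auto simp: X_def occs_le_def occs_def conf_def ones_def)
  then show ?thesis using n s by (auto simp: X1_def)
qed

lemma conf_Y:
  assumes i: "i \<in> B" and s: "s \<in> {0, 2}"
  shows "conf B i s \<in> Y"
proof -
  have n: "(\<Sum>x\<in>B. conf B i s x) + 1 = card B + s" by (rule conf_num[OF finB i])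
  then have "(\<Sum>x\<in>B. conf B i s x) \<le> Ns" using cardAB s by auto
  then show ?thesis using i by (auto simp: Y_def occs_le_def occs_def conf_def ones_def)
qed

text \<open>A dipole lies inside A, inside B, or across the cut. Inside one part it leaves the other
  part in its Mott configuration; across the cut a surplus on one side faces a hole on the other,
  hence the occupations s and 2 - s.\<close>

lemma dipole_add_cases:
  assumes a: "a \<in> X" and b: "b \<in> Y" and e: "dipole Ns (\<lambda>x. a x + b x)"
  obtains "b = ones B" | "a = ones A"
  | i j s where "i \<in> A" "j \<in> B" "s \<in> {0, 2}" "nbr Ns i j" "a = conf A i s" "b = conf B j (2 - s)"
proof -
  obtain i j where ij: "nbr Ns i j" "(\<lambda>x. a x + b x) = (ones {1..Ns})(i := 2, j := 0)"
    using e by (auto simp: dipole_def)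
  have ne: "i \<noteq> j" "i \<in> {1..Ns}" "j \<in> {1..Ns}" using ij nbr_neq[OF ij(1) Ns2] by (auto simp: nbr_def)
  have ab: "a = (\<lambda>x. if x \<in> A then ((ones {1..Ns})(i := 2, j := 0)) x else 0)"
    "b = (\<lambda>x. if x \<in> B then ((ones {1..Ns})(i := 2, j := 0)) x else 0)"
    using ij(2) unfolding add_eq_split[OF a b] by auto
  consider "i \<in> A" "j \<in> A" | "i \<in> B" "j \<in> B" | "i \<in> A" "j \<in> B" | "i \<in> B" "j \<in> A"
    using ne by (auto simp: B_def)
  then show ?thesis
  proof cases
    case 1
    then have "b = ones B" unfolding ab by (auto simp: fun_eq_iff ones_def B_def)
    then show ?thesis using that(1) by blast
  next
    case 2
    then have "a = ones A" unfolding ab using A by (auto simp: fun_eq_iff ones_def B_def)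
    then show ?thesis using that(2) by blast
  next
    case 3
    then have "a = conf A i 2" "b = conf B j (2 - 2)"
      unfolding ab using A ne by (auto simp: fun_eq_iff ones_def conf_def B_def)
    then show ?thesis using that(3)[of i j 2] 3 ij(1) by blast
  next
    case 4
    then have "a = conf A j 0" "b = conf B i (2 - 0)"
      unfolding ab using A ne by (auto simp: fun_eq_iff ones_def conf_def B_def)
    then show ?thesis using that(3)[of j i 0] 4 nbr_sym[OF ij(1)] by blast
  qed
qed

lemma dipole_conf_add:
  assumes i: "i \<in> A" and j: "j \<in> B" and s: "s \<in> {0, 2}" and ij: "nbr Ns i j"
  shows "dipole Ns (\<lambda>x. conf A i s x + conf B j (2 - s) x)"
proof -
  have "(\<lambda>x. conf A i s x + conf B j (2 - s) x) = (if s = 2 then (ones {1..Ns})(i := 2, j := 0) else (ones {1..Ns})(j := 2, i := 0))"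
    using i j s A by (auto simp: fun_eq_iff conf_def ones_def B_def)
  then show ?thesis using ij nbr_sym[OF ij] s unfolding dipole_def by auto
qed

text \<open>A dipole inside one part preserves the particle number of A, so on X1 only the dipoles
  across the cut remain.\<close>

lemma dipole_X1:
  assumes a: "a \<in> X1" and b: "b \<in> Y" and e: "dipole Ns (\<lambda>x. a x + b x)"
  obtains i j s where "i \<in> A" "j \<in> B" "s \<in> {0, 2}" "nbr Ns i j" "a = conf A i s" "b = conf B j (2 - s)"
proof (rule dipole_add_cases[OF _ b e])
  show "a \<in> X" using a X1 by blast
  assume bo: "b = ones B"
  have "(\<Sum>x\<in>A. a x) + (\<Sum>x\<in>B. b x) = Ns"
    using dipole_occs_eq[OF e Ns2] add_occs_eq[of a b] a b X1 by blast
  then have "(\<Sum>x\<in>A. a x) = card A" using cardAB(1) ones_num[of B] unfolding bo by linarith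
  then show thesis using a by (simp add: X1_def)
next
  assume "a = ones A"
  then show thesis using a ones_num[of A] by (simp add: X1_def)
next
  fix i j s assume "i \<in> A" "j \<in> B" "s \<in> {0, 2}" "nbr Ns i j" "a = conf A i s" "b = conf B j (2 - s)"
  then show thesis by (rule that)
qed

lemma G_conf:
  assumes i: "i \<in> A" and s: "s \<in> {0, 2}" and b: "b \<in> Y"
  shows "G (conf A i s) b = (if \<exists>j\<in>B. nbr Ns i j \<and> b = conf B j (2 - s) then 1 else 0)"
proof -
  have "dipole Ns (\<lambda>x. conf A i s x + b x) \<longleftrightarrow> (\<exists>j\<in>B. nbr Ns i j \<and> b = conf B j (2 - s))"
  proof
    assume "dipole Ns (\<lambda>x. conf A i s x + b x)"
    then obtain i' j s' where "i' \<in> A" "j \<in> B" "s' \<in> {0, 2}" "nbr Ns i' j" "conf A i s = conf A i' s'" "b = conf B j (2 - s')"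
      by (rule dipole_X1[OF conf_X1[OF i s] b])
    then show "\<exists>j\<in>B. nbr Ns i j \<and> b = conf B j (2 - s)" using conf_inj[of s s' i A i'] i s by auto
  next
    assume "\<exists>j\<in>B. nbr Ns i j \<and> b = conf B j (2 - s)"
    then show "dipole Ns (\<lambda>x. conf A i s x + b x)" using dipole_conf_add[OF i _ s] by blast
  qed
  then show ?thesis by (simp add: G_def dipole_amp_def)
qed

definition "T i i' = card {j \<in> B. nbr Ns i j \<and> nbr Ns i' j}"

text \<open>Two configurations of A overlap through B when the same partner completes both to a
  dipole: the partner being a hole or a surplus fixes s, and its site is a common neighbour. So S
  contains two copies of T, one for each s.\<close>

lemma S_conf:
  assumes i: "i \<in> A" "i' \<in> A" and s: "s \<in> {0, 2}" "s' \<in> {0, 2}"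
  shows "S (conf A i s) (conf A i' s') = (if s = s' then T i i' else 0)"
proof -
  let ?J = "{j \<in> B. nbr Ns i j \<and> nbr Ns i' j}"
  have r: "2 - s \<in> {0, 2}" "2 - s' \<in> {0, 2}" using s by auto
  have GG: "G (conf A i s) b * G (conf A i' s') b
     = (if s = s' \<and> b \<in> (\<lambda>j. conf B j (2 - s)) ` ?J then 1 else 0)" if b: "b \<in> Y" for b
  proof (cases "(\<exists>j\<in>B. nbr Ns i j \<and> b = conf B j (2 - s)) \<and> (\<exists>j\<in>B. nbr Ns i' j \<and> b = conf B j (2 - s'))")
    case True
    then obtain j j' where j: "j \<in> B" "nbr Ns i j" "b = conf B j (2 - s)"
      and j': "j' \<in> B" "nbr Ns i' j'" "b = conf B j' (2 - s')"
      by blast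
    have "j = j' \<and> 2 - s = 2 - s'" using conf_inj[OF r j(1) j'(1)] j(3) j'(3) by simp
    then have "j = j'" "s = s'" using s by auto
    then show ?thesis using True j j' unfolding G_conf[OF i(1) s(1) b] G_conf[OF i(2) s(2) b] by auto
  next
    case False
    then show ?thesis unfolding G_conf[OF i(1) s(1) b] G_conf[OF i(2) s(2) b] by auto
  qed
  have inj: "inj_on (\<lambda>j. conf B j (2 - s)) ?J"
    using conf_inj[OF r(1) r(1)] by (auto intro!: inj_onI)
  have sub: "(\<lambda>j. conf B j (2 - s)) ` ?J \<subseteq> Y" using conf_Y r(1) by auto
  have "S (conf A i s) (conf A i' s') = (\<Sum>b\<in>Y. if s = s' \<and> b \<in> (\<lambda>j. conf B j (2 - s)) ` ?J then 1 else 0)"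
    unfolding S_def by (intro sum.cong refl GG)
  also have "\<dots> = (if s = s' then card ((\<lambda>j. conf B j (2 - s)) ` ?J) else 0)"
    using finY sub by (auto simp: sum.inter_restrict[symmetric] Int_absorb1)
  finally show ?thesis unfolding T_def card_image[OF inj] .
qed

lemma S_not_conf:
  assumes "a \<in> X1" "\<not> (\<exists>i\<in>A. \<exists>s\<in>{0, 2}. a = conf A i s)"
  shows "S a a' = 0"
proof -
  have "G a b = 0" if "b \<in> Y" for b
    using dipole_X1[OF assms(1) that] assms(2) unfolding G_def dipole_amp_def by (metis (full_types))
  then show ?thesis by (simp add: S_def)
qed

section \<open>Comparison of the reduced density matrix with its leading part\<close>

definition "Q = card Y * (2 * K + K\<^sup>2)"

lemma Q: "Q \<ge> 0" using K by (simp add: Q_def)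

lemma epow: "\<epsilon> ^ 4 \<le> \<epsilon> ^ 3" "\<epsilon> ^ 6 \<le> \<epsilon> ^ 4" "\<epsilon>\<^sup>2 \<le> \<epsilon>" "\<epsilon> ^ 3 \<le> \<epsilon>\<^sup>2"
  using \<epsilon> power_decreasing[of 1 2 \<epsilon>] by (auto intro!: power_decreasing)

lemma gram_diff_bound:
  assumes "\<And>b. b \<in> Y \<Longrightarrow> cmod (M a b * cnj (M a' b) - of_real (\<epsilon>\<^sup>2 * (G a b * G a' b))) \<le> (2 * K + K\<^sup>2) * c"
  shows "cmod (gram Y M a a' - of_real (\<epsilon>\<^sup>2 * S a a')) \<le> Q * c"
proof -
  have "gram Y M a a' - of_real (\<epsilon>\<^sup>2 * S a a') = (\<Sum>b\<in>Y. M a b * cnj (M a' b) - of_real (\<epsilon>\<^sup>2 * (G a b * G a' b)))"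
    by (simp add: gram_def S_def sum_subtractf sum_distrib_left)
  also have "cmod \<dots> \<le> (\<Sum>b\<in>Y. (2 * K + K\<^sup>2) * c)"
    by (intro order_trans[OF norm_sum] sum_mono assms)
  finally show ?thesis by (simp add: Q_def)
qed

text \<open>With no control of parity, an unflipped amplitude of order eps^2 may meet a dipole of
  order eps, which limits the accuracy to third order.\<close>

lemma gram_approx:
  assumes "a \<in> X1" "a' \<in> X1"
  shows "cmod (gram Y M a a' - of_real (\<epsilon>\<^sup>2 * S a a')) \<le> Q * \<epsilon> ^ 3"
proof (rule gram_diff_bound)
  fix b assume b: "b \<in> Y"
  have "cmod (M a b * cnj (M a' b) - of_real (\<epsilon>\<^sup>2 * (G a b * G a' b))) \<le> 2 * \<epsilon> * (K * \<epsilon>\<^sup>2) + (K * \<epsilon>\<^sup>2)\<^sup>2"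
    unfolding M_def G_def
    by (rule product_perturbation) (use bounds(3) X1_add_neq[OF _ b] assms \<epsilon> dipole_amp_bounds in auto)
  also have "\<dots> = 2 * K * \<epsilon> ^ 3 + K\<^sup>2 * \<epsilon> ^ 4" by (simp add: eval_nat_numeral)
  also have "\<dots> \<le> 2 * K * \<epsilon> ^ 3 + K\<^sup>2 * \<epsilon> ^ 3" using epow by (intro add_left_mono mult_left_mono) auto
  finally show "cmod (M a b * cnj (M a' b) - of_real (\<epsilon>\<^sup>2 * (G a b * G a' b))) \<le> (2 * K + K\<^sup>2) * \<epsilon> ^ 3"
    by (simp add: distrib_right)
qed

definition "wt a = (\<Sum>x = 1..Ns. x * a x)" for a :: occ

lemma flipped_add:
  "flipped Ns (\<lambda>x. a x + b x) \<longleftrightarrow> odd (wt a + (\<Sum>x = 1..Ns. x * (b x + 1)))"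
  by (simp add: flipped_def wt_def algebra_simps sum.distrib)

text \<open>With equal parity, a and a' combined with the same b are both flipped or both unflipped.
  In the first case each amplitude has error eps^3 and meets a factor eps; in the second G vanishes
  and both amplitudes are of order eps^2. Third-order terms cannot occur.\<close>

lemma gram_approx_same_parity:
  assumes a: "a \<in> X1" "a' \<in> X1" and par: "even (wt a + wt a')"
  shows "cmod (gram Y M a a' - of_real (\<epsilon>\<^sup>2 * S a a')) \<le> Q * \<epsilon> ^ 4"
proof (rule gram_diff_bound)
  fix b assume b: "b \<in> Y"
  have f: "flipped Ns (\<lambda>x. a' x + b x) \<longleftrightarrow> flipped Ns (\<lambda>x. a x + b x)"
    using par unfolding flipped_add by auto
  show "cmod (M a b * cnj (M a' b) - of_real (\<epsilon>\<^sup>2 * (G a b * G a' b))) \<le> (2 * K + K\<^sup>2) * \<epsilon> ^ 4"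
  proof (cases "flipped Ns (\<lambda>x. a x + b x)")
    case True
    have "cmod (M a b * cnj (M a' b) - of_real (\<epsilon>\<^sup>2 * (G a b * G a' b))) \<le> 2 * \<epsilon> * (K * \<epsilon> ^ 3) + (K * \<epsilon> ^ 3)\<^sup>2"
      unfolding M_def G_def
      by (rule product_perturbation) (use bounds(1) True f \<epsilon> dipole_amp_bounds in auto)
    also have "\<dots> = 2 * K * \<epsilon> ^ 4 + K\<^sup>2 * \<epsilon> ^ 6" by (simp add: eval_nat_numeral)
    also have "\<dots> \<le> 2 * K * \<epsilon> ^ 4 + K\<^sup>2 * \<epsilon> ^ 4" using epow by (intro add_left_mono mult_left_mono) auto
    finally show ?thesis by (simp add: distrib_right)
  next
    case False
    then have "G a b = 0" using dipole_flipped[OF _ Ns2 ev] by (auto simp: G_def dipole_amp_def)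
    then have "cmod (M a b * cnj (M a' b) - of_real (\<epsilon>\<^sup>2 * (G a b * G a' b))) = cmod (M a b) * cmod (M a' b)"
      by (simp add: norm_mult)
    also have "\<dots> \<le> (K * \<epsilon>\<^sup>2) * (K * \<epsilon>\<^sup>2)"
      unfolding M_def using bounds(2) False f X1_add_neq[OF _ b] a K by (intro mult_mono) auto
    also have "\<dots> = K\<^sup>2 * \<epsilon> ^ 4" by (simp add: eval_nat_numeral)
    also have "\<dots> \<le> (2 * K + K\<^sup>2) * \<epsilon> ^ 4" using K \<epsilon> by (intro mult_right_mono) auto
    finally show ?thesis .
  qed
qed

text \<open>Particle conservation: b determines the particle number of A, which is
  \<open>card A\<close> off X1 and different on X1.\<close>

lemma gram_block:
  assumes "a \<in> X1" "a' \<in> X - X1"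
  shows "gram Y M a a' = 0"
  unfolding gram_def
proof (rule sum.neutral[OF ballI], rule ccontr)
  fix b assume b: "b \<in> Y" and "M a b * cnj (M a' b) \<noteq> 0"
  then have "(\<Sum>x\<in>A. a x) + (\<Sum>x\<in>B. b x) = Ns" "(\<Sum>x\<in>A. a' x) + (\<Sum>x\<in>B. b x) = Ns"
    using M_nonzero[of a b] M_nonzero[of a' b] assms X1 by auto
  then show False using assms by (simp add: X1_def)
qed

text \<open>Normalization of the state: adding occupations is injective on pairs and reaches the
  whole sector, and the amplitude vanishes on the other sums.\<close>

lemma trace_one: "(\<Sum>a\<in>X. mass Y M a) = 1"
proof -
  let ?h = "\<lambda>(a, b). (\<lambda>x. a x + b x :: nat)"
  have inj: "inj_on ?h (X \<times> Y)"
  proof (rule inj_onI, clarify)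
    fix a b a' b' assume "a \<in> X" "b \<in> Y" "a' \<in> X" "b' \<in> Y" "(\<lambda>x. a x + b x) = (\<lambda>x. a' x + b' x)"
    then show "a = a' \<and> b = b'"
      using add_eq_split[of a b "\<lambda>x. a' x + b' x"] add_eq_split[of a' b' "\<lambda>x. a' x + b' x"] by metis
  qed
  have sub: "occs_eq {1..Ns} Ns \<subseteq> ?h ` (X \<times> Y)"
  proof
    fix n assume n: "n \<in> occs_eq {1..Ns} Ns"
    let ?a = "\<lambda>x. if x \<in> A then n x else 0" and ?b = "\<lambda>x. if x \<in> B then n x else 0"
    have "(\<Sum>x\<in>A. n x) + (\<Sum>x\<in>B. n x) = Ns" using n sum_split[of n] by (simp add: occs_eq_def)
    then have "?a \<in> X" "?b \<in> Y" by (auto simp: X_def Y_def occs_le_def occs_def)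
    moreover have "n = ?h (?a, ?b)" using n by (auto simp: fun_eq_iff occs_eq_def occs_def B_def)
    ultimately show "n \<in> ?h ` (X \<times> Y)" by blast
  qed
  have "(\<Sum>a\<in>X. mass Y M a) = (\<Sum>p\<in>X \<times> Y. (cmod (\<phi> (?h p)))\<^sup>2)"
    unfolding mass_def M_def by (simp add: sum.cartesian_product case_prod_beta)
  also have "\<dots> = (\<Sum>n\<in>?h ` (X \<times> Y). (cmod (\<phi> n))\<^sup>2)"
    by (simp only: sum.reindex[OF inj] o_def)
  also have "\<dots> = (\<Sum>n\<in>occs_eq {1..Ns} Ns. (cmod (\<phi> n))\<^sup>2)"
    by (rule sum.mono_neutral_right[OF _ sub]) (use finX finY nm in \<open>auto simp: near_mott_def sector_def\<close>)
  finally show ?thesis using nm by (simp add: near_mott_def)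
qed

section \<open>The inner block has nearly rank one\<close>

definition "Q2 = K + 2 * (1 + K)\<^sup>2"

text \<open>A 2 by 2 minor with the Mott row and column, divided by the Mott amplitude. It vanishes
  in that row and column; elsewhere a + b is not a dipole, because a dipole across the cut would put
  a into X1. Then M a b is of order eps^2, which gives the K in \<open>Q2\<close>, and the product
  has two factors of order eps over an amplitude of at least 1/2, which gives 2 (1 + K)^2.\<close>

lemma inner_minor_bound:
  assumes a: "a \<in> X - X1" and b: "b \<in> Y"
  shows "cmod (M a b - M (ones A) b / M (ones A) (ones B) * M a (ones B)) \<le> Q2 * \<epsilon>\<^sup>2"
proof -
  let ?c = "M (ones A) (ones B)"
  have c: "?c = \<phi> (ones {1..Ns})"
    using add_ones[OF ones_X ones_Y] by (simp add: M_def)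
  have "cmod (?c - 1) \<le> 1 / 2" using nm small unfolding c near_mott_def by linarith
  moreover have "cmod (1::complex) \<le> cmod (1 - ?c) + cmod ?c" using norm_triangle_ineq[of "1 - ?c" ?c] by simp
  ultimately have ch: "cmod ?c \<ge> 1 / 2" by (simp add: norm_minus_commute)
  then have c0: "?c \<noteq> 0" by auto
  have Q2: "0 \<le> Q2 * \<epsilon>\<^sup>2" using K by (simp add: Q2_def)
  have first: "cmod (M a b) \<le> (1 + K) * \<epsilon>" if "(\<lambda>x. a x + b x) \<noteq> ones {1..Ns}" for a b
  proof -
    have "cmod (M a b) \<le> cmod (M a b - of_real (\<epsilon> * G a b)) + cmod (of_real (\<epsilon> * G a b) :: complex)"
      using norm_triangle_ineq[of "M a b - of_real (\<epsilon> * G a b)" "of_real (\<epsilon> * G a b)"] by simp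
    also have "\<dots> \<le> K * \<epsilon>\<^sup>2 + \<epsilon> * 1"
      using bounds(3)[OF that] \<epsilon> dipole_amp_bounds[of Ns]
      unfolding M_def G_def norm_of_real abs_mult by (intro add_mono mult_mono) auto
    also have "\<dots> \<le> K * \<epsilon> + \<epsilon> * 1" using epow K \<epsilon> by (intro add_mono mult_left_mono) auto
    finally show ?thesis by (simp add: algebra_simps)
  qed
  consider "b = ones B" | "a = ones A" | "a \<noteq> ones A" "b \<noteq> ones B" by blast
  then show ?thesis
  proof cases
    case 3
    have aX: "a \<in> X" using a by blast
    have n: "(\<lambda>x. a x + b x) \<noteq> ones {1..Ns}" using add_ones[OF aX b] 3 by blast
    have "\<not> dipole Ns (\<lambda>x. a x + b x)"
    proof
      assume "dipole Ns (\<lambda>x. a x + b x)"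
      then show False
        by (rule dipole_add_cases[OF aX b]) (use 3 a conf_X1 in auto)
    qed
    then have "cmod (M a b) \<le> K * \<epsilon>\<^sup>2" using bounds(3)[OF n] by (simp add: M_def dipole_amp_def)
    moreover have "cmod (M (ones A) b / ?c * M a (ones B)) \<le> 2 * (1 + K)\<^sup>2 * \<epsilon>\<^sup>2"
    proof -
      have 1: "cmod (M (ones A) b) \<le> (1 + K) * \<epsilon>" using first add_ones[OF ones_X b] 3 by blast
      have 2: "cmod (M a (ones B)) \<le> (1 + K) * \<epsilon>" using first add_ones[OF aX ones_Y] 3 by blast
      have "cmod (M (ones A) b / ?c * M a (ones B)) = cmod (M (ones A) b) * cmod (M a (ones B)) / cmod ?c"
        by (simp add: norm_mult norm_divide)
      also have "\<dots> \<le> ((1 + K) * \<epsilon>) * ((1 + K) * \<epsilon>) / (1 / 2)"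
        using 1 2 ch K \<epsilon> by (intro frac_le mult_mono) auto
      finally show ?thesis by (simp add: power2_eq_square algebra_simps)
    qed
    ultimately show ?thesis
      using norm_triangle_ineq4[of "M a b" "M (ones A) b / ?c * M a (ones B)"]
      by (simp add: Q2_def distrib_right)
  qed (use c0 Q2 in auto)
qed

text \<open>On the inner block the trace minus the Rayleigh quotient of w is the sum over the
  columns of their squared distances to the line of w. By \<open>inner_minor_bound\<close> these
  distances are of order eps^2, so w misses only O(eps^4) of the trace.\<close>

lemma main_schmidt_vector:
  obtains w where "norm_sq X w = 1" "\<And>a. a \<in> X1 \<Longrightarrow> w a = 0"
    "1 - (\<Sum>a\<in>X1. mass Y M a) - card X * card Y * Q2\<^sup>2 * \<epsilon> ^ 4 \<le> rayleigh X (gram Y M) w"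
proof -
  let ?c = "M (ones A) (ones B)"
  define z where "z a = M a (ones B)" for a
  define V where "V = X - X1"
  have V: "finite V" "V \<subseteq> X" using finX by (auto simp: V_def)
  have z0: "z a = 0" if "a \<in> X1" for a
  proof (rule ccontr)
    assume "z a \<noteq> 0"
    then have "(\<Sum>x\<in>A. a x) + (\<Sum>x\<in>B. ones B x) = Ns"
      using M_nonzero[OF _ ones_Y, of a] that X1 by (auto simp: z_def)
    then show False using that cardAB(1) ones_num[of B] by (simp add: X1_def)
  qed
  have nV: "norm_sq X y = norm_sq V y" if "\<And>a. a \<in> X1 \<Longrightarrow> y a = 0" for y
    unfolding norm_sq_def V_def using sum.subset_diff[OF X1 finX, of "\<lambda>a. (cmod (y a))\<^sup>2"] that by simp
  have "\<phi> (ones {1..Ns}) \<noteq> 0"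
  proof
    assume "\<phi> (ones {1..Ns}) = 0"
    then have "1 \<le> K * \<epsilon>\<^sup>2" using nm by (simp add: near_mott_def)
    then show False using small by simp
  qed
  then have "z (ones A) \<noteq> 0" using add_ones[OF ones_X ones_Y] by (simp add: M_def z_def)
  then have "norm_sq X z \<noteq> 0" unfolding norm_sq_eq_0[OF finX] using ones_X by blast
  then have nz: "norm_sq X z > 0" using norm_sq_nonneg[of X z] by simp
  define w where "w a = of_real (1 / sqrt (norm_sq X z)) * z a" for a
  have w1: "norm_sq X w = 1" unfolding w_def norm_sq_scale norm_of_real using nz by (simp add: power_divide)
  have w0: "w a = 0" if "a \<in> X1" for a using z0[OF that] by (simp add: w_def)
  have wV: "norm_sq V w = 1" using nV[of w] w0 w1 by simp
  have ipV: "(\<Sum>a\<in>X. cnj (w a) * M a b) = ip V w (\<lambda>a. M a b)" for b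
    unfolding ip_def V_def using sum.subset_diff[OF X1 finX, of "\<lambda>a. cnj (w a) * M a b"] w0 by simp
  have "(\<Sum>b\<in>Y. norm_sq V (\<lambda>a. M a b)) - rayleigh X (gram Y M) w
     = (\<Sum>b\<in>Y. norm_sq V (\<lambda>a. M a b) - (cmod (ip V w (\<lambda>a. M a b)))\<^sup>2)"
    unfolding rayleigh_gram ipV by (simp add: sum_subtractf)
  also have "\<dots> \<le> (\<Sum>b\<in>Y. card X * (Q2 * \<epsilon>\<^sup>2)\<^sup>2)"
  proof (rule sum_mono)
    fix b assume b: "b \<in> Y"
    \<comment> \<open>Makes \<open>?l * w\<close> the rank-one approximation of column b; the square
      root undoes the normalization of w.\<close>
    let ?l = "M (ones A) b / ?c * of_real (sqrt (norm_sq X z))"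
    have "norm_sq V (\<lambda>a. M a b) - (cmod (ip V w (\<lambda>a. M a b)))\<^sup>2 \<le> norm_sq V (\<lambda>a. M a b - ?l * w a)"
      by (rule line_distance[OF wV V(1)])
    also have "\<dots> = norm_sq V (\<lambda>a. M a b - M (ones A) b / ?c * M a (ones B))"
      using nz by (simp add: w_def z_def)
    also have "\<dots> \<le> (\<Sum>a\<in>V. (Q2 * \<epsilon>\<^sup>2)\<^sup>2)"
      unfolding norm_sq_def using inner_minor_bound[OF _ b] by (intro sum_mono power_mono) (auto simp: V_def)
    also have "\<dots> \<le> card X * (Q2 * \<epsilon>\<^sup>2)\<^sup>2"
      using card_mono[OF finX V(2)] by (simp add: mult_right_mono)
    finally show "norm_sq V (\<lambda>a. M a b) - (cmod (ip V w (\<lambda>a. M a b)))\<^sup>2 \<le> card X * (Q2 * \<epsilon>\<^sup>2)\<^sup>2" .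
  qed
  also have "\<dots> = card X * card Y * Q2\<^sup>2 * \<epsilon> ^ 4" by (simp add: power_mult_distrib flip: power_mult)
  finally have le: "(\<Sum>b\<in>Y. norm_sq V (\<lambda>a. M a b)) - rayleigh X (gram Y M) w \<le> card X * card Y * Q2\<^sup>2 * \<epsilon> ^ 4" .
  have "(\<Sum>b\<in>Y. norm_sq V (\<lambda>a. M a b)) = (\<Sum>a\<in>V. mass Y M a)"
    unfolding norm_sq_def mass_def by (rule sum.swap)
  also have "\<dots> = 1 - (\<Sum>a\<in>X1. mass Y M a)"
    using sum.subset_diff[OF X1 finX, of "mass Y M"] trace_one by (simp add: V_def)
  finally show ?thesis using that[OF w1 w0] le by simp
qed

section \<open>Leading weights and trial vectors on the outer block\<close>

lemma wt_conf:
  assumes "i \<in> A" "i' \<in> A" "even (i + i')" "s \<in> {0, 2}"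
  shows "even (wt (conf A i s) + wt (conf A i' s))"
proof -
  have e: "even (wt (conf A j s)) \<longleftrightarrow> even ((\<Sum>x\<in>A. x) + j)" if "j \<in> A" for j
  proof -
    have "wt (conf A j s) + j = (\<Sum>x\<in>A. x) + j * s"
      unfolding wt_def using conf_sum[OF that A(1), of "\<lambda>x. x"] by simp
    then have "even (wt (conf A j s) + j) \<longleftrightarrow> even ((\<Sum>x\<in>A. x) + j * s)" by simp
    moreover have "even (j * s)" using assms(4) by auto
    ultimately show ?thesis unfolding even_add by blast
  qed
  show ?thesis using e[OF assms(1)] e[OF assms(2)] assms(3) by auto
qed

text \<open>A diagonal entry pairs a with itself, so the parities agree and the fourth-order
  estimate applies to the whole trace. The factor 2 counts surplus and hole.\<close>

lemma outer_mass:
  "\<bar>(\<Sum>a\<in>X1. mass Y M a) - \<epsilon>\<^sup>2 * (2 * (\<Sum>i\<in>A. real (T i i)))\<bar> \<le> card X * Q * \<epsilon> ^ 4"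
proof -
  let ?c = "\<lambda>(i, s). conf A i s"
  have inj: "inj_on ?c (A \<times> {0, 2})" using conf_inj by (auto intro!: inj_onI)
  have sub: "?c ` (A \<times> {0, 2}) \<subseteq> X1" using conf_X1 by auto
  have "(\<Sum>a\<in>X1. S a a) = (\<Sum>a\<in>?c ` (A \<times> {0, 2}). S a a)"
  proof (rule sum.mono_neutral_right[OF _ sub ballI])
    show "finite X1" using finX X1 finite_subset by blast
    fix a assume "a \<in> X1 - ?c ` (A \<times> {0, 2})"
    then show "S a a = 0" by (intro S_not_conf) force+
  qed
  also have "\<dots> = (\<Sum>p\<in>A \<times> {0, 2}. S (?c p) (?c p))"
    by (simp only: sum.reindex[OF inj] o_def)
  also have "\<dots> = (\<Sum>i\<in>A. \<Sum>s\<in>{0, 2}. S (conf A i s) (conf A i s))"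
    unfolding sum.cartesian_product by (simp add: case_prod_beta)
  also have "\<dots> = (\<Sum>i\<in>A. real (T i i) + real (T i i))"
    by (intro sum.cong refl) (simp add: S_conf)
  finally have S: "(\<Sum>a\<in>X1. S a a) = 2 * (\<Sum>i\<in>A. real (T i i))"
    by (simp add: sum.distrib sum_distrib_left)
  have "\<bar>(\<Sum>a\<in>X1. mass Y M a) - \<epsilon>\<^sup>2 * (\<Sum>a\<in>X1. S a a)\<bar> = \<bar>\<Sum>a\<in>X1. mass Y M a - \<epsilon>\<^sup>2 * S a a\<bar>"
    by (simp add: sum_subtractf sum_distrib_left)
  also have "\<dots> \<le> (\<Sum>a\<in>X1. Q * \<epsilon> ^ 4)"
  proof (intro order_trans[OF sum_abs] sum_mono)
    fix a assume a: "a \<in> X1"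
    have "cmod (of_real (mass Y M a - \<epsilon>\<^sup>2 * S a a)) \<le> Q * \<epsilon> ^ 4"
      using gram_approx_same_parity[OF a a] by (simp add: gram_diag del: of_real_power)
    then show "\<bar>mass Y M a - \<epsilon>\<^sup>2 * S a a\<bar> \<le> Q * \<epsilon> ^ 4" unfolding norm_of_real .
  qed
  also have "\<dots> \<le> card X * (Q * \<epsilon> ^ 4)"
    using card_mono[OF finX X1] Q \<epsilon> by (simp add: mult_right_mono)
  finally show ?thesis unfolding S by simp
qed

text \<open>Embeds functions on the sites of A as superpositions of a single surplus or a single
  hole. By \<open>ip_lift\<close> it is isometric for each s, and the two values of s give
  orthogonal images.\<close>

definition lift :: "(nat \<Rightarrow> complex) \<Rightarrow> nat \<Rightarrow> occ \<Rightarrow> complex" where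
  "lift f s a = (\<Sum>i\<in>A. if a = conf A i s then f i else 0)"

lemma sum_lift:
  assumes "s \<in> {0, 2}"
  shows "(\<Sum>a\<in>X. F a * lift f s a) = (\<Sum>i\<in>A. F (conf A i s) * f i)"
proof -
  have "(\<Sum>a\<in>X. F a * lift f s a) = (\<Sum>a\<in>X. \<Sum>i\<in>A. if a = conf A i s then F (conf A i s) * f i else 0)"
    unfolding lift_def sum_distrib_left by (intro sum.cong refl) auto
  also have "\<dots> = (\<Sum>i\<in>A. \<Sum>a\<in>X. if a = conf A i s then F (conf A i s) * f i else 0)"
    by (rule sum.swap)
  also have "\<dots> = (\<Sum>i\<in>A. F (conf A i s) * f i)"
    using conf_X1[OF _ assms] X1 finX by (intro sum.cong refl) auto
  finally show ?thesis .
qed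

lemma lift_conf:
  assumes "s \<in> {0, 2}" "s' \<in> {0, 2}" "i \<in> A"
  shows "lift f s (conf A i s') = (if s = s' then f i else 0)"
proof -
  have "lift f s (conf A i s') = (\<Sum>i'\<in>A. if i' = i then if s = s' then f i else 0 else 0)"
    unfolding lift_def using assms by (intro sum.cong refl) (auto simp: conf_inj)
  then show ?thesis using finA assms(3) by simp
qed

lemma lift_not_conf:
  assumes "\<not> (\<exists>i\<in>A. a = conf A i s)"
  shows "lift f s a = 0"
  using assms by (auto simp: lift_def intro!: sum.neutral)

lemma ip_lift:
  assumes "s \<in> {0, 2}" "s' \<in> {0, 2}"
  shows "ip X (lift f s) (lift g s') = (if s = s' then ip A f g else 0)"
proof -
  have "ip X (lift f s) (lift g s') = (\<Sum>i\<in>A. cnj (lift f s (conf A i s')) * g i)"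
    unfolding ip_def by (rule sum_lift[OF assms(2)])
  also have "\<dots> = (\<Sum>i\<in>A. if s = s' then cnj (f i) * g i else 0)"
    using assms by (intro sum.cong refl) (simp add: lift_conf)
  finally show ?thesis by (simp add: ip_def)
qed

lemma mat_vec_lift: "s \<in> {0, 2} \<Longrightarrow> mat_vec X R (lift f s) a = (\<Sum>i\<in>A. R a (conf A i s) * f i)"
  unfolding mat_vec_def by (rule sum_lift)

text \<open>An eigenvector of T lifts to one of S on all of X1: the two values of s decouple, and
  both sides vanish at configurations other than a single surplus or hole.\<close>

lemma S_lift:
  assumes a: "a \<in> X1" and s: "s \<in> {0, 2}"
    and eig: "\<And>i. i \<in> A \<Longrightarrow> (\<Sum>i'\<in>A. of_nat (T i i') * f i') = of_real \<mu> * f i"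
  shows "(\<Sum>i\<in>A. of_real (S a (conf A i s)) * f i) = of_real \<mu> * lift f s a"
proof (cases "\<exists>i\<in>A. \<exists>s'\<in>{0, 2}. a = conf A i s'")
  case True
  then obtain i' s' where i': "i' \<in> A" and s': "s' \<in> {0, 2}" and a': "a = conf A i' s'" by blast
  have "(\<Sum>i\<in>A. of_real (S a (conf A i s)) * f i) = (\<Sum>i\<in>A. if s' = s then of_nat (T i' i) * f i else 0)"
    unfolding a' using S_conf[OF i' _ s' s] by (intro sum.cong refl) auto
  also have "\<dots> = (if s' = s then of_real \<mu> * f i' else 0)"
    using eig[OF i'] by simp
  finally show ?thesis unfolding a' lift_conf[OF s s' i'] by auto
next
  case False
  then have "lift f s a = 0" using s by (intro lift_not_conf) blast
  then show ?thesis using S_not_conf[OF a False] by simp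
qed

lemma unit_component: "norm_sq A f = 1 \<Longrightarrow> i \<in> A \<Longrightarrow> cmod (f i) \<le> 1"
  using member_le_sum[of i A "\<lambda>i. (cmod (f i))\<^sup>2"] finA by (simp add: norm_sq_def abs_square_le_1)

text \<open>The row a ranges over configurations of either parity, so the third-order estimate is
  the one available; squared, it gives the sixth order required.\<close>

lemma lift_defect:
  assumes s: "s \<in> {0, 2}" and f: "norm_sq A f = 1"
    and eig: "\<And>i. i \<in> A \<Longrightarrow> (\<Sum>i'\<in>A. of_nat (T i i') * f i') = of_real \<mu> * f i"
  shows "norm_sq X (\<lambda>a. mat_vec X (gram Y M) (lift f s) a - of_real (\<epsilon>\<^sup>2 * \<mu>) * lift f s a)
    \<le> card X * (card A * Q)\<^sup>2 * \<epsilon> ^ 6"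
proof -
  have "cmod (mat_vec X (gram Y M) (lift f s) a - of_real (\<epsilon>\<^sup>2 * \<mu>) * lift f s a) \<le> card A * (Q * \<epsilon> ^ 3)"
    if a: "a \<in> X" for a
  proof (cases "a \<in> X1")
    case True
    have Sl: "(\<Sum>i\<in>A. of_real (S a (conf A i s)) * f i) = of_real \<mu> * lift f s a"
      by (rule S_lift[OF True s]) (rule eig)
    have "mat_vec X (gram Y M) (lift f s) a - of_real (\<epsilon>\<^sup>2 * \<mu>) * lift f s a
      = (\<Sum>i\<in>A. gram Y M a (conf A i s) * f i) - of_real (\<epsilon>\<^sup>2) * (of_real \<mu> * lift f s a)"
      by (simp add: mat_vec_lift[OF s])
    also have "\<dots> = (\<Sum>i\<in>A. (gram Y M a (conf A i s) - of_real (\<epsilon>\<^sup>2 * S a (conf A i s))) * f i)"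
      unfolding Sl[symmetric]
      by (simp add: sum_distrib_left left_diff_distrib sum_subtractf mult.assoc)
    also have "cmod \<dots> \<le> (\<Sum>i\<in>A. (Q * \<epsilon> ^ 3) * 1)"
    proof (intro order_trans[OF norm_sum] sum_mono)
      fix i assume i: "i \<in> A"
      show "cmod ((gram Y M a (conf A i s) - of_real (\<epsilon>\<^sup>2 * S a (conf A i s))) * f i) \<le> (Q * \<epsilon> ^ 3) * 1"
        unfolding norm_mult[of _ "f i"]
        using gram_approx[OF True conf_X1[OF i s]] unit_component[OF f i] Q \<epsilon> by (intro mult_mono) auto
    qed
    finally show ?thesis by simp
  next
    case False
    have "gram Y M a (conf A i s) = 0" if "i \<in> A" for i
    proof -
      have "gram Y M a (conf A i s) = cnj (gram Y M (conf A i s) a)" by (simp add: gram_def mult.commute)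
      then show ?thesis using gram_block[OF conf_X1[OF that s], of a] a False by simp
    qed
    moreover have "lift f s a = 0" using False conf_X1[OF _ s] by (intro lift_not_conf) blast
    ultimately show ?thesis using Q \<epsilon> by (simp add: mat_vec_lift[OF s])
  qed
  then have "norm_sq X (\<lambda>a. mat_vec X (gram Y M) (lift f s) a - of_real (\<epsilon>\<^sup>2 * \<mu>) * lift f s a)
     \<le> (\<Sum>a\<in>X. (card A * (Q * \<epsilon> ^ 3))\<^sup>2)"
    unfolding norm_sq_def by (intro sum_mono power_mono) auto
  also have "\<dots> = card X * (card A * Q)\<^sup>2 * \<epsilon> ^ 6" by (simp add: power_mult_distrib flip: power_mult)
  finally show ?thesis .
qed

text \<open>Here both indices run over the support of f, which by \<open>par\<close> lies on one
  sublattice; the equal-parity estimate therefore applies to every nonzero term and gives fourth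
  order.\<close>

lemma lift_rayleigh:
  assumes s: "s \<in> {0, 2}" and f: "norm_sq A f = 1"
    and eig: "\<And>i. i \<in> A \<Longrightarrow> (\<Sum>i'\<in>A. of_nat (T i i') * f i') = of_real \<mu> * f i"
    and par: "\<And>i i'. i \<in> A \<Longrightarrow> i' \<in> A \<Longrightarrow> f i \<noteq> 0 \<Longrightarrow> f i' \<noteq> 0 \<Longrightarrow> even (i + i')"
  shows "\<bar>rayleigh X (gram Y M) (lift f s) - \<epsilon>\<^sup>2 * \<mu>\<bar> \<le> (card A)\<^sup>2 * Q * \<epsilon> ^ 4"
proof -
  have 1: "ip X (lift f s) (mat_vec X (gram Y M) (lift f s))
     = (\<Sum>i\<in>A. cnj (f i) * (\<Sum>i'\<in>A. gram Y M (conf A i s) (conf A i' s) * f i'))"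
  proof -
    have "ip X (lift f s) (mat_vec X (gram Y M) (lift f s)) = cnj (\<Sum>a\<in>X. cnj (mat_vec X (gram Y M) (lift f s) a) * lift f s a)"
      by (simp add: ip_def mult.commute)
    also have "\<dots> = (\<Sum>i\<in>A. cnj (f i) * mat_vec X (gram Y M) (lift f s) (conf A i s))"
      unfolding sum_lift[OF s] by (simp add: mult.commute)
    finally show ?thesis by (simp add: mat_vec_lift[OF s])
  qed
  have 2: "of_real (\<epsilon>\<^sup>2 * \<mu>) = (\<Sum>i\<in>A. cnj (f i) * (\<Sum>i'\<in>A. of_real (\<epsilon>\<^sup>2 * S (conf A i s) (conf A i' s)) * f i'))"
  proof -
    have "(\<Sum>i\<in>A. cnj (f i) * (\<Sum>i'\<in>A. of_real (\<epsilon>\<^sup>2 * S (conf A i s) (conf A i' s)) * f i'))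
      = (\<Sum>i\<in>A. cnj (f i) * (of_real (\<epsilon>\<^sup>2 * \<mu>) * f i))"
    proof (intro sum.cong refl)
      fix i assume i: "i \<in> A"
      have "(\<Sum>i'\<in>A. of_real (\<epsilon>\<^sup>2 * S (conf A i s) (conf A i' s)) * f i')
         = of_real (\<epsilon>\<^sup>2) * (\<Sum>i'\<in>A. of_real (S (conf A i s) (conf A i' s)) * f i')"
        by (simp add: sum_distrib_left mult.assoc)
      also have "(\<Sum>i'\<in>A. of_real (S (conf A i s) (conf A i' s)) * f i') = of_real \<mu> * lift f s (conf A i s)"
        by (rule S_lift[OF conf_X1[OF i s] s]) (rule eig)
      finally show "cnj (f i) * (\<Sum>i'\<in>A. of_real (\<epsilon>\<^sup>2 * S (conf A i s) (conf A i' s)) * f i') = cnj (f i) * (of_real (\<epsilon>\<^sup>2 * \<mu>) * f i)"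
        unfolding lift_conf[OF s s i] by simp
    qed
    also have "\<dots> = of_real (\<epsilon>\<^sup>2 * \<mu>) * ip A f f" by (simp add: ip_def sum_distrib_left mult_ac)
    finally show ?thesis by (simp add: ip_self f)
  qed
  have "\<bar>rayleigh X (gram Y M) (lift f s) - \<epsilon>\<^sup>2 * \<mu>\<bar>
     = \<bar>Re (ip X (lift f s) (mat_vec X (gram Y M) (lift f s)) - of_real (\<epsilon>\<^sup>2 * \<mu>))\<bar>"
    by (simp add: rayleigh_def)
  also have "\<dots> \<le> cmod (ip X (lift f s) (mat_vec X (gram Y M) (lift f s)) - of_real (\<epsilon>\<^sup>2 * \<mu>))"
    by (rule abs_Re_le_cmod)
  also have "ip X (lift f s) (mat_vec X (gram Y M) (lift f s)) - of_real (\<epsilon>\<^sup>2 * \<mu>)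
     = (\<Sum>i\<in>A. \<Sum>i'\<in>A. cnj (f i) * (gram Y M (conf A i s) (conf A i' s) - of_real (\<epsilon>\<^sup>2 * S (conf A i s) (conf A i' s))) * f i')"
    unfolding 1 2 by (simp add: sum_subtractf sum_distrib_left algebra_simps)
  also have "cmod \<dots> \<le> (\<Sum>i\<in>A. \<Sum>i'\<in>A. 1 * (Q * \<epsilon> ^ 4) * 1)"
  proof (intro order_trans[OF norm_sum] sum_mono)
    fix i i' assume i: "i \<in> A" "i' \<in> A"
    show "cmod (cnj (f i) * (gram Y M (conf A i s) (conf A i' s) - of_real (\<epsilon>\<^sup>2 * S (conf A i s) (conf A i' s))) * f i') \<le> 1 * (Q * \<epsilon> ^ 4) * 1"
    proof (cases "f i = 0 \<or> f i' = 0")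
      case True
      then show ?thesis using Q \<epsilon> by auto
    next
      case False
      then have "even (i + i')" using par[OF i] by blast
      then have "even (wt (conf A i s) + wt (conf A i' s))" by (rule wt_conf[OF i _ s])
      then have g: "cmod (gram Y M (conf A i s) (conf A i' s) - of_real (\<epsilon>\<^sup>2 * S (conf A i s) (conf A i' s))) \<le> Q * \<epsilon> ^ 4"
        by (rule gram_approx_same_parity[OF conf_X1[OF i(1) s] conf_X1[OF i(2) s]])
      have "cmod (f i) \<le> 1" "cmod (f i') \<le> 1" using unit_component[OF f] i by auto
      then show ?thesis unfolding norm_mult[of _ "f i'"] norm_mult[of "cnj (f i)"] complex_mod_cnj
        using g Q \<epsilon> by (intro mult_mono) auto
    qed
  qed
  finally show ?thesis by (simp add: power2_eq_square mult.assoc)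
qed

end

section \<open>Entropy of a bipartition in terms of its modes\<close>

definition common_nbrs :: "nat \<Rightarrow> nat set \<Rightarrow> nat \<Rightarrow> nat \<Rightarrow> nat" where
  "common_nbrs Ns A i i' = card {j \<in> {1..Ns} - A. nbr Ns i j \<and> nbr Ns i' j}"

text \<open>
  Positive part of the spectral data of the matrix \<open>common_nbrs\<close> on \<open>A\<close>; the trace condition says
  that no positive eigenvalue is missing. The parity condition is what makes the Rayleigh quotients
  of the modes accurate to fourth order.
\<close>

definition schmidt_modes :: "nat \<Rightarrow> nat set \<Rightarrow> 'k set \<Rightarrow> ('k \<Rightarrow> nat \<Rightarrow> complex) \<Rightarrow> ('k \<Rightarrow> real) \<Rightarrow> bool" where
  "schmidt_modes Ns A J f \<mu> \<longleftrightarrow> finite J \<and> orthonormal A J f \<and> (\<forall>k\<in>J. \<mu> k > 0) \<and>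
     (\<forall>k\<in>J. \<forall>i\<in>A. (\<Sum>i'\<in>A. of_nat (common_nbrs Ns A i i') * f k i') = of_real (\<mu> k) * f k i) \<and>
     (\<Sum>k\<in>J. \<mu> k) = (\<Sum>i\<in>A. real (common_nbrs Ns A i i)) \<and>
     (\<forall>k\<in>J. \<forall>i\<in>A. \<forall>i'\<in>A. f k i \<noteq> 0 \<longrightarrow> f k i' \<noteq> 0 \<longrightarrow> even (i + i'))"

context near_mott_bipartition
begin

lemma T_eq: "T i i' = common_nbrs Ns A i i'"
  by (simp add: T_def common_nbrs_def B_def)

definition "K' = card X * (card A * Q)\<^sup>2 + (card A)\<^sup>2 * Q + card X * Q + card X * card Y * Q2\<^sup>2"

lemma entropy_bound:
  fixes f :: "'k \<Rightarrow> nat \<Rightarrow> complex"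
  assumes sm: "schmidt_modes Ns A J f \<mu>"
  shows "\<bar>entanglement_entropy Ns Ns A \<phi> - 2 * (\<Sum>k\<in>J. \<epsilon>\<^sup>2 * \<mu> k * (1 - ln (\<epsilon>\<^sup>2 * \<mu> k)))\<bar>
    \<le> (2 * (\<Sum>k\<in>J. K' * (2 + \<bar>ln (\<mu> k)\<bar>) + 2 * K' + K' / \<mu> k) + 2 * K'
       + 2 * (2 * (\<Sum>k\<in>J. \<mu> k) + K')\<^sup>2 + 3 * (2 * K' + real (2 * card J) * K') + card X) * \<epsilon> ^ 3"
proof -
  have J: "finite J" and f: "orthonormal A J f" and \<mu>: "\<And>k. k \<in> J \<Longrightarrow> \<mu> k > 0"
    and tr: "(\<Sum>k\<in>J. \<mu> k) = (\<Sum>i\<in>A. real (T i i))"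
    using sm by (auto simp: schmidt_modes_def T_eq)
  have eig: "(\<Sum>i'\<in>A. of_nat (T i i') * f k i') = of_real (\<mu> k) * f k i" if "k \<in> J" "i \<in> A" for k i
    using sm that by (simp add: schmidt_modes_def T_eq)
  have par: "even (i + i')" if "k \<in> J" "i \<in> A" "i' \<in> A" "f k i \<noteq> 0" "f k i' \<noteq> 0" for k i i'
    using sm that unfolding schmidt_modes_def by blast
  have f1: "norm_sq A (f k) = 1" if "k \<in> J" for k by (rule orthonormal_norm_sq[OF f that])
  \<comment> \<open>Each mode is lifted once as a hole (0) and once as a surplus (2); this doubling
    is the factor 2 in front of the entropy sum.\<close>
  define J2 where "J2 = {0, 2::nat} \<times> J"
  define u where "u p = lift (f (snd p)) (fst p)" for p
  define \<nu> where "\<nu> p = \<mu> (snd p)" for p :: "nat \<times> 'k"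
  have s2: "(\<Sum>p\<in>J2. h (snd p)) = 2 * (\<Sum>k\<in>J. h k)" for h :: "'k \<Rightarrow> real"
  proof -
    have "(\<Sum>p\<in>J2. h (snd p)) = (\<Sum>s\<in>{0, 2::nat}. \<Sum>k\<in>J. h k)"
      unfolding J2_def sum.cartesian_product by (simp add: case_prod_beta)
    then show ?thesis by simp
  qed
  have cJ: "card J2 = 2 * card J" by (simp add: J2_def card_cartesian_product)
  have on: "orthonormal X J2 u"
    unfolding orthonormal_def
  proof (intro ballI)
    fix p q assume "p \<in> J2" "q \<in> J2"
    then have "fst p \<in> {0, 2}" "fst q \<in> {0, 2}" "snd p \<in> J" "snd q \<in> J" by (auto simp: J2_def)
    then show "ip X (u p) (u q) = (if p = q then 1 else 0)"
      unfolding u_def using orthonormalD[OF f] by (simp only: ip_lift) (simp add: prod_eq_iff)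
  qed
  have K'0: "K' \<ge> 0" using Q by (simp add: K'_def)
  have K'ge: "card X * (card A * Q)\<^sup>2 \<le> K'" "(card A)\<^sup>2 * Q \<le> K'" "card X * Q \<le> K'" "card X * card Y * Q2\<^sup>2 \<le> K'"
    using Q by (simp_all add: K'_def)
  obtain w where w: "norm_sq X w = 1" "\<And>a. a \<in> X1 \<Longrightarrow> w a = 0"
    "1 - (\<Sum>a\<in>X1. mass Y M a) - card X * card Y * Q2\<^sup>2 * \<epsilon> ^ 4 \<le> rayleigh X (gram Y M) w"
    by (rule main_schmidt_vector) (rule that)
  have e4: "0 \<le> \<epsilon> ^ 4" "0 \<le> \<epsilon> ^ 6" using \<epsilon> by auto
  have "\<bar>von_neumann_entropy X (gram Y M) - (\<Sum>p\<in>J2. \<epsilon>\<^sup>2 * \<nu> p * (1 - ln (\<epsilon>\<^sup>2 * \<nu> p)))\<bar>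
    \<le> ((\<Sum>p\<in>J2. K' * (2 + \<bar>ln (\<nu> p)\<bar>) + 2 * K' + K' / \<nu> p) + 2 * K' + 2 * ((\<Sum>p\<in>J2. \<nu> p) + K')\<^sup>2
        + 3 * (2 * K' + card J2 * K') + card X) * \<epsilon> ^ 3"
  proof (rule gram_entropy_bound[OF finX X1 _ on _ K'0 \<epsilon> trace_one gram_block])
    show "finite J2" using J by (simp add: J2_def)
    show "\<nu> p > 0" if "p \<in> J2" for p using \<mu> that by (auto simp: J2_def \<nu>_def)
    show "u p a = 0" if "p \<in> J2" "a \<in> X - X1" for p a
      unfolding u_def by (rule lift_not_conf) (use that conf_X1 in \<open>auto simp: J2_def\<close>)
    show "norm_sq X (\<lambda>a. mat_vec X (gram Y M) (u p) a - of_real (\<epsilon>\<^sup>2 * \<nu> p) * u p a) \<le> K' * \<epsilon> ^ 6" if p: "p \<in> J2" for p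
    proof -
      have s: "fst p \<in> {0, 2}" "snd p \<in> J" using p by (auto simp: J2_def)
      have "norm_sq X (\<lambda>a. mat_vec X (gram Y M) (u p) a - of_real (\<epsilon>\<^sup>2 * \<nu> p) * u p a) \<le> card X * (card A * Q)\<^sup>2 * \<epsilon> ^ 6"
        unfolding u_def \<nu>_def by (rule lift_defect[OF s(1) f1[OF s(2)] eig[OF s(2)]])
      then show ?thesis using mult_right_mono[OF K'ge(1) e4(2)] by linarith
    qed
    show "\<bar>rayleigh X (gram Y M) (u p) - \<epsilon>\<^sup>2 * \<nu> p\<bar> \<le> K' * \<epsilon> ^ 4" if p: "p \<in> J2" for p
    proof -
      have s: "fst p \<in> {0, 2}" "snd p \<in> J" using p by (auto simp: J2_def)
      have "\<bar>rayleigh X (gram Y M) (u p) - \<epsilon>\<^sup>2 * \<nu> p\<bar> \<le> (card A)\<^sup>2 * Q * \<epsilon> ^ 4"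
        unfolding u_def \<nu>_def by (rule lift_rayleigh[OF s(1) f1[OF s(2)] eig[OF s(2)] par[OF s(2)]])
      then show ?thesis using mult_right_mono[OF K'ge(2) e4(1)] by linarith
    qed
    show "\<bar>(\<Sum>a\<in>X1. mass Y M a) - \<epsilon>\<^sup>2 * (\<Sum>p\<in>J2. \<nu> p)\<bar> \<le> K' * \<epsilon> ^ 4"
      using outer_mass mult_right_mono[OF K'ge(3) e4(1)] unfolding \<nu>_def s2[of \<mu>] tr by linarith
    show "norm_sq X w = 1" by (rule w(1))
    show "w a = 0" if "a \<in> X1" for a by (rule w(2)[OF that])
    show "1 - (\<Sum>a\<in>X1. mass Y M a) - K' * \<epsilon> ^ 4 \<le> rayleigh X (gram Y M) w"
      using w(3) mult_right_mono[OF K'ge(4) e4(1)] by linarith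
  qed
  moreover have "entanglement_entropy Ns Ns A \<phi> = von_neumann_entropy X (gram Y M)"
    unfolding entanglement_entropy_def reduced_density_gram X_def ..
  ultimately show ?thesis
    unfolding \<nu>_def cJ s2[of \<mu>] s2[of "\<lambda>k. \<epsilon>\<^sup>2 * \<mu> k * (1 - ln (\<epsilon>\<^sup>2 * \<mu> k))"]
      s2[of "\<lambda>k. K' * (2 + \<bar>ln (\<mu> k)\<bar>) + 2 * K' + K' / \<mu> k"] by simp
qed

end

lemma entanglement_entropy_phase:
  assumes "cmod z = 1"
  shows "entanglement_entropy Ns N A (\<lambda>n. z * \<psi> n) = entanglement_entropy Ns N A \<psi>"
proof -
  have "z * x * cnj (z * y) = x * cnj y" for x y
    using complex_norm_square[of z] assms by (simp add: algebra_simps)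
  then have "reduced_density Ns N A (\<lambda>n. z * \<psi> n) = reduced_density Ns N A \<psi>"
    unfolding reduced_density_def by presburger
  then show ?thesis by (simp add: entanglement_entropy_def)
qed

theorem ground_state_entropy:
  fixes f :: "'k \<Rightarrow> nat \<Rightarrow> complex"
  assumes Ns: "Ns \<ge> 3" and ev: "even Ns" and A: "A \<subseteq> {1..Ns}" "A \<noteq> {}" "A \<noteq> {1..Ns}"
    and sm: "schmidt_modes Ns A J f \<mu>"
  obtains C \<delta> :: real where "\<delta> > 0"
    "\<And>t U \<psi>. t > 0 \<Longrightarrow> U > 0 \<Longrightarrow> sqrt 2 * t / U < \<delta> \<Longrightarrow> ground_state Ns Ns t U \<psi> \<Longrightarrow>
      \<bar>entanglement_entropy Ns Ns A \<psi>
        - 2 * (\<Sum>k\<in>J. (sqrt 2 * t / U)\<^sup>2 * \<mu> k * (1 - ln ((sqrt 2 * t / U)\<^sup>2 * \<mu> k)))\<bar>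
      \<le> C * (sqrt 2 * t / U) ^ 3"
proof -
  obtain K \<delta> :: real where K: "K \<ge> 0" and \<delta>: "\<delta> > 0"
    and nm: "\<And>t U \<psi>. t > 0 \<Longrightarrow> U > 0 \<Longrightarrow> sqrt 2 * t / U < \<delta> \<Longrightarrow> ground_state Ns Ns t U \<psi> \<Longrightarrow>
      \<exists>z. cmod z = 1 \<and> near_mott Ns K (sqrt 2 * t / U) (\<lambda>n. z * \<psi> n)"
    by (rule ground_state_near_mott[OF Ns ev]) (rule that)
  \<comment> \<open>The constants of the locale are rebuilt from Ns, A, K and the modes before t, U
    and \<psi> are fixed, which makes C uniform in them.\<close>
  define x where "x = card (occs_le A Ns)"
  define y where "y = card (occs_le ({1..Ns} - A) Ns)"
  define q where "q = y * (2 * K + K\<^sup>2)"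
  define k where "k = x * (card A * q)\<^sup>2 + (card A)\<^sup>2 * q + x * q + x * y * (K + 2 * (1 + K)\<^sup>2)\<^sup>2"
  define C where "C = 2 * (\<Sum>j\<in>J. k * (2 + \<bar>ln (\<mu> j)\<bar>) + 2 * k + k / \<mu> j) + 2 * k
       + 2 * (2 * (\<Sum>j\<in>J. \<mu> j) + k)\<^sup>2 + 3 * (2 * k + real (2 * card J) * k) + x"
  \<comment> \<open>The second bound on the radius yields e <= 1 and K e <= 1/2, hence K e^2 <= 1/2
    as the locale asks.\<close>
  define d where "d = min \<delta> (1 / (2 * (K + 1)))"
  have "d > 0" using \<delta> K by (simp add: d_def)
  moreover have "\<bar>entanglement_entropy Ns Ns A \<psi> - 2 * (\<Sum>j\<in>J. (sqrt 2 * t / U)\<^sup>2 * \<mu> j * (1 - ln ((sqrt 2 * t / U)\<^sup>2 * \<mu> j)))\<bar>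
      \<le> C * (sqrt 2 * t / U) ^ 3"
    if t: "t > 0" "U > 0" "sqrt 2 * t / U < d" "ground_state Ns Ns t U \<psi>" for t U \<psi>
  proof -
    define e where "e = sqrt 2 * t / U"
    have e0: "e > 0" using t by (simp add: e_def)
    have "e < 1 / (2 * (K + 1))" using t by (simp add: e_def d_def)
    then have "e * (2 * (K + 1)) < 1" using K by (simp add: pos_less_divide_eq)
    then have eK: "K * e + e < 1 / 2" by (simp add: algebra_simps)
    have "K * e \<ge> 0" using K e0 by simp
    then have e1: "e \<le> 1" "K * e \<le> 1 / 2" using eK e0 by auto
    have "K * e * e \<le> K * e * 1" using e1 e0 K by (intro mult_left_mono) auto
    then have small: "K * e\<^sup>2 \<le> 1 / 2" using e1 by (simp add: power2_eq_square mult.assoc)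
    obtain z where z: "cmod z = 1" "near_mott Ns K e (\<lambda>n. z * \<psi> n)"
      using nm[of t U \<psi>] t unfolding e_def d_def by auto
    interpret near_mott_bipartition Ns A K e "\<lambda>n. z * \<psi> n"
      using Ns ev A K e0 e1 small z by unfold_locales auto
    have "x = card X" "y = card Y" by (simp_all add: x_def y_def X_def Y_def B_def)
    then have "C = 2 * (\<Sum>k\<in>J. K' * (2 + \<bar>ln (\<mu> k)\<bar>) + 2 * K' + K' / \<mu> k) + 2 * K'
       + 2 * (2 * (\<Sum>k\<in>J. \<mu> k) + K')\<^sup>2 + 3 * (2 * K' + real (2 * card J) * K') + card X"
      unfolding C_def k_def q_def K'_def Q_def Q2_def by simp
    then show ?thesis
      using entropy_bound[OF sm] unfolding entanglement_entropy_phase[OF z(1)] e_def[symmetric] by simp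
  qed
  ultimately show ?thesis by (rule that)
qed

section \<open>Schmidt modes of the three bipartitions\<close>

lemma orthonormal_indicators:
  assumes "finite A" "J \<subseteq> A"
  shows "orthonormal A J (\<lambda>k i. if i = k then 1 else 0)"
  unfolding orthonormal_def
proof (intro ballI)
  fix j k assume "j \<in> J" "k \<in> J"
  then have "k \<in> A" using assms by blast
  have "ip A (\<lambda>i. if i = j then 1 else 0) (\<lambda>i. if i = k then 1 else 0)
     = (\<Sum>i\<in>A. if i = k then if j = k then 1 else 0 else 0)"
    unfolding ip_def by (intro sum.cong) auto
  then show "ip A (\<lambda>i. if i = j then 1 else 0) (\<lambda>i. if i = k then 1 else 0) = (if j = k then 1 else 0)"
    using assms(1) \<open>k \<in> A\<close> by simp
qed

text \<open>When the matrix of common neighbours is diagonal, single sites are the modes, and the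
  parity condition reduces to i + i being even.\<close>

lemma schmidt_modes_sites:
  assumes A: "finite A" and J: "J \<subseteq> A" and \<mu>: "\<mu> > 0"
    and T: "\<And>i k. i \<in> A \<Longrightarrow> k \<in> J \<Longrightarrow> real (common_nbrs Ns A i k) = (if i = k then \<mu> else 0)"
    and out: "\<And>i. i \<in> A \<Longrightarrow> i \<notin> J \<Longrightarrow> common_nbrs Ns A i i = 0"
  shows "schmidt_modes Ns A J (\<lambda>k i. if i = k then 1 else 0) (\<lambda>_. \<mu>)"
  unfolding schmidt_modes_def
proof (intro conjI ballI impI)
  show "finite J" using A J finite_subset by blast
  show "orthonormal A J (\<lambda>k i. if i = k then 1 else 0)" by (rule orthonormal_indicators[OF A J])
  show "(\<Sum>k\<in>J. \<mu>) = (\<Sum>i\<in>A. real (common_nbrs Ns A i i))"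
  proof -
    have "(\<Sum>i\<in>A. real (common_nbrs Ns A i i)) = (\<Sum>i\<in>J. real (common_nbrs Ns A i i))"
      by (rule sum.mono_neutral_right[OF A J]) (simp add: out)
    also have "\<dots> = (\<Sum>k\<in>J. \<mu>)" using T J by (intro sum.cong refl) auto
    finally show ?thesis by simp
  qed
next
  fix k i assume k: "k \<in> J" and i: "i \<in> A"
  have "(\<Sum>i'\<in>A. of_nat (common_nbrs Ns A i i') * (if i' = k then 1 else 0))
     = (\<Sum>i'\<in>A. if i' = k then complex_of_real (real (common_nbrs Ns A i k)) else 0)"
    by (intro sum.cong) auto
  also have "\<dots> = of_real (if i = k then \<mu> else 0)" using A J k T[OF i k] by (simp add: subsetD)
  finally show "(\<Sum>i'\<in>A. of_nat (common_nbrs Ns A i i') * (if i' = k then 1 else 0)) = of_real \<mu> * (if i = k then 1 else 0 :: complex)"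
    by simp
qed (use \<mu> in \<open>auto split: if_splits\<close>)

lemma nbr_half:
  assumes m: "m \<ge> 2" and i: "i \<in> {1..m}" and j: "j \<in> {m+1..2*m}"
  shows "nbr (2*m) i j \<longleftrightarrow> (i = 1 \<and> j = 2*m) \<or> (i = m \<and> j = m + 1)"
proof -
  have "i \<in> {1..2*m}" "j \<in> {1..2*m}" using i j by auto
  then show ?thesis unfolding nbr_def using m i j by (auto simp: next_site_cases)
qed

text \<open>Only the end sites 1 and m have a neighbour outside, namely 2 m and m + 1. For m >= 2
  these are distinct, so the matrix is diagonal with eigenvalue 1 at each of the two cuts.\<close>

lemma schmidt_modes_half:
  assumes m: "m \<ge> 2"
  shows "schmidt_modes (2*m) {1..m} {1, m} (\<lambda>k i. if i = k then 1 else 0) (\<lambda>_. 1)"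
proof (rule schmidt_modes_sites)
  have B: "{1..2*m} - {1..m} = {m+1..2*m}" by auto
  have s: "common_nbrs (2*m) {1..m} i i' = card {j \<in> {m+1..2*m}.
     ((i = 1 \<and> j = 2*m) \<or> (i = m \<and> j = m + 1)) \<and> ((i' = 1 \<and> j = 2*m) \<or> (i' = m \<and> j = m + 1))}"
    if "i \<in> {1..m}" "i' \<in> {1..m}" for i i'
    unfolding common_nbrs_def B using nbr_half[OF m] that by (intro arg_cong[of _ _ card]) blast
  show "{1, m} \<subseteq> {1..m}" using m by auto
  show "real (common_nbrs (2*m) {1..m} i k) = (if i = k then 1 else 0)" if i: "i \<in> {1..m}" and k: "k \<in> {1, m}" for i k
  proof -
    have k': "k \<in> {1..m}" using k m by auto
    have "{j \<in> {m+1..2*m}. ((i = 1 \<and> j = 2*m) \<or> (i = m \<and> j = m + 1)) \<and> ((k = 1 \<and> j = 2*m) \<or> (k = m \<and> j = m + 1))}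
       = (if i = k then {if k = 1 then 2*m else m + 1} else {})"
      using k m by auto
    then show ?thesis unfolding s[OF i k'] by simp
  qed
  show "common_nbrs (2*m) {1..m} i i = 0" if i: "i \<in> {1..m}" "i \<notin> {1, m}" for i
    unfolding s[OF i(1) i(1)] using i by auto
qed auto

lemma nbr_first:
  assumes Ns: "Ns \<ge> 3" and j: "j \<in> {1..Ns}"
  shows "nbr Ns 1 j \<longleftrightarrow> j = 2 \<or> j = Ns"
proof -
  have 1: "1 \<in> {1..Ns}" using Ns by simp
  show ?thesis
    unfolding nbr_def next_site_cases[OF 1] next_site_cases[OF j] using Ns j by auto
qed

text \<open>A single site has the two distinct outside neighbours 2 and Ns. The eigenvalue 2 is what
  produces the ln 2 in the single-site entropy.\<close>

lemma schmidt_modes_site: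
  assumes Ns: "Ns \<ge> 3"
  shows "schmidt_modes Ns {1} {1} (\<lambda>k i. if i = k then 1 else 0) (\<lambda>_. 2)"
proof (rule schmidt_modes_sites)
  have "{j \<in> {1..Ns} - {1}. nbr Ns 1 j} = {j \<in> {1..Ns} - {1}. j = 2 \<or> j = Ns}"
    using nbr_first[OF Ns] by blast
  also have "\<dots> = {2, Ns}" using Ns by auto
  finally have "{j \<in> {1..Ns} - {1}. nbr Ns 1 j} = {2, Ns}" .
  then have "common_nbrs Ns {1} 1 1 = 2" using Ns by (simp add: common_nbrs_def)
  then show "real (common_nbrs Ns {1} i k) = (if i = k then 2 else 0)" if "i \<in> {1}" "k \<in> {1}" for i k
    using that by simp
qed auto

section \<open>Roots of unity and Fourier modes of the sublattices\<close>

definition unity_root :: "nat \<Rightarrow> nat \<Rightarrow> complex" where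
  "unity_root m k = cis (2 * pi * (real k / real m))"

lemma unity_root_power:
  assumes "m > 0"
  shows "unity_root m k ^ m = 1"
proof -
  have "real m * (2 * pi * (real k / real m)) = 2 * pi * real k" using assms by simp
  then show ?thesis unfolding unity_root_def Complex.DeMoivre by (simp only: cis_multiple_2pi Ints_of_nat)
qed

lemma unity_root_power_mod:
  assumes "m > 0"
  shows "unity_root m k ^ (x mod m) = unity_root m k ^ x"
proof -
  have "unity_root m k ^ x = unity_root m k ^ (m * (x div m) + x mod m)" by simp
  also have "\<dots> = unity_root m k ^ (x mod m)"
    by (simp only: power_add power_mult unity_root_power[OF assms] power_one mult_1)
  finally show ?thesis by simp
qed

lemma cnj_unity_root: "cnj (unity_root m k) * unity_root m k = 1"
  by (simp add: unity_root_def cis_cnj cis_mult)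

text \<open>For k different from k' the quotient is an m-th root of unity other than 1, because |k'
  - k| < m, and its geometric sum vanishes. This is orthogonality of the Fourier modes.\<close>

lemma unity_root_quotient_sum:
  assumes m: "m > 0" and k: "k < m" "k' < m"
  shows "(\<Sum>l<m. (cnj (unity_root m k) * unity_root m k') ^ l) = (if k = k' then of_nat m else 0)"
proof (cases "k = k'")
  case True
  then show ?thesis by (simp add: cnj_unity_root)
next
  case False
  let ?z = "cnj (unity_root m k) * unity_root m k'"
  have "?z ^ m = 1" using unity_root_power[OF m] by (simp add: power_mult_distrib flip: complex_cnj_power)
  moreover have "?z \<noteq> 1"
  proof
    assume "?z = 1"
    have "?z = cis (2 * pi * ((real k' - real k) / real m))"
      by (simp add: unity_root_def cis_cnj cis_mult diff_divide_distrib algebra_simps)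
    then have "cos (2 * pi * ((real k' - real k) / real m)) = 1" using \<open>?z = 1\<close> by (simp add: complex_eq_iff)
    then obtain n :: int where "2 * pi * ((real k' - real k) / real m) = of_int n * 2 * pi"
      using cos_one_2pi_int by blast
    then have "(2 * pi) * ((real k' - real k) / real m) = (2 * pi) * of_int n" by (simp only: mult_ac)
    then have "(real k' - real k) / real m = of_int n" by (simp only: mult_cancel_left) simp
    then have "real k' - real k = of_int n * real m" using m by (simp add: field_simps)
    then have "real_of_int (int k' - int k) = real_of_int (n * int m)" by simp
    then have e: "int k' - int k = n * int m" by (simp only: of_int_eq_iff)
    have "\<bar>int k' - int k\<bar> < int m" using k by linarith
    then have "\<bar>n\<bar> * int m < 1 * int m" unfolding e by (simp add: abs_mult)
    then have "\<bar>n\<bar> < 1" using m by (simp only: mult_less_cancel_right_pos of_nat_0_less_iff)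
    then show False using e False by simp
  qed
  ultimately show ?thesis using False by (simp add: geometric_sum)
qed

lemma unity_root_0: "unity_root m 0 = 1"
  by (simp add: unity_root_def)

text \<open>Equals |1 + q|^2 for the root of unity q = \<open>unity_root m k\<close>. For even m it
  vanishes at k = m / 2, a mode that is left out because modes carry positive eigenvalues.\<close>

definition dispersion :: "nat \<Rightarrow> nat \<Rightarrow> real" where
  "dispersion m k = 4 * (cos (pi * real k / real m))\<^sup>2"

lemma dispersion_eq: "dispersion m k = 2 + 2 * Re (unity_root m k)"
  using cos_double_cos[of "pi * real k / real m"] by (simp add: dispersion_def unity_root_def mult.assoc)

lemma dispersion_factor: "(1 + unity_root m k) * (1 + cnj (unity_root m k)) = of_real (dispersion m k)"
proof -
  have "(1 + unity_root m k) * (1 + cnj (unity_root m k))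
     = 1 + (unity_root m k + cnj (unity_root m k)) + cnj (unity_root m k) * unity_root m k"
    by (simp add: algebra_simps)
  also have "\<dots> = of_real (dispersion m k)"
    unfolding cnj_unity_root complex_add_cnj dispersion_eq by simp
  finally show ?thesis .
qed

text \<open>The roots of unity sum to 0 for m >= 2, leaving 2 per mode; this agrees with the trace
  of the matrix, two outside neighbours for each of m sites.\<close>

lemma dispersion_sum:
  assumes "m \<ge> 2"
  shows "(\<Sum>k<m. dispersion m k) = 2 * real m"
proof -
  have p: "unity_root m k = unity_root m 1 ^ k" for k
    unfolding unity_root_def Complex.DeMoivre by (rule arg_cong[of _ _ cis]) simp
  have "(\<Sum>k<m. unity_root m k) = (\<Sum>k<m. unity_root m 1 ^ k)"
    by (rule sum.cong[OF refl p])
  also have "\<dots> = 0"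
    using unity_root_quotient_sum[of m 0 1] assms by (simp add: unity_root_0)
  finally have "Re (\<Sum>k<m. unity_root m k) = 0" by simp
  then have "(\<Sum>k<m. Re (unity_root m k)) = 0" by (simp only: Re_sum)
  then show ?thesis by (simp add: dispersion_eq sum.distrib flip: sum_distrib_left)
qed

text \<open>With both sublattices numbered around the ring, adjacency from A to its complement is
  the circulant identity plus shift modulo m. The matrix of common neighbours is this circulant
  times its transpose, so Fourier modes diagonalize it with eigenvalues (1 + q)(1 + cnj q).\<close>

lemma schmidt_modes_sublattice:
  assumes m: "m \<ge> 2"
    and \<alpha>: "bij_betw \<alpha> {..<m} A" and \<beta>: "bij_betw \<beta> {..<m} ({1..Ns} - A)"
    and nb: "\<And>l r. l < m \<Longrightarrow> r < m \<Longrightarrow> nbr Ns (\<alpha> l) (\<beta> r) \<longleftrightarrow> r = l \<or> r = (l + 1) mod m"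
    and par: "\<And>i i'. i \<in> A \<Longrightarrow> i' \<in> A \<Longrightarrow> even (i + i')"
  shows "schmidt_modes Ns A {k. k < m \<and> dispersion m k \<noteq> 0}
    (\<lambda>k i. of_real (1 / sqrt (real m)) * unity_root m k ^ (the_inv_into {..<m} \<alpha> i)) (dispersion m)"
proof -
  have m0: "m > 0" using m by simp
  define c where "c = complex_of_real (1 / sqrt (real m))"
  define f where "f k i = c * unity_root m k ^ (the_inv_into {..<m} \<alpha> i)" for k i
  have cc: "cnj c * c = of_real (1 / real m)" using m0 by (simp add: c_def flip: of_real_mult)
  have f\<alpha>: "f k (\<alpha> l) = c * unity_root m k ^ l" if "l < m" for k l
    using \<alpha> that by (simp add: f_def the_inv_into_f_f bij_betw_def)
  have sumA: "(\<Sum>i\<in>A. h i) = (\<Sum>l<m. h (\<alpha> l))" for h :: "nat \<Rightarrow> complex"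
    using sum.reindex_bij_betw[OF \<alpha>, of h] by simp
  have sumAr: "(\<Sum>i\<in>A. h i) = (\<Sum>l<m. h (\<alpha> l))" for h :: "nat \<Rightarrow> real"
    using sum.reindex_bij_betw[OF \<alpha>, of h] by simp
  have neq: "l \<noteq> (l + 1) mod m" if "l < m" for l using that m by (auto simp: mod_if)
  define ad where "ad l r = (if r = l then 1 else 0) + (if r = (l + 1) mod m then 1 else 0 :: nat)" for l r
  have adn: "ad l r = (if nbr Ns (\<alpha> l) (\<beta> r) then 1 else 0)" if "l < m" "r < m" for l r
    using nb[OF that] neq[OF that(1)] by (auto simp: ad_def)
  have T: "common_nbrs Ns A (\<alpha> l) (\<alpha> l') = (\<Sum>r<m. ad l r * ad l' r)" if l: "l < m" "l' < m" for l l'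
  proof -
    have "common_nbrs Ns A (\<alpha> l) (\<alpha> l') = (\<Sum>j\<in>{1..Ns} - A. if nbr Ns (\<alpha> l) j \<and> nbr Ns (\<alpha> l') j then 1 else 0)"
      unfolding common_nbrs_def by (simp add: sum.If_cases Int_def)
    also have "\<dots> = (\<Sum>r<m. if nbr Ns (\<alpha> l) (\<beta> r) \<and> nbr Ns (\<alpha> l') (\<beta> r) then 1 else 0)"
      by (rule sum.reindex_bij_betw[OF \<beta>, symmetric])
    also have "\<dots> = (\<Sum>r<m. ad l r * ad l' r)" using l by (intro sum.cong refl) (auto simp: adn)
    finally show ?thesis .
  qed
  have row: "(\<Sum>r<m. of_nat (ad l r) * h r) = h l + h ((l + 1) mod m)" if "l < m" for l and h :: "nat \<Rightarrow> complex"
  proof -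
    have "(\<Sum>r<m. of_nat (ad l r) * h r) = (\<Sum>r<m. (if r = l then h r else 0) + (if r = (l + 1) mod m then h r else 0))"
      unfolding ad_def by (intro sum.cong) auto
    then show ?thesis using that m0 by (simp add: sum.distrib)
  qed
  have col: "(\<Sum>l<m. of_nat (ad l r) * unity_root m k ^ l) = unity_root m k ^ r * (1 + cnj (unity_root m k))" if r: "r < m" for r k
  proof -
    \<comment> \<open>\<open>?p\<close> is the predecessor of r modulo m, with m - 1 added instead
      of 1 subtracted to stay within the naturals.\<close>
    let ?q = "unity_root m k" and ?p = "(r + (m - 1)) mod m"
    have pr: "r = (l + 1) mod m \<longleftrightarrow> l = ?p" if "l < m" for l
      using that r m by (cases "r = 0"; cases "l + 1 = m") (auto simp: mod_if)
    have "(\<Sum>l<m. of_nat (ad l r) * ?q ^ l) = (\<Sum>l<m. (if l = r then ?q ^ l else 0) + (if l = ?p then ?q ^ l else 0))"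
      unfolding ad_def using pr by (intro sum.cong) auto
    also have "\<dots> = ?q ^ r + ?q ^ ?p" using r m0 by (simp add: sum.distrib)
    also have "?q ^ ?p = ?q ^ r * ?q ^ (m - 1)" by (simp only: unity_root_power_mod[OF m0] power_add)
    \<comment> \<open>Inserting cnj q q = 1 completes the exponent to m, so q^(m - 1) is the
      conjugate of q.\<close>
    also have "?q ^ (m - 1) = cnj ?q * ?q * ?q ^ (m - 1)" by (simp add: cnj_unity_root)
    also have "\<dots> = cnj ?q * ?q ^ Suc (m - 1)" by simp
    also have "\<dots> = cnj ?q" using m0 unity_root_power[OF m0, of k] by simp
    finally show ?thesis by (simp add: algebra_simps)
  qed
  have "schmidt_modes Ns A {k. k < m \<and> dispersion m k \<noteq> 0} f (dispersion m)"
    unfolding schmidt_modes_def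
  proof (intro conjI ballI impI)
    show "finite {k. k < m \<and> dispersion m k \<noteq> 0}" by simp
    show "orthonormal A {k. k < m \<and> dispersion m k \<noteq> 0} f"
      unfolding orthonormal_def
    proof (intro ballI)
      fix k k' assume "k \<in> {k. k < m \<and> dispersion m k \<noteq> 0}" "k' \<in> {k. k < m \<and> dispersion m k \<noteq> 0}"
      then have k: "k < m" "k' < m" by auto
      have "ip A (f k) (f k') = (\<Sum>l<m. cnj c * c * (cnj (unity_root m k) * unity_root m k') ^ l)"
        unfolding ip_def sumA by (intro sum.cong refl) (simp add: f\<alpha> power_mult_distrib mult_ac)
      also have "\<dots> = (if k = k' then 1 else 0)"
        unfolding sum_distrib_left[symmetric] unity_root_quotient_sum[OF m0 k] cc using m0 by simp
      finally show "ip A (f k) (f k') = (if k = k' then 1 else 0)" .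
    qed
    show "dispersion m k > 0" if "k \<in> {k. k < m \<and> dispersion m k \<noteq> 0}" for k
      using that by (auto simp: dispersion_def)
    show "(\<Sum>k | k < m \<and> dispersion m k \<noteq> 0. dispersion m k) = (\<Sum>i\<in>A. real (common_nbrs Ns A i i))"
    proof -
      have "(\<Sum>k | k < m \<and> dispersion m k \<noteq> 0. dispersion m k) = (\<Sum>k<m. dispersion m k)"
        by (rule sum.mono_neutral_left) auto
      also have "\<dots> = 2 * real m" by (rule dispersion_sum[OF m])
      finally have 1: "(\<Sum>k | k < m \<and> dispersion m k \<noteq> 0. dispersion m k) = 2 * real m" .
      have "common_nbrs Ns A (\<alpha> l) (\<alpha> l) = 2" if l: "l < m" for l
      proof -
        have "(of_nat (common_nbrs Ns A (\<alpha> l) (\<alpha> l)) :: complex) = (\<Sum>r<m. of_nat (ad l r) * of_nat (ad l r))"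
          unfolding T[OF l l] by simp
        also have "\<dots> = of_nat (ad l l) + of_nat (ad l ((l + 1) mod m))" by (rule row[OF l])
        also have "\<dots> = of_nat 2" using neq[OF l] by (simp add: ad_def)
        finally show ?thesis by (simp only: of_nat_eq_iff)
      qed
      then have "(\<Sum>i\<in>A. real (common_nbrs Ns A i i)) = 2 * real m" unfolding sumAr by simp
      then show ?thesis using 1 by simp
    qed
    show "even (i + i')" if "i \<in> A" "i' \<in> A" for i i' by (rule par[OF that])
    fix k i assume "k \<in> {k. k < m \<and> dispersion m k \<noteq> 0}" and i: "i \<in> A"
    obtain l where l: "l < m" "i = \<alpha> l" using \<alpha> i by (auto simp: bij_betw_def)
    let ?q = "unity_root m k"
    have "(\<Sum>i'\<in>A. of_nat (common_nbrs Ns A i i') * f k i') = (\<Sum>l'<m. \<Sum>r<m. of_nat (ad l r) * (of_nat (ad l' r) * (c * ?q ^ l')))"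
      unfolding sumA l(2) by (intro sum.cong refl) (simp add: T[OF l(1)] f\<alpha> sum_distrib_right mult.assoc)
    also have "\<dots> = (\<Sum>r<m. of_nat (ad l r) * (c * (\<Sum>l'<m. of_nat (ad l' r) * ?q ^ l')))"
      by (subst sum.swap) (simp add: sum_distrib_left mult_ac)
    also have "\<dots> = (\<Sum>r<m. of_nat (ad l r) * (c * (?q ^ r * (1 + cnj ?q))))"
      by (intro sum.cong refl) (simp add: col)
    also have "\<dots> = c * (?q ^ l * (1 + cnj ?q)) + c * (?q ^ ((l + 1) mod m) * (1 + cnj ?q))" by (rule row[OF l(1)])
    also have "\<dots> = (1 + ?q) * (1 + cnj ?q) * (c * ?q ^ l)"
      unfolding unity_root_power_mod[OF m0] by (simp add: algebra_simps)
    finally show "(\<Sum>i'\<in>A. of_nat (common_nbrs Ns A i i') * f k i') = of_real (dispersion m k) * f k i"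
      unfolding dispersion_factor l(2) f\<alpha>[OF l(1)] .
  qed
  then show ?thesis unfolding f_def[abs_def] c_def .
qed

lemma schmidt_modes_odd:
  assumes m: "m \<ge> 2"
  shows "\<exists>f. schmidt_modes (2*m) {i \<in> {1..2*m}. odd i} {k. k < m \<and> dispersion m k \<noteq> 0} (f :: nat \<Rightarrow> nat \<Rightarrow> complex) (dispersion m)"
proof -
  let ?A = "{i \<in> {1..2*m}. odd i}"
  \<comment> \<open>Numbered so that the even sites r = l and r = l + 1 surround the odd site 2 l +
    1; number 0 is the site 2 m, next to site 1 across the closing bond.\<close>
  let ?\<beta> = "\<lambda>r. if r = 0 then 2*m else 2*r"
  have a: "bij_betw (\<lambda>l. 2*l+1) {..<m} ?A"
    by (rule bij_betw_byWitness[of _ "\<lambda>i. i div 2"]) (auto, presburger)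
  have b: "bij_betw ?\<beta> {..<m} ({1..2*m} - ?A)"
    by (rule bij_betw_byWitness[of _ "\<lambda>i. if i = 2*m then 0 else i div 2"]) (use m in \<open>auto elim!: evenE split: if_splits\<close>)
  have n: "nbr (2*m) (2*l+1) (?\<beta> r) \<longleftrightarrow> r = l \<or> r = (l + 1) mod m" if l: "l < m" "r < m" for l r
  proof -
    have i: "2*l+1 \<in> {1..2*m}" "?\<beta> r \<in> {1..2*m}" using l by auto
    show ?thesis unfolding nbr_def next_site_cases[OF i(1)] next_site_cases[OF i(2)]
      using i l m by (cases "l + 1 = m") (auto simp: mod_if)
  qed
  show ?thesis using schmidt_modes_sublattice[OF m a b n] by fastforce
qed

lemma schmidt_modes_even:
  assumes m: "m \<ge> 2"
  shows "\<exists>f. schmidt_modes (2*m) {i \<in> {1..2*m}. even i} {k. k < m \<and> dispersion m k \<noteq> 0} (f :: nat \<Rightarrow> nat \<Rightarrow> complex) (dispersion m)"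
proof -
  let ?A = "{i \<in> {1..2*m}. even i}"
  have a: "bij_betw (\<lambda>l. 2*l+2) {..<m} ?A"
    by (rule bij_betw_byWitness[of _ "\<lambda>i. i div 2 - 1"]) (auto elim!: evenE)
  have b: "bij_betw (\<lambda>r. 2*r+1) {..<m} ({1..2*m} - ?A)"
    by (rule bij_betw_byWitness[of _ "\<lambda>i. i div 2"]) (auto, presburger)
  have n: "nbr (2*m) (2*l+2) (2*r+1) \<longleftrightarrow> r = l \<or> r = (l + 1) mod m" if l: "l < m" "r < m" for l r
  proof -
    have i: "2*l+2 \<in> {1..2*m}" "2*r+1 \<in> {1..2*m}" using l by auto
    show ?thesis unfolding nbr_def next_site_cases[OF i(1)] next_site_cases[OF i(2)]
      using i l m by (cases "l + 1 = m") (auto simp: mod_if)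
  qed
  show ?thesis using schmidt_modes_sublattice[OF m a b n] by fastforce
qed

text \<open>Modes with zero dispersion can be put back, since their terms vanish, as does
  \<open>f_cos\<close> with ln 0 = 0. Splitting the logarithm, the coefficient of 1 + ln (1 / e^2)
  is the trace 2 m and the rest is the sum of \<open>f_cos\<close>.\<close>

lemma sublattice_entropy_value:
  assumes m: "m \<ge> 2" and e: "e > 0"
  shows "2 * (\<Sum>k | k < m \<and> dispersion m k \<noteq> 0. e\<^sup>2 * dispersion m k * (1 - ln (e\<^sup>2 * dispersion m k)))
    = e\<^sup>2 * (2 * real (2*m) * (1 + ln (1 / e\<^sup>2)) - 2 * (\<Sum>k<m. f_cos (pi * real k / real m)))"
proof -
  have "(\<Sum>k | k < m \<and> dispersion m k \<noteq> 0. e\<^sup>2 * dispersion m k * (1 - ln (e\<^sup>2 * dispersion m k)))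
     = (\<Sum>k<m. e\<^sup>2 * dispersion m k * (1 - ln (e\<^sup>2 * dispersion m k)))"
    by (rule sum.mono_neutral_left) auto
  also have "\<dots> = (\<Sum>k<m. e\<^sup>2 * (1 + ln (1 / e\<^sup>2)) * dispersion m k - e\<^sup>2 * f_cos (pi * real k / real m))"
  proof (intro sum.cong refl)
    fix k
    show "e\<^sup>2 * dispersion m k * (1 - ln (e\<^sup>2 * dispersion m k))
      = e\<^sup>2 * (1 + ln (1 / e\<^sup>2)) * dispersion m k - e\<^sup>2 * f_cos (pi * real k / real m)"
    proof (cases "dispersion m k = 0")
      case False
      then have "dispersion m k > 0" by (simp add: dispersion_def)
      moreover have "f_cos (pi * real k / real m) = dispersion m k * ln (dispersion m k)"
        by (simp add: f_cos_def dispersion_def)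
      ultimately show ?thesis using e by (simp add: ln_mult ln_div algebra_simps)
    qed (simp add: f_cos_def dispersion_def)
  qed
  also have "\<dots> = e\<^sup>2 * (1 + ln (1 / e\<^sup>2)) * (2 * real m) - e\<^sup>2 * (\<Sum>k<m. f_cos (pi * real k / real m))"
    by (simp add: sum_subtractf dispersion_sum[OF m] flip: sum_distrib_left)
  finally show ?thesis by (simp add: algebra_simps)
qed

theorem mainTheorem4:
  fixes Ns m :: nat
  assumes "Ns \<ge> 4" and "even Ns" and "m = Ns div 2"
  shows "\<exists>C \<delta> :: real. \<delta> > 0 \<and>
    (\<forall>(t :: real) (U :: real) (\<epsilon> :: real) (\<psi> :: state).
       t > 0 \<longrightarrow> U > 0 \<longrightarrow> \<epsilon> = sqrt 2 * t / U \<longrightarrow> \<epsilon> < \<delta> \<longrightarrow> ground_state Ns Ns t U \<psi> \<longrightarrow>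
         \<bar>entanglement_entropy Ns Ns {1..Ns div 2} \<psi>
            - 4 * \<epsilon>\<^sup>2 * (1 + ln (1 / \<epsilon>\<^sup>2))\<bar> \<le> C * \<epsilon> ^ 3
       \<and> (\<forall>A \<in> {{i \<in> {1..Ns}. odd i}, {i \<in> {1..Ns}. even i}}.
           \<bar>entanglement_entropy Ns Ns A \<psi>
              - \<epsilon>\<^sup>2 * (2 * real Ns * (1 + ln (1 / \<epsilon>\<^sup>2))
                       - 2 * (\<Sum>k<m. f_cos (pi * real k / real m)))\<bar> \<le> C * \<epsilon> ^ 3)
       \<and> \<bar>entanglement_entropy Ns Ns {1} \<psi>
            - (4 * \<epsilon>\<^sup>2 * (1 + ln (1 / \<epsilon>\<^sup>2)) - 4 * ln 2 * \<epsilon>\<^sup>2)\<bar> \<le> C * \<epsilon> ^ 3)"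
proof -
  have m: "m \<ge> 2" and Nsm: "Ns = 2 * m" and Ns3: "Ns \<ge> 3" using assms by auto
  have Nsd: "Ns div 2 = m" using assms(3) by simp
  let ?O = "{i \<in> {1..Ns}. odd i}" and ?E = "{i \<in> {1..Ns}. even i}"
  let ?e = "\<lambda>t U. sqrt 2 * t / U :: real"
  have O: "1 \<in> ?O" "2 \<notin> ?O" and E: "2 \<in> ?E" "1 \<notin> ?E" and rng: "1 \<in> {1..Ns}" "2 \<in> {1..Ns}"
    using Ns3 by auto
  have sub: "{1..m} \<subseteq> {1..Ns}" "{1..m} \<noteq> {}" "{1..m} \<noteq> {1..Ns}" using m Nsm by auto
  obtain C1 d1 :: real where d1: "d1 > 0" and h1: "\<And>t U \<psi>. t > 0 \<Longrightarrow> U > 0 \<Longrightarrow> ?e t U < d1 \<Longrightarrow> ground_state Ns Ns t U \<psi> \<Longrightarrow>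
      \<bar>entanglement_entropy Ns Ns {1..m} \<psi> - 2 * (\<Sum>k\<in>{1, m}. (?e t U)\<^sup>2 * 1 * (1 - ln ((?e t U)\<^sup>2 * 1)))\<bar> \<le> C1 * (?e t U) ^ 3"
    by (rule ground_state_entropy[OF Ns3 assms(2) sub schmidt_modes_half[OF m, folded Nsm]]) (rule that)
  obtain f2 where f2: "schmidt_modes Ns ?O {k. k < m \<and> dispersion m k \<noteq> 0} f2 (dispersion m)"
    using schmidt_modes_odd[OF m] unfolding Nsm by blast
  obtain f3 where f3: "schmidt_modes Ns ?E {k. k < m \<and> dispersion m k \<noteq> 0} f3 (dispersion m)"
    using schmidt_modes_even[OF m] unfolding Nsm by blast
  let ?v = "\<lambda>e. 2 * (\<Sum>k | k < m \<and> dispersion m k \<noteq> 0. e\<^sup>2 * dispersion m k * (1 - ln (e\<^sup>2 * dispersion m k)))"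
  have sub: "?O \<subseteq> {1..Ns}" "?O \<noteq> {}" "?O \<noteq> {1..Ns}" using O rng by blast+
  obtain C2 d2 :: real where d2: "d2 > 0" and h2: "\<And>t U \<psi>. t > 0 \<Longrightarrow> U > 0 \<Longrightarrow> ?e t U < d2 \<Longrightarrow> ground_state Ns Ns t U \<psi> \<Longrightarrow>
      \<bar>entanglement_entropy Ns Ns ?O \<psi> - ?v (?e t U)\<bar> \<le> C2 * (?e t U) ^ 3"
    by (rule ground_state_entropy[OF Ns3 assms(2) sub f2]) (rule that)
  have sub: "?E \<subseteq> {1..Ns}" "?E \<noteq> {}" "?E \<noteq> {1..Ns}" using E rng by blast+
  obtain C3 d3 :: real where d3: "d3 > 0" and h3: "\<And>t U \<psi>. t > 0 \<Longrightarrow> U > 0 \<Longrightarrow> ?e t U < d3 \<Longrightarrow> ground_state Ns Ns t U \<psi> \<Longrightarrow>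
      \<bar>entanglement_entropy Ns Ns ?E \<psi> - ?v (?e t U)\<bar> \<le> C3 * (?e t U) ^ 3"
    by (rule ground_state_entropy[OF Ns3 assms(2) sub f3]) (rule that)
  have n21: "2 \<notin> {1::nat}" by simp
  have sub: "{1} \<subseteq> {1..Ns}" "{1::nat} \<noteq> {}" "{1} \<noteq> {1..Ns}" using rng n21 by blast+
  obtain C4 d4 :: real where d4: "d4 > 0" and h4: "\<And>t U \<psi>. t > 0 \<Longrightarrow> U > 0 \<Longrightarrow> ?e t U < d4 \<Longrightarrow> ground_state Ns Ns t U \<psi> \<Longrightarrow>
      \<bar>entanglement_entropy Ns Ns {1} \<psi> - 2 * (\<Sum>k\<in>{1::nat}. (?e t U)\<^sup>2 * 2 * (1 - ln ((?e t U)\<^sup>2 * 2)))\<bar> \<le> C4 * (?e t U) ^ 3"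
    by (rule ground_state_entropy[OF Ns3 assms(2) sub schmidt_modes_site[OF Ns3]]) (rule that)
  define C where "C = max (max C1 C2) (max C3 C4)"
  define \<delta> where "\<delta> = min (min d1 d2) (min d3 d4)"
  have \<delta>: "\<delta> > 0" using d1 d2 d3 d4 by (simp add: \<delta>_def)
  have "\<bar>entanglement_entropy Ns Ns {1..Ns div 2} \<psi> - 4 * \<epsilon>\<^sup>2 * (1 + ln (1 / \<epsilon>\<^sup>2))\<bar> \<le> C * \<epsilon> ^ 3
       \<and> (\<forall>A \<in> {?O, ?E}. \<bar>entanglement_entropy Ns Ns A \<psi>
              - \<epsilon>\<^sup>2 * (2 * real Ns * (1 + ln (1 / \<epsilon>\<^sup>2))
                       - 2 * (\<Sum>k<m. f_cos (pi * real k / real m)))\<bar> \<le> C * \<epsilon> ^ 3)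
       \<and> \<bar>entanglement_entropy Ns Ns {1} \<psi>
            - (4 * \<epsilon>\<^sup>2 * (1 + ln (1 / \<epsilon>\<^sup>2)) - 4 * ln 2 * \<epsilon>\<^sup>2)\<bar> \<le> C * \<epsilon> ^ 3"
    if t: "t > 0" "U > 0" and e: "\<epsilon> = sqrt 2 * t / U" and small: "\<epsilon> < \<delta>" and gs: "ground_state Ns Ns t U \<psi>" for t U \<epsilon> :: real and \<psi>
  proof -
    have e0: "\<epsilon> > 0" using t e by simp
    have mono: "x \<le> C * \<epsilon> ^ 3" if "x \<le> D * \<epsilon> ^ 3" "D \<le> C" for x D
      using that mult_right_mono[of D C "\<epsilon> ^ 3"] e0 by (meson less_imp_le order_trans zero_le_power)
    have le: "C1 \<le> C" "C2 \<le> C" "C3 \<le> C" "C4 \<le> C" by (auto simp: C_def)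
    have sm: "?e t U < d1" "?e t U < d2" "?e t U < d3" "?e t U < d4" using small e by (auto simp: \<delta>_def)
    \<comment> \<open>Ensures that \<open>{1, m}\<close> has two elements, so that the sum counts
      both cuts of the half ring.\<close>
    have "1 \<noteq> m" using m by simp
    then have v1: "2 * (\<Sum>k\<in>{1, m}. \<epsilon>\<^sup>2 * 1 * (1 - ln (\<epsilon>\<^sup>2 * 1))) = 4 * \<epsilon>\<^sup>2 * (1 + ln (1 / \<epsilon>\<^sup>2))"
      using e0 by (simp add: ln_div)
    have v2: "?v \<epsilon> = \<epsilon>\<^sup>2 * (2 * real Ns * (1 + ln (1 / \<epsilon>\<^sup>2)) - 2 * (\<Sum>k<m. f_cos (pi * real k / real m)))"
      unfolding Nsm by (rule sublattice_entropy_value[OF m e0])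
    have v4: "2 * (\<Sum>k\<in>{1::nat}. \<epsilon>\<^sup>2 * 2 * (1 - ln (\<epsilon>\<^sup>2 * 2))) = 4 * \<epsilon>\<^sup>2 * (1 + ln (1 / \<epsilon>\<^sup>2)) - 4 * ln 2 * \<epsilon>\<^sup>2"
      using e0 by (simp add: ln_div ln_mult algebra_simps)
    show ?thesis
      using mono[OF h1[OF t sm(1) gs, folded e, unfolded v1] le(1)]
        mono[OF h2[OF t sm(2) gs, folded e, unfolded v2] le(2)]
        mono[OF h3[OF t sm(3) gs, folded e, unfolded v2] le(3)]
        mono[OF h4[OF t sm(4) gs, folded e, unfolded v4] le(4)]
      unfolding Nsd by blast
  qed
  then show ?thesis using \<delta> by blast
qed

end
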